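(* Let $K=\mathbb Q(\sqrt2)$ with ring of integers $\mathcal O_K=\mathbb Z[\sqrt2]$, and in $\left(\frac{-1,-1}{K}\right)$ let $$\mathcal G=\mathcal O_K\oplus\mathcal O_K2\mathbf i\oplus\mathcal O_K\tfrac{\mathbf i+\mathbf j}{\sqrt2}\oplus\mathcal O_K\tfrac{(1+\sqrt2)+(\sqrt2-1)\mathbf i+\mathbf j+\mathbf k}{2}.$$ Let $\alpha\in\mathcal O_K$ be totally positive with $\alpha\in(\sqrt2)^e\mathcal O_K\setminus(\sqrt2)^{e+1}\mathcal O_K$. Then $$r_{\mathcal G}(\alpha)=4\sum_{\substack{\delta\mathcal O_K\mid\alpha\mathcal O_K\\ \sqrt2\mathcal O_K\nmid\delta\mathcal O_K}}\operatorname{Nm}(\delta\mathcal O_K)\cdot\begin{cases}1,&e=0,\\2\cdot2,&e=1,\\3\cdot2^2,&e=2,\\2(2^2+\dots+2^e)+2\cdot2^e-2^2,&e\ge3.\end{cases}$$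
   Context: $\left(\frac{-1,-1}{K}\right)$ has $K$-basis $1,\mathbf i,\mathbf j,\mathbf k$ with $\mathbf i^2=\mathbf j^2=-1$, $\mathbf k=\mathbf i\mathbf j=-\mathbf j\mathbf i$, and reduced norm $\operatorname{nrd}(t+x\mathbf i+y\mathbf j+z\mathbf k)=t^2+x^2+y^2+z^2$. $r_{\mathcal G}(\alpha)=\#\{\mathbf q\in\mathcal G:\operatorname{nrd}\mathbf q=\alpha\}$; the sum runs over ideals of $\mathcal O_K$ dividing $\alpha\mathcal O_K$ not divisible by $\sqrt2\mathcal O_K$; $\operatorname{Nm}$ is the absolute norm. *)

theory Defs
  imports
    Complex_Main
    "HOL-Computational_Algebra.Polynomial"
    "HOL-Algebra.QuotRing"
    "HOL-Algebra.Ideal_Product"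
begin

section \<open>Number fields inside the reals\<close>

definition real_subring :: "real set \<Rightarrow> real ring" where
  "real_subring S = \<lparr>carrier = S, mult = (*), one = 1, zero = 0, add = (+)\<rparr>"

lemma real_subring_simps [simp]:
  "carrier (real_subring S) = S"
  "x \<otimes>\<^bsub>real_subring S\<^esub> y = x * y"
  "x \<oplus>\<^bsub>real_subring S\<^esub> y = x + y"
  "\<one>\<^bsub>real_subring S\<^esub> = 1"
  "\<zero>\<^bsub>real_subring S\<^esub> = 0"
  by (simp_all add: real_subring_def)

lemma cring_real_subring:
  assumes 01: "0 \<in> S" "1 \<in> S"
    and closed: "\<And>x y. x \<in> S \<Longrightarrow> y \<in> S \<Longrightarrow> x + y \<in> S"
      "\<And>x y. x \<in> S \<Longrightarrow> y \<in> S \<Longrightarrow> x * y \<in> S" "\<And>x. x \<in> S \<Longrightarrow> - x \<in> S"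
  shows "cring (real_subring S)"
proof (rule cringI)
  show "abelian_group (real_subring S)"
  proof (rule abelian_groupI)
    fix x assume "x \<in> carrier (real_subring S)"
    hence "- x \<in> S" using closed(3) by simp
    thus "\<exists>y\<in>carrier (real_subring S). y \<oplus>\<^bsub>real_subring S\<^esub> x = \<zero>\<^bsub>real_subring S\<^esub>"
      by (intro bexI[of _ "- x"]) simp_all
  qed (simp_all add: 01 closed)
  show "comm_monoid (real_subring S)"
    by (rule comm_monoidI) (simp_all add: 01 closed)
qed (simp add: distrib_right)

definition ring_of_integers :: "real set \<Rightarrow> real set" where
  "ring_of_integers F = {x \<in> F. algebraic_int x}"

text \<open>
  An element of a totally real number field is totally positive if its image under every
  embedding into the reals is positive.
\<close>
definition totally_positive :: "real set \<Rightarrow> real \<Rightarrow> bool" where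
  "totally_positive F x \<longleftrightarrow>
     (\<forall>\<sigma> \<in> ring_hom (real_subring F) (real_subring UNIV). 0 < \<sigma> x)"


section \<open>Ideals\<close>

definition ideal_dvd :: "('a, 'b) ring_scheme \<Rightarrow> 'a set \<Rightarrow> 'a set \<Rightarrow> bool" where
  "ideal_dvd R I J \<longleftrightarrow> (\<exists>C. ideal C R \<and> J = ideal_prod R I C)"

definition ideal_norm :: "('a, 'b) ring_scheme \<Rightarrow> 'a set \<Rightarrow> nat" where
  "ideal_norm R I = card (carrier (R Quot I))"


section \<open>The field $K$ and its ring of integers\<close>

definition Qsqrt2 :: "real set" where
  "Qsqrt2 = {a + b * sqrt 2 | a b. a \<in> \<rat> \<and> b \<in> \<rat>}"

definition OK :: "real set" where
  "OK = ring_of_integers Qsqrt2"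

abbreviation OK_ring :: "real ring" where
  "OK_ring \<equiv> real_subring OK"

lemma sqrt2_irrational: "sqrt 2 \<notin> \<rat>"
proof
  assume "sqrt 2 \<in> \<rat>"
  then obtain m n :: nat where n: "n \<noteq> 0" and eq: "\<bar>sqrt 2\<bar> = real m / real n" and cop: "coprime m n"
    by (rule Rats_abs_nat_div_natE)
  from n eq have "real m = sqrt 2 * real n" by (simp add: field_simps)
  hence "(real m)\<^sup>2 = 2 * (real n)\<^sup>2" by (simp add: power_mult_distrib)
  hence e: "m\<^sup>2 = 2 * n\<^sup>2" by (metis of_nat_eq_iff of_nat_mult of_nat_numeral of_nat_power)
  hence "even (m\<^sup>2)" by simp
  hence m: "even m" by simp
  then obtain k where "m = 2 * k" by (elim evenE)
  with e have "n\<^sup>2 = 2 * k\<^sup>2" by (simp add: power2_eq_square)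
  hence "even (n\<^sup>2)" by simp
  hence "even n" by simp
  with coprime_common_divisor[OF cop m] show False by simp
qed

lemma rat_sqrt2_eq_iff:
  assumes "a \<in> \<rat>" "b \<in> \<rat>" "c \<in> \<rat>" "d \<in> \<rat>"
  shows "a + b * sqrt 2 = c + d * sqrt 2 \<longleftrightarrow> a = c \<and> b = d"
proof
  assume eq: "a + b * sqrt 2 = c + d * sqrt 2"
  have "b = d"
  proof (rule ccontr)
    assume "b \<noteq> d"
    with eq have "sqrt 2 = (c - a) / (b - d)" by (simp add: field_simps)
    moreover have "(c - a) / (b - d) \<in> \<rat>" using assms by auto
    ultimately show False using sqrt2_irrational by simp
  qed
  with eq show "a = c \<and> b = d" by simp
qed auto

lemma field_Qsqrt2: "field (real_subring Qsqrt2)"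
proof -
  have base: "u + v * sqrt 2 \<in> Qsqrt2" if "u \<in> \<rat>" "v \<in> \<rat>" for u v
    using that unfolding Qsqrt2_def by blast
  have closed: "x + y \<in> Qsqrt2" "x * y \<in> Qsqrt2" "- x \<in> Qsqrt2"
    if "x \<in> Qsqrt2" "y \<in> Qsqrt2" for x y
  proof -
    from that obtain a b c d where r: "a \<in> \<rat>" "b \<in> \<rat>" "c \<in> \<rat>" "d \<in> \<rat>"
      and x: "x = a + b * sqrt 2" and y: "y = c + d * sqrt 2" unfolding Qsqrt2_def by blast
    have "x + y = (a + c) + (b + d) * sqrt 2" "x * y = (a * c + 2 * b * d) + (a * d + b * c) * sqrt 2"
      "- x = (- a) + (- b) * sqrt 2"
      by (simp_all add: x y algebra_simps)
    moreover have "a + c \<in> \<rat>" "b + d \<in> \<rat>" "a * c + 2 * b * d \<in> \<rat>" "a * d + b * c \<in> \<rat>" "- a \<in> \<rat>" "- b \<in> \<rat>"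
      using r by auto
    ultimately show "x + y \<in> Qsqrt2" "x * y \<in> Qsqrt2" "- x \<in> Qsqrt2"
      unfolding Qsqrt2_def by blast+
  qed
  have "1 = 1 + 0 * sqrt 2" "0 = 0 + 0 * sqrt 2" by simp_all
  hence c01: "1 \<in> Qsqrt2" "0 \<in> Qsqrt2" unfolding Qsqrt2_def by (blast intro: Rats_0 Rats_1)+
  have cr: "cring (real_subring Qsqrt2)"
    by (rule cring_real_subring) (simp_all add: closed c01)
  show ?thesis
  proof (rule cring.cring_fieldI2[OF cr])
    fix x assume "x \<in> carrier (real_subring Qsqrt2)" "x \<noteq> \<zero>\<^bsub>real_subring Qsqrt2\<^esub>"
    hence "x \<in> Qsqrt2" and nz: "x \<noteq> 0" by auto
    then obtain a b where r: "a \<in> \<rat>" "b \<in> \<rat>" and x: "x = a + b * sqrt 2" unfolding Qsqrt2_def by blast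
    let ?N = "a\<^sup>2 - 2 * b\<^sup>2"
    have prod: "x * (a - b * sqrt 2) = ?N" by (simp add: x algebra_simps power2_eq_square)
    have "a - b * sqrt 2 \<noteq> 0"
    proof
      assume "a - b * sqrt 2 = 0"
      hence "a + (- b) * sqrt 2 = 0 + 0 * sqrt 2" by simp
      hence "a = 0 \<and> - b = 0" by (subst (asm) rat_sqrt2_eq_iff) (use r in auto)
      with nz x show False by simp
    qed
    with prod nz have N: "?N \<noteq> 0" by (metis mult_eq_0_iff)
    have "x * (a / ?N + (- b / ?N) * sqrt 2) = (x * (a - b * sqrt 2)) / ?N"
      by (simp add: field_simps diff_divide_distrib)
    also have "\<dots> = 1" using N prod by simp
    finally have "x * (a / ?N + (- b / ?N) * sqrt 2) = 1" .
    moreover have "a / ?N \<in> \<rat>" "- b / ?N \<in> \<rat>" using r by auto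
    ultimately show "\<exists>y\<in>carrier (real_subring Qsqrt2). x \<otimes>\<^bsub>real_subring Qsqrt2\<^esub> y = \<one>\<^bsub>real_subring Qsqrt2\<^esub>"
      using base[of "a / ?N" "- b / ?N"] by (intro bexI[of _ "a / ?N + (- b / ?N) * sqrt 2"]) simp_all
  qed auto
qed

lemma Rats_bounded_denominator:
  fixes N D :: real
  assumes N: "N \<in> \<rat>" and D: "D \<in> \<int>" "D \<noteq> 0" and b: "\<And>k. D * N ^ k \<in> \<int>"
  shows "N \<in> \<int>"
proof -
  obtain m n :: nat where n: "n \<noteq> 0" and eq: "\<bar>N\<bar> = real m / real n" and cop: "coprime m n"
    using N by (rule Rats_abs_nat_div_natE)
  obtain d where d: "D = of_int d" using D by (elim Ints_cases)
  have dvd: "int n ^ k dvd d" for k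
  proof -
    have "\<bar>D * N ^ k\<bar> \<in> \<int>" using b[of k] by simp
    then obtain z where "\<bar>D * N ^ k\<bar> = of_int z" by (elim Ints_cases)
    hence "of_int \<bar>d\<bar> * (real m / real n) ^ k = of_int z" by (simp add: abs_mult power_abs eq d)
    hence "of_int \<bar>d\<bar> * real m ^ k = of_int z * real n ^ k" using n by (simp add: field_simps)
    hence "real_of_int (\<bar>d\<bar> * int m ^ k) = real_of_int (z * int n ^ k)" by simp
    hence "\<bar>d\<bar> * int m ^ k = z * int n ^ k" by (simp only: of_int_eq_iff)
    hence "int n ^ k dvd \<bar>d\<bar> * int m ^ k" by simp
    moreover have "coprime (int n ^ k) (int m ^ k)" using cop by (simp add: coprime_commute)
    ultimately show ?thesis by (simp add: coprime_dvd_mult_left_iff)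
  qed
  have "n = 1"
  proof (rule ccontr)
    assume "n \<noteq> 1"
    with n have n2: "2 \<le> int n" by simp
    have "int n ^ nat \<bar>d\<bar> \<le> \<bar>d\<bar>" using dvd_imp_le_int[OF _ dvd[of "nat \<bar>d\<bar>"]] D d by simp
    moreover have "(2::int) ^ nat \<bar>d\<bar> \<le> int n ^ nat \<bar>d\<bar>" using n2 by (intro power_mono) auto
    moreover have "int (nat \<bar>d\<bar>) < 2 ^ nat \<bar>d\<bar>"
      by (metis less_exp of_nat_less_iff of_nat_numeral of_nat_power)
    ultimately show False by simp
  qed
  hence "\<bar>N\<bar> \<in> \<int>" using eq by simp
  thus ?thesis by (auto simp: abs_if minus_in_Ints_iff split: if_splits)
qed

lemma OK_eq_Zsqrt2: "OK = {a + b * sqrt 2 | a b. a \<in> \<int> \<and> b \<in> \<int>}" (is "_ = ?Z")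
proof
  have Zadd: "x + y \<in> ?Z" and Zmult: "x * y \<in> ?Z" if "x \<in> ?Z" "y \<in> ?Z" for x y
  proof -
    from that obtain a b c d where r: "a \<in> \<int>" "b \<in> \<int>" "c \<in> \<int>" "d \<in> \<int>"
      and x: "x = a + b * sqrt 2" and y: "y = c + d * sqrt 2" by blast
    have "x + y = (a + c) + (b + d) * sqrt 2" "x * y = (a * c + 2 * b * d) + (a * d + b * c) * sqrt 2"
      by (simp_all add: x y algebra_simps)
    moreover have "a + c \<in> \<int>" "b + d \<in> \<int>" "a * c + 2 * b * d \<in> \<int>" "a * d + b * c \<in> \<int>"
      using r by auto
    ultimately show "x + y \<in> ?Z" "x * y \<in> ?Z" by blast+
  qed
  have Zint: "x \<in> ?Z" if "x \<in> \<int>" for x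
  proof -
    have "x = x + 0 * sqrt 2" by simp
    thus ?thesis using that Ints_0 by blast
  qed
  have Zpow: "x ^ k \<in> ?Z" if "x \<in> ?Z" for x k
  proof (induction k)
    case 0
    show ?case using Zint[of 1] by simp
  next
    case (Suc k)
    show ?case using Zmult[OF that Suc] by simp
  qed
  have Zsum: "(\<Sum>i\<in>A. f i) \<in> ?Z" if "\<And>i. i \<in> A \<Longrightarrow> f i \<in> ?Z" for f and A :: "nat set"
    using that
  proof (induction A rule: infinite_finite_induct)
    case (insert i A)
    have "f i \<in> ?Z" "sum f A \<in> ?Z" using insert by blast+
    thus ?case using insert.hyps Zadd[of "f i" "sum f A"] by simp
  qed (use Zint[of 0] in simp_all)
  have norm_int: "a\<^sup>2 - 2 * b\<^sup>2 \<in> \<int>"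
    if ab: "a \<in> \<rat>" "b \<in> \<rat>" and D: "D \<in> \<int>" "D \<noteq> 0" and bd: "\<And>k. D * (a + b * sqrt 2) ^ k \<in> ?Z" for a b D :: real
  proof (rule Rats_bounded_denominator)
    show "a\<^sup>2 - 2 * b\<^sup>2 \<in> \<rat>" using ab by auto
    show "D\<^sup>2 \<in> \<int>" "D\<^sup>2 \<noteq> 0" using D by auto
    fix k
    have "\<exists>u v. u \<in> \<rat> \<and> v \<in> \<rat> \<and> (a + b * sqrt 2) ^ k = u + v * sqrt 2 \<and> u\<^sup>2 - 2 * v\<^sup>2 = (a\<^sup>2 - 2 * b\<^sup>2) ^ k"
    proof (induction k)
      case 0
      show ?case by (intro exI[of _ 1] exI[of _ 0]) auto
    next
      case (Suc k)
      then obtain u v where uv: "u \<in> \<rat>" "v \<in> \<rat>" "(a + b * sqrt 2) ^ k = u + v * sqrt 2"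
        "u\<^sup>2 - 2 * v\<^sup>2 = (a\<^sup>2 - 2 * b\<^sup>2) ^ k" by blast
      have "(a * u + 2 * b * v)\<^sup>2 - 2 * (a * v + b * u)\<^sup>2 = (a\<^sup>2 - 2 * b\<^sup>2) * (u\<^sup>2 - 2 * v\<^sup>2)"
        by (simp add: algebra_simps power2_eq_square)
      moreover have "(a + b * sqrt 2) ^ Suc k = (a * u + 2 * b * v) + (a * v + b * u) * sqrt 2"
        by (simp add: uv(3) algebra_simps)
      ultimately show ?case using ab uv by (intro exI[of _ "a * u + 2 * b * v"] exI[of _ "a * v + b * u"]) auto
    qed
    then obtain u v where uv: "u \<in> \<rat>" "v \<in> \<rat>" "(a + b * sqrt 2) ^ k = u + v * sqrt 2"
      "u\<^sup>2 - 2 * v\<^sup>2 = (a\<^sup>2 - 2 * b\<^sup>2) ^ k" by blast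
    from bd[of k] obtain m n where mn: "m \<in> \<int>" "n \<in> \<int>" "D * (a + b * sqrt 2) ^ k = m + n * sqrt 2" by blast
    have "D * u + (D * v) * sqrt 2 = m + n * sqrt 2" using mn(3) uv(3) by (simp add: algebra_simps)
    moreover have "D \<in> \<rat>" "m \<in> \<rat>" "n \<in> \<rat>" using D mn Ints_subset_Rats by blast+
    ultimately have "D * u = m \<and> D * v = n" using uv by (subst (asm) rat_sqrt2_eq_iff) auto
    hence "D\<^sup>2 * (u\<^sup>2 - 2 * v\<^sup>2) = m\<^sup>2 - 2 * n\<^sup>2" by (auto simp: algebra_simps power2_eq_square)
    thus "D\<^sup>2 * (a\<^sup>2 - 2 * b\<^sup>2) ^ k \<in> \<int>" using uv(4) mn by auto
  qed
  show "OK \<subseteq> ?Z"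
  proof
    fix x assume "x \<in> OK"
    then obtain a b where ab: "a \<in> \<rat>" "b \<in> \<rat>" and x: "x = a + b * sqrt 2" and ai: "algebraic_int x"
      unfolding OK_def ring_of_integers_def Qsqrt2_def by blast
    from ai obtain p where lc: "lead_coeff p = 1" and ci: "\<And>i. coeff p i \<in> \<int>" and root: "poly p x = 0"
      by (auto elim: algebraic_int.cases)
    define n where "n = degree p"
    obtain a1 a2 where a1: "a = of_int a1 / of_int a2" "a2 > 0"
      using ab(1) by (metis Rats_cases' )
    obtain b1 b2 where b1: "b = of_int b1 / of_int b2" "b2 > 0"
      using ab(2) by (metis Rats_cases')
    define d where "d = real_of_int (a2 * b2)"
    have d: "d \<in> \<int>" "d \<noteq> 0" using a1 b1 by (auto simp: d_def)
    have "real_of_int a1 = a * of_int a2" "real_of_int b1 = b * of_int b2" using a1 b1 by simp_all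
    hence "d * x = of_int (a1 * b2) + of_int (b1 * a2) * sqrt 2" by (simp add: d_def x algebra_simps)
    hence dx: "d * x \<in> ?Z" using Ints_of_int by blast
    define D where "D = d ^ n"
    have D: "D \<in> \<int>" "D \<noteq> 0" using d by (auto simp: D_def)
    have bd: "D * x ^ k \<in> ?Z" for k
    proof (induction k rule: less_induct)
      case (less k)
      show ?case
      proof (cases "k < n")
        case True
        have "D * x ^ k = d ^ (n - k) * (d * x) ^ k"
          using True by (simp add: D_def power_mult_distrib flip: power_add mult.assoc)
        moreover have "d ^ (n - k) * (d * x) ^ k \<in> ?Z"
          by (rule Zmult[OF Zint Zpow[OF dx]]) (use d in auto)
        ultimately show ?thesis by (simp only:)
      next
        case False
        have "(\<Sum>i<n. coeff p i * x ^ i) + x ^ n = 0"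
          using root lc by (simp add: poly_altdef n_def flip: lessThan_Suc_atMost)
        hence xn: "x ^ n = (\<Sum>i<n. - coeff p i * x ^ i)" by (simp add: sum_negf)
        have "D * x ^ (k - n) * x ^ n = (\<Sum>i<n. - coeff p i * (D * x ^ (k - n + i)))"
          unfolding xn sum_distrib_left by (intro sum.cong) (simp_all add: power_add)
        moreover have "D * x ^ (k - n) * x ^ n = D * x ^ k" using False by (simp flip: power_add mult.assoc)
        moreover have "(\<Sum>i<n. - coeff p i * (D * x ^ (k - n + i))) \<in> ?Z"
        proof (rule Zsum, rule Zmult)
          fix i assume "i \<in> {..<n}"
          thus "D * x ^ (k - n + i) \<in> ?Z" using False by (intro less) auto
          show "- coeff p i \<in> ?Z" by (rule Zint) (use ci in auto)
        qed
        ultimately show ?thesis by (simp only:)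
      qed
    qed
    have bd1: "D * (x + 1) ^ k \<in> ?Z" for k
    proof -
      have "D * (x + 1) ^ k = (\<Sum>i\<le>k. of_nat (k choose i) * (D * x ^ i))"
        unfolding binomial_ring sum_distrib_left by (intro sum.cong) simp_all
      moreover have "(\<Sum>i\<le>k. of_nat (k choose i) * (D * x ^ i)) \<in> ?Z"
        by (rule Zsum, rule Zmult[OF Zint bd]) auto
      ultimately show ?thesis by (simp only:)
    qed
    have N0: "a\<^sup>2 - 2 * b\<^sup>2 \<in> \<int>" using norm_int[OF ab D] bd x by blast
    have x1: "x + 1 = (a + 1) + b * sqrt 2" by (simp add: x)
    have "a + 1 \<in> \<rat>" using ab by auto
    hence "(a + 1)\<^sup>2 - 2 * b\<^sup>2 \<in> \<int>" using norm_int[OF _ ab(2) D, of "a + 1"] bd1 x1 by metis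
    hence "((a + 1)\<^sup>2 - 2 * b\<^sup>2) - (a\<^sup>2 - 2 * b\<^sup>2) - 1 \<in> \<int>" using N0 by (rule Ints_diff[OF Ints_diff]) simp
    hence "2 * a \<in> \<int>" by (simp add: power2_eq_square algebra_simps)
    then obtain A where A: "2 * a = of_int A" by (elim Ints_cases)
    obtain N where N: "a\<^sup>2 - 2 * b\<^sup>2 = of_int N" using N0 by (elim Ints_cases)
    have "2 * (2 * b)\<^sup>2 = (2 * a)\<^sup>2 - 4 * (a\<^sup>2 - 2 * b\<^sup>2)" by (simp add: power2_eq_square algebra_simps)
    also have "\<dots> = of_int (A\<^sup>2 - 4 * N)" by (simp add: A N)
    finally have B2: "2 * (2 * b)\<^sup>2 = of_int (A\<^sup>2 - 4 * N)" .
    have "2 * b \<in> \<int>"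
    proof -
      have "2 * b \<in> \<rat>" using ab by auto
      then obtain r s :: nat where s: "s \<noteq> 0" and rs: "\<bar>2 * b\<bar> = real r / real s" and cop: "coprime r s"
        by (rule Rats_abs_nat_div_natE)
      have "2 * \<bar>2 * b\<bar>\<^sup>2 = of_int (A\<^sup>2 - 4 * N)" using B2 by simp
      hence "2 * (real r)\<^sup>2 = of_int (A\<^sup>2 - 4 * N) * (real s)\<^sup>2"
        unfolding rs using s by (simp add: field_simps)
      hence "real_of_int (2 * (int r)\<^sup>2) = of_int ((A\<^sup>2 - 4 * N) * (int s)\<^sup>2)" by simp
      hence "2 * (int r)\<^sup>2 = (A\<^sup>2 - 4 * N) * (int s)\<^sup>2" by (simp only: of_int_eq_iff)
      hence "(int s)\<^sup>2 dvd 2 * (int r)\<^sup>2" by simp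
      moreover have "coprime ((int s)\<^sup>2) ((int r)\<^sup>2)" using cop by (simp add: coprime_commute)
      ultimately have "(int s)\<^sup>2 dvd 2" by (simp add: coprime_dvd_mult_left_iff)
      hence le: "(int s)\<^sup>2 \<le> 2" by (rule zdvd_imp_le) simp
      have "s < 2"
      proof (rule ccontr)
        assume "\<not> s < 2"
        hence "2 ^ 2 \<le> (int s)\<^sup>2" by (intro power_mono) auto
        with le show False by simp
      qed
      with s have "s = 1" by simp
      hence "\<bar>2 * b\<bar> \<in> \<int>" using rs by simp
      thus ?thesis by (auto simp: abs_if minus_in_Ints_iff split: if_splits)
    qed
    then obtain B where B: "2 * b = of_int B" by (elim Ints_cases)
    have "real_of_int (2 * B\<^sup>2) = of_int (A\<^sup>2 - 4 * N)" using B2 B by simp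
    hence AB: "2 * B\<^sup>2 = A\<^sup>2 - 4 * N" by (simp only: of_int_eq_iff)
    hence "A\<^sup>2 = 2 * (B\<^sup>2 + 2 * N)" by simp
    hence "even (A\<^sup>2)" by simp
    hence "even A" by simp
    then obtain a' where a': "A = 2 * a'" by (elim evenE)
    with AB have "B\<^sup>2 = 2 * (a'\<^sup>2 - N)" by (simp add: power_mult_distrib)
    hence "even (B\<^sup>2)" by simp
    hence "even B" by simp
    then obtain b' where b': "B = 2 * b'" by (elim evenE)
    have "a = of_int a'" "b = of_int b'" using A B a' b' by simp_all
    thus "x \<in> ?Z" using x Ints_of_int by blast
  qed
  show "?Z \<subseteq> OK"
  proof
    fix x assume "x \<in> ?Z"
    then obtain a b where ab: "a \<in> \<int>" "b \<in> \<int>" and x: "x = a + b * sqrt 2" by blast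
    have "algebraic_int x"
    proof (rule algebraic_int.intros)
      let ?p = "[: a\<^sup>2 - 2 * b\<^sup>2, - 2 * a, 1 :]"
      show "lead_coeff ?p = 1" by simp
      show "\<forall>i. coeff ?p i \<in> \<int>" using ab by (auto simp: coeff_pCons split: nat.splits)
      show "poly ?p x = 0" by (simp add: x algebra_simps power2_eq_square)
    qed
    moreover have "x \<in> Qsqrt2"
      using ab Ints_subset_Rats unfolding x Qsqrt2_def by blast
    ultimately show "x \<in> OK" by (simp add: OK_def ring_of_integers_def)
  qed
qed

lemma cring_OK: "cring OK_ring"
proof -
  have closed: "x + y \<in> OK" "x * y \<in> OK" "- x \<in> OK"
    if "x \<in> OK" "y \<in> OK" for x y
  proof -
    from that obtain a b c d where r: "a \<in> \<int>" "b \<in> \<int>" "c \<in> \<int>" "d \<in> \<int>"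
      and x: "x = a + b * sqrt 2" and y: "y = c + d * sqrt 2" unfolding OK_eq_Zsqrt2 by blast
    have "x + y = (a + c) + (b + d) * sqrt 2" "x * y = (a * c + 2 * b * d) + (a * d + b * c) * sqrt 2"
      "- x = (- a) + (- b) * sqrt 2"
      by (simp_all add: x y algebra_simps)
    moreover have "a + c \<in> \<int>" "b + d \<in> \<int>" "a * c + 2 * b * d \<in> \<int>" "a * d + b * c \<in> \<int>" "- a \<in> \<int>" "- b \<in> \<int>"
      using r by auto
    ultimately show "x + y \<in> OK" "x * y \<in> OK" "- x \<in> OK"
      unfolding OK_eq_Zsqrt2 by blast+
  qed
  have c01: "1 \<in> OK" "0 \<in> OK"
  proof -
    have "1 = 1 + 0 * sqrt 2" "0 = 0 + 0 * sqrt 2" by simp_all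
    thus "1 \<in> OK" "0 \<in> OK" unfolding OK_eq_Zsqrt2 by (blast intro: Ints_0 Ints_1)+
  qed
  show ?thesis
    by (rule cring_real_subring) (simp_all add: closed c01)
qed

lemma totally_positive_Qsqrt2_iff:
  assumes ab: "a \<in> \<rat>" "b \<in> \<rat>"
  shows "totally_positive Qsqrt2 (a + b * sqrt 2) \<longleftrightarrow> a + b * sqrt 2 > 0 \<and> a - b * sqrt 2 > 0"
proof
  assume tp: "totally_positive Qsqrt2 (a + b * sqrt 2)"
  have "(\<lambda>x. x) \<in> ring_hom (real_subring Qsqrt2) (real_subring UNIV)"
    by (auto intro!: ring_hom_memI)
  with tp have pos: "a + b * sqrt 2 > 0" by (auto simp: totally_positive_def)
  define \<sigma> where "\<sigma> x = (THE y. \<exists>c d. c \<in> \<rat> \<and> d \<in> \<rat> \<and> x = c + d * sqrt 2 \<and> y = c - d * sqrt 2)" for x :: real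
  have \<sigma>: "\<sigma> (c + d * sqrt 2) = c - d * sqrt 2" if "c \<in> \<rat>" "d \<in> \<rat>" for c d
    unfolding \<sigma>_def
    by (rule the_equality) (use that in \<open>auto simp: rat_sqrt2_eq_iff\<close>)
  have "\<sigma> \<in> ring_hom (real_subring Qsqrt2) (real_subring UNIV)"
  proof (rule ring_hom_memI)
    fix x y assume "x \<in> carrier (real_subring Qsqrt2)" "y \<in> carrier (real_subring Qsqrt2)"
    then obtain c d c' d' where r: "c \<in> \<rat>" "d \<in> \<rat>" "c' \<in> \<rat>" "d' \<in> \<rat>"
      and x: "x = c + d * sqrt 2" and y: "y = c' + d' * sqrt 2" by (auto simp: Qsqrt2_def)
    have "x * y = (c * c' + 2 * d * d') + (c * d' + d * c') * sqrt 2"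
      "x + y = (c + c') + (d + d') * sqrt 2" by (simp_all add: x y algebra_simps)
    hence "\<sigma> (x * y) = (c * c' + 2 * d * d') - (c * d' + d * c') * sqrt 2"
      "\<sigma> (x + y) = (c + c') - (d + d') * sqrt 2" using r by (simp_all only:) (intro \<sigma>; auto)+
    thus "\<sigma> (x \<otimes>\<^bsub>real_subring Qsqrt2\<^esub> y) = \<sigma> x \<otimes>\<^bsub>real_subring UNIV\<^esub> \<sigma> y"
      "\<sigma> (x \<oplus>\<^bsub>real_subring Qsqrt2\<^esub> y) = \<sigma> x \<oplus>\<^bsub>real_subring UNIV\<^esub> \<sigma> y"
      unfolding real_subring_simps using \<sigma>[OF r(1,2)] \<sigma>[OF r(3,4)] x y
      by (simp_all only:) (simp_all add: algebra_simps)
  next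
    show "\<sigma> \<one>\<^bsub>real_subring Qsqrt2\<^esub> = \<one>\<^bsub>real_subring UNIV\<^esub>" using \<sigma>[of 1 0] by simp
  qed auto
  with tp have "\<sigma> (a + b * sqrt 2) > 0" by (auto simp: totally_positive_def)
  with pos \<sigma> ab show "a + b * sqrt 2 > 0 \<and> a - b * sqrt 2 > 0" by simp
next
  assume pos: "a + b * sqrt 2 > 0 \<and> a - b * sqrt 2 > 0"
  show "totally_positive Qsqrt2 (a + b * sqrt 2)"
    unfolding totally_positive_def
  proof
    fix \<sigma> assume hom: "\<sigma> \<in> ring_hom (real_subring Qsqrt2) (real_subring UNIV)"
    have K: "x \<in> Qsqrt2" if "x \<in> \<rat>" for x
    proof -
      have "x = x + 0 * sqrt 2" by simp
      thus ?thesis using that Rats_0 unfolding Qsqrt2_def by blast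
    qed
    have "sqrt 2 = 0 + 1 * sqrt 2" by simp
    hence Ks: "sqrt 2 \<in> Qsqrt2" unfolding Qsqrt2_def by (blast intro: Rats_0 Rats_1)
    have mult: "\<sigma> (x * y) = \<sigma> x * \<sigma> y" and add: "\<sigma> (x + y) = \<sigma> x + \<sigma> y"
      if "x \<in> Qsqrt2" "y \<in> Qsqrt2" for x y
      using ring_hom_mult[OF hom, of x y] ring_hom_add[OF hom, of x y] that by simp_all
    have one: "\<sigma> 1 = 1" using ring_hom_one[OF hom] by simp
    have zero: "\<sigma> 0 = 0" using add[of 0 0] K by simp
    have nat: "\<sigma> (of_nat n) = of_nat n" for n
      by (induction n) (auto simp: zero one add K)
    have int: "\<sigma> (of_int z) = of_int z" for z
    proof (cases "z \<ge> 0")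
      case True
      thus ?thesis using nat[of "nat z"] by simp
    next
      case False
      have "\<sigma> (of_int z + of_nat (nat (- z))) = \<sigma> (of_int z) + \<sigma> (of_nat (nat (- z)))"
        by (rule add) (auto intro: K)
      thus ?thesis using False nat[of "nat (- z)"] zero by simp
    qed
    have rat: "\<sigma> x = x" if x: "x \<in> \<rat>" for x
    proof -
      obtain m n where mn: "x = of_int m / of_int n" "n > 0" using x by (metis Rats_cases')
      have "\<sigma> (x * of_int n) = \<sigma> x * \<sigma> (of_int n)" using x by (intro mult K) auto
      moreover have "x * of_int n = of_int m" using mn(2) by (simp add: mn(1))
      ultimately have "\<sigma> x * of_int n = x * of_int n" by (simp only: int)
      thus ?thesis using mn(2) by simp
    qed
    have "\<sigma> (sqrt 2) * \<sigma> (sqrt 2) = 2" using mult[OF Ks Ks] rat[of 2] by simp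
    hence "(\<sigma> (sqrt 2))\<^sup>2 = (sqrt 2)\<^sup>2" by (simp add: power2_eq_square)
    hence "\<sigma> (sqrt 2) = sqrt 2 \<or> \<sigma> (sqrt 2) = - sqrt 2" by (simp only: power2_eq_iff)
    moreover have "b * sqrt 2 \<in> Qsqrt2"
    proof -
      have "b * sqrt 2 = 0 + b * sqrt 2" by simp
      thus ?thesis using ab Rats_0 unfolding Qsqrt2_def by blast
    qed
    hence "\<sigma> (a + b * sqrt 2) = a + b * \<sigma> (sqrt 2)"
      using add[of a "b * sqrt 2"] mult[of b "sqrt 2"] ab K Ks rat by simp
    ultimately show "0 < \<sigma> (a + b * sqrt 2)" using pos by auto
  qed
qed


section \<open>Quaternions\<close>

text \<open>
  Hamilton's quaternions over the reals. For a subfield $F$ of the reals, the quaternion algebra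
  $(-1,-1)$ over $F$ is the $F$-subalgebra of quaternions with coordinates in $F$.
\<close>

datatype quat = Quat (qre: real) (qi: real) (qj: real) (qk: real)

lemma quat_eq_iff: "p = q \<longleftrightarrow> qre p = qre q \<and> qi p = qi q \<and> qj p = qj q \<and> qk p = qk q"
  by (cases p; cases q) auto

instantiation quat :: real_algebra_1
begin

definition "0 = Quat 0 0 0 0"
definition "1 = Quat 1 0 0 0"
definition "p + q = Quat (qre p + qre q) (qi p + qi q) (qj p + qj q) (qk p + qk q)"
definition "- p = Quat (- qre p) (- qi p) (- qj p) (- qk p)"
definition "p - q = Quat (qre p - qre q) (qi p - qi q) (qj p - qj q) (qk p - qk q)"
definition "p * q = Quat
  (qre p * qre q - qi p * qi q - qj p * qj q - qk p * qk q)
  (qre p * qi q + qi p * qre q + qj p * qk q - qk p * qj q)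
  (qre p * qj q - qi p * qk q + qj p * qre q + qk p * qi q)
  (qre p * qk q + qi p * qj q - qj p * qi q + qk p * qre q)"
definition "scaleR c p = Quat (c * qre p) (c * qi p) (c * qj p) (c * qk p)"

lemmas quat_arith_defs = zero_quat_def one_quat_def plus_quat_def uminus_quat_def
  minus_quat_def times_quat_def scaleR_quat_def

instance
  by standard (auto simp: quat_arith_defs quat_eq_iff algebra_simps)

end

definition quat_i :: quat where "quat_i = Quat 0 1 0 0"
definition quat_j :: quat where "quat_j = Quat 0 0 1 0"
definition quat_k :: quat where "quat_k = Quat 0 0 0 1"

lemma quat_relations:
  "quat_i * quat_i = -1" "quat_j * quat_j = -1"
  "quat_i * quat_j = quat_k" "quat_j * quat_i = - quat_k"
  by (simp_all add: quat_i_def quat_j_def quat_k_def quat_arith_defs)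

lemma quat_basis: "Quat t x y z = t *\<^sub>R 1 + x *\<^sub>R quat_i + y *\<^sub>R quat_j + z *\<^sub>R quat_k"
  by (simp add: quat_i_def quat_j_def quat_k_def quat_arith_defs)

definition quat_algebra :: "real set \<Rightarrow> quat set" where
  "quat_algebra F = {Quat t x y z | t x y z. t \<in> F \<and> x \<in> F \<and> y \<in> F \<and> z \<in> F}"

definition nrd :: "quat \<Rightarrow> real" where
  "nrd q = (qre q)\<^sup>2 + (qi q)\<^sup>2 + (qj q)\<^sup>2 + (qk q)\<^sup>2"

lemma nrd_eq_mult_conj: "q * Quat (qre q) (- qi q) (- qj q) (- qk q) = of_real (nrd q)"
  by (simp add: of_real_def nrd_def quat_arith_defs power2_eq_square)


section \<open>The lattice $\mathcal G$\<close>

definition G_basis3 :: quat where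
  "G_basis3 = (1 / sqrt 2) *\<^sub>R (quat_i + quat_j)"

definition G_basis4 :: quat where
  "G_basis4 = (1 / 2) *\<^sub>R
     ((1 + sqrt 2) *\<^sub>R 1 + (sqrt 2 - 1) *\<^sub>R quat_i + quat_j + quat_k)"

definition G :: "quat set" where
  "G = {a *\<^sub>R 1 + b *\<^sub>R (2 *\<^sub>R quat_i) + c *\<^sub>R G_basis3 + d *\<^sub>R G_basis4 | a b c d.
          a \<in> OK \<and> b \<in> OK \<and> c \<in> OK \<and> d \<in> OK}"

lemma G_direct_sum:
  assumes "a *\<^sub>R 1 + b *\<^sub>R (2 *\<^sub>R quat_i) + c *\<^sub>R G_basis3 + d *\<^sub>R G_basis4 =
           a' *\<^sub>R 1 + b' *\<^sub>R (2 *\<^sub>R quat_i) + c' *\<^sub>R G_basis3 + d' *\<^sub>R G_basis4"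
  shows "a = a' \<and> b = b' \<and> c = c' \<and> d = d'"
proof -
  have d: "d = d'" using assms
    by (simp add: G_basis3_def G_basis4_def quat_i_def quat_j_def quat_k_def quat_arith_defs)
  hence c: "c = c'" using assms
    by (simp add: G_basis3_def G_basis4_def quat_i_def quat_j_def quat_k_def quat_arith_defs)
  from c d show ?thesis using assms
    by (simp add: G_basis3_def G_basis4_def quat_i_def quat_j_def quat_k_def quat_arith_defs)
qed

lemma G_subset_quat_algebra: "G \<subseteq> quat_algebra Qsqrt2"
proof
  fix q assume "q \<in> G"
  then obtain a b c d where abcd: "a \<in> OK" "b \<in> OK" "c \<in> OK" "d \<in> OK"
    and q: "q = a *\<^sub>R 1 + b *\<^sub>R (2 *\<^sub>R quat_i) + c *\<^sub>R G_basis3 + d *\<^sub>R G_basis4"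
    unfolding G_def by blast
  have K: "a \<in> Qsqrt2" "b \<in> Qsqrt2" "c \<in> Qsqrt2" "d \<in> Qsqrt2"
    using abcd by (simp_all add: OK_def ring_of_integers_def)
  interpret F: field "real_subring Qsqrt2" by (rule field_Qsqrt2)
  have add: "x + y \<in> Qsqrt2" and mult: "x * y \<in> Qsqrt2" if "x \<in> Qsqrt2" "y \<in> Qsqrt2" for x y
    using F.a_closed[of x y] F.m_closed[of x y] that by simp_all
  have base: "u + v * sqrt 2 \<in> Qsqrt2" if "u \<in> \<rat>" "v \<in> \<rat>" for u v
    using that unfolding Qsqrt2_def by blast
  have s: "1 / sqrt 2 = 0 + (1/2) * sqrt 2" by (simp add: field_simps)
  have cK: "1 / sqrt 2 \<in> Qsqrt2" "2 \<in> Qsqrt2" "1/2 \<in> Qsqrt2"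
    "(1 + sqrt 2) / 2 \<in> Qsqrt2" "(sqrt 2 - 1) / 2 \<in> Qsqrt2"
    using base[of 0 "1/2"] base[of 2 0] base[of "1/2" 0] base[of "1/2" "1/2"] base[of "-1/2" "1/2"]
    by (simp_all add: s add_divide_distrib diff_divide_distrib)
  have "q = Quat (a + d * ((1 + sqrt 2) / 2)) (b * 2 + c * (1 / sqrt 2) + d * ((sqrt 2 - 1) / 2))
              (c * (1 / sqrt 2) + d * (1/2)) (d * (1/2))"
    by (simp add: q G_basis3_def G_basis4_def quat_i_def quat_j_def quat_k_def quat_arith_defs)
  moreover have "a + d * ((1 + sqrt 2) / 2) \<in> Qsqrt2"
    "b * 2 + c * (1 / sqrt 2) + d * ((sqrt 2 - 1) / 2) \<in> Qsqrt2"
    "c * (1 / sqrt 2) + d * (1/2) \<in> Qsqrt2" "d * (1/2) \<in> Qsqrt2"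
    by (intro add mult K cK)+
  ultimately show "q \<in> quat_algebra Qsqrt2" unfolding quat_algebra_def by blast
qed

definition r_G :: "real \<Rightarrow> nat" where
  "r_G \<alpha> = card {q \<in> G. nrd q = \<alpha>}"

end

theory Submission
  imports Defs
begin

text \<open>
  The lattice $\mathcal G$ is an order of index $8$ in a maximal order $\mathcal O$, namely the
  elements whose image in $M_2(\mathcal O_K / 2\sqrt 2)$ is upper triangular.

  The maximal order is norm-Euclidean: its elements are $p + r\sqrt 2$ with $p$ in the Hurwitz
  lattice and $2r$ in the root lattice $D_4$, and rounding in these two lattices suffices. Hence all
  left ideals are principal, and for a totally positive prime $\pi$ of norm $q$ the splitting of
  $\mathcal O / \pi$ gives the Hecke recursion
  $r(\pi\alpha) + q\, r(\alpha/\pi) = (q + 1)\, r(\alpha)$ for the representation numbers of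
  $\mathcal O$. The divisor sum obeys the same recursion, so that
  $r_{\mathcal O}(\alpha) = 48\,(2^{e+1} - 1) \sum \mathrm{Nm}(\delta)$, the sum running over the
  odd divisors.

  For $x \in \mathcal O$ the number of units $u$ of reduced norm $1$ with $ux \in \mathcal G$ depends
  only on the power of $\sqrt 2$ dividing the first column of the image of $x$. The elements whose
  first column vanishes modulo $(\sqrt 2)^s$ form a left ideal generated by an element of reduced
  norm $(2 + \sqrt 2)^s$. Averaging over the $48$ units expresses $12\, r_{\mathcal G}(\alpha)$ as
  $r(\alpha) + r(\alpha/\nu) + 2 r(\alpha/\nu^2) + 8 r(\alpha/\nu^3)$ with $\nu = 2 + \sqrt 2$.
\<close>


section \<open>Arithmetic of $\mathbb{Z}[\sqrt 2]$\<close>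

text \<open>Exact norms, not just norms up to units, come from the unit 1 + sqrt 2 of norm -1: every
  prime has a totally positive associate, and every totally positive unit is a square. A generator
  whose reduced norm is a prime times a unit can therefore be rescaled to have the prime itself as
  norm.

  The obstacle in the Euclidean step is that the covering radii of the two lattices only bound the
  norm of the remainder by that of the divisor, with equality possible. Ties are broken by making
  the rational and irrational parts of the remainder non-orthogonal.

  The weights 1, 1, 2, 8 come from the projective line. Modulo (sqrt 2)^s with s = 3, 2, 1, 0 it has
  12, 6, 3, 1 points, and the 48 units meet them equally often, namely 4, 8, 16, 48 times. The
  successive increments 4, 4, 8, 32, divided by 4, are the weights. The case distinction in e
  records which of the quotients \<alpha>/\<nu>^k are still integral.\<close>

datatype zs2 = ZS (rpart: int) (spart: int)

lemma zs2_eq_iff: "x = y \<longleftrightarrow> rpart x = rpart y \<and> spart x = spart y"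
  by (cases x; cases y) auto

definition emb :: "zs2 \<Rightarrow> real" where
  "emb x = of_int (rpart x) + of_int (spart x) * sqrt 2"

lemma emb_inj: "emb x = emb y \<longleftrightarrow> x = y"
  by (auto simp: emb_def rat_sqrt2_eq_iff zs2_eq_iff)

instantiation zs2 :: idom
begin

definition "0 = ZS 0 0"
definition "1 = ZS 1 0"
definition "x + y = ZS (rpart x + rpart y) (spart x + spart y)"
definition "- x = ZS (- rpart x) (- spart x)"
definition "x - y = ZS (rpart x - rpart y) (spart x - spart y)"
definition "x * y = ZS (rpart x * rpart y + 2 * spart x * spart y) (rpart x * spart y + spart x * rpart y)"

lemmas zs2_defs = zero_zs2_def one_zs2_def plus_zs2_def uminus_zs2_def minus_zs2_def times_zs2_def

lemma emb_mult: "emb (x * y) = emb x * emb y"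
  by (simp add: emb_def zs2_defs algebra_simps)

lemma emb_eq_0: "emb x = 0 \<longleftrightarrow> x = 0"
  using emb_inj[of x 0] by (simp add: emb_def zs2_defs)

instance
proof
  fix a b :: zs2
  assume "a \<noteq> 0" "b \<noteq> 0"
  thus "a * b \<noteq> 0" by (metis emb_mult emb_eq_0 mult_eq_0_iff)
qed (auto simp: zs2_defs algebra_simps)

end

lemma zs2_sel [simp]:
  "rpart 0 = 0" "spart 0 = 0" "rpart 1 = 1" "spart 1 = 0"
  "rpart (x + y) = rpart x + rpart y" "spart (x + y) = spart x + spart y"
  "rpart (- x) = - rpart x" "spart (- x) = - spart x"
  "rpart (x - y) = rpart x - rpart y" "spart (x - y) = spart x - spart y"
  by (simp_all add: zs2_defs)

lemma zs2_sel_mult: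
  "rpart (x * y) = rpart x * rpart y + 2 * spart x * spart y"
  "spart (x * y) = rpart x * spart y + spart x * rpart y"
  by (simp_all add: zs2_defs)

lemma of_nat_zs2: "(of_nat n :: zs2) = ZS (int n) 0"
  by (induction n) (auto simp: zs2_defs)

instance zs2 :: ring_char_0
  by standard (auto intro!: injI simp: of_nat_zs2)

lemma of_int_zs2: "(of_int n :: zs2) = ZS n 0"
  by (cases n rule: int_diff_cases) (simp add: of_nat_zs2 zs2_defs)

lemma numeral_zs2: "(numeral n :: zs2) = ZS (numeral n) 0"
  using of_int_zs2[of "numeral n"] by simp

lemma zs2_sel_num [simp]: "rpart (of_int n) = n" "spart (of_int n) = 0"
  "rpart (numeral k) = numeral k" "spart (numeral k) = 0"
  by (simp_all add: of_int_zs2 numeral_zs2)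

lemma emb_simps [simp]:
  "emb 0 = 0" "emb 1 = 1" "emb (x + y) = emb x + emb y" "emb (- x) = - emb x"
  "emb (x - y) = emb x - emb y" "emb (x * y) = emb x * emb y" "emb (of_int n) = of_int n"
  "emb (numeral k) = numeral k"
  by (simp_all add: emb_mult) (simp_all add: emb_def algebra_simps)

lemma emb_power [simp]: "emb (x ^ n) = emb x ^ n"
  by (induction n) auto

definition r2 :: zs2 where "r2 = ZS 0 1"

lemma emb_r2 [simp]: "emb r2 = sqrt 2"
  by (simp add: r2_def emb_def)

lemma r2_sel [simp]: "rpart r2 = 0" "spart r2 = 1"
  by (simp_all add: r2_def)

lemma r2_mult_r2: "r2 * r2 = 2" "r2 * (r2 * x) = 2 * x"
  by (simp_all add: zs2_eq_iff zs2_sel_mult)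

lemma r2_nonzero [simp]: "r2 \<noteq> 0"
  by (simp add: zs2_eq_iff)

definition cjg :: "zs2 \<Rightarrow> zs2" where "cjg x = ZS (rpart x) (- spart x)"

lemma cjg_sel [simp]: "rpart (cjg x) = rpart x" "spart (cjg x) = - spart x"
  by (simp_all add: cjg_def)

lemma cjg_simps [simp]:
  "cjg 0 = 0" "cjg 1 = 1" "cjg (x + y) = cjg x + cjg y" "cjg (- x) = - cjg x"
  "cjg (x - y) = cjg x - cjg y" "cjg (x * y) = cjg x * cjg y" "cjg (of_int n) = of_int n"
  "cjg (cjg x) = x" "cjg x = 0 \<longleftrightarrow> x = 0"
  by (auto simp: zs2_eq_iff zs2_sel_mult algebra_simps)

lemma cjg_numeral [simp]: "cjg (numeral k) = numeral k"
  by (simp add: zs2_eq_iff)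

definition fnorm :: "zs2 \<Rightarrow> int" where "fnorm x = rpart x ^ 2 - 2 * spart x ^ 2"

lemma mult_cjg: "x * cjg x = of_int (fnorm x)"
  by (simp add: zs2_eq_iff zs2_sel_mult fnorm_def power2_eq_square)

lemma fnorm_mult [simp]: "fnorm (x * y) = fnorm x * fnorm y"
  by (simp add: fnorm_def zs2_sel_mult power2_eq_square algebra_simps)

lemma fnorm_simps [simp]: "fnorm 0 = 0" "fnorm 1 = 1" "fnorm (of_int n) = n ^ 2"
  "fnorm (cjg x) = fnorm x" "fnorm (- x) = fnorm x" "fnorm r2 = -2"
  by (simp_all add: fnorm_def)

lemma fnorm_eq_0_iff [simp]: "fnorm x = 0 \<longleftrightarrow> x = 0"
proof
  assume "fnorm x = 0"
  with mult_cjg[of x] have "x * cjg x = 0" by simp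
  thus "x = 0" by simp
qed simp

lemma fnorm_dvd: "x dvd y \<Longrightarrow> fnorm x dvd fnorm y"
  by (auto elim!: dvdE)

lemma dvd_fnorm: "x dvd of_int (fnorm x)"
  by (metis mult_cjg dvd_triv_left)

lemma unit_iff_fnorm: "x dvd 1 \<longleftrightarrow> \<bar>fnorm x\<bar> = 1"
proof
  assume "x dvd 1"
  from fnorm_dvd[OF this] show "\<bar>fnorm x\<bar> = 1" by simp
next
  assume "\<bar>fnorm x\<bar> = 1"
  hence "fnorm x = 1 \<or> fnorm x = - 1" by arith
  with dvd_fnorm[of x] show "x dvd 1" by auto
qed

lemma of_int_dvd_zs2: "of_int n dvd x \<longleftrightarrow> n dvd rpart x \<and> n dvd spart x"
proof
  assume "of_int n dvd x"
  thus "n dvd rpart x \<and> n dvd spart x" by (auto elim!: dvdE simp: zs2_sel_mult)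
next
  assume "n dvd rpart x \<and> n dvd spart x"
  then obtain a b where "rpart x = n * a" "spart x = n * b" by (auto elim!: dvdE)
  hence "x = of_int n * ZS a b" by (simp add: zs2_eq_iff zs2_sel_mult)
  thus "of_int n dvd x" by simp
qed

lemma r2_dvd_iff: "r2 dvd x \<longleftrightarrow> even (rpart x)"
proof
  assume "even (rpart x)"
  then obtain a where "rpart x = 2 * a" by (elim evenE)
  hence "x = r2 * ZS (spart x) a" by (simp add: zs2_eq_iff zs2_sel_mult)
  thus "r2 dvd x" by (rule dvdI)
qed (auto elim!: dvdE simp: zs2_sel_mult)

lemma two_r2_dvd_iff: "2 * r2 dvd x \<longleftrightarrow> 4 dvd rpart x \<and> even (spart x)"
proof
  assume "4 dvd rpart x \<and> even (spart x)"
  then obtain a b where "rpart x = 4 * a" "spart x = 2 * b" by (auto elim!: dvdE)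
  hence "x = 2 * r2 * ZS b a" by (simp add: zs2_eq_iff zs2_sel_mult)
  thus "2 * r2 dvd x" by simp
qed (auto elim!: dvdE simp: zs2_sel_mult)

section \<open>Euclidean division, Bezout identities and primes in Z[sqrt 2]\<close>

lemma zs2_division:
  assumes "b \<noteq> 0"
  shows "\<exists>q. \<bar>fnorm (a - q * b)\<bar> < \<bar>fnorm b\<bar>"
proof -
  define n where "n = fnorm b"
  have n: "n \<noteq> 0" using assms by (simp add: n_def)
  \<comment> \<open>\<open>c\<close> is the quotient of \<open>a\<close> by \<open>b\<close> scaled
    by the rational integer \<open>n\<close>, so rounding \<open>c / n\<close> in each coordinate
    keeps all quantities integral.\<close>
  define c where "c = a * cjg b"
  define u v where "u = round (of_int (rpart c) / of_int n :: real)" and "v = round (of_int (spart c) / of_int n :: real)"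
  have rnd: "(of_int x - of_int (round (of_int x / of_int n :: real)) * of_int n :: real)\<^sup>2 \<le> (of_int n)\<^sup>2 / 4" for x
  proof -
    have "\<bar>of_int (round (of_int x / of_int n :: real)) - of_int x / of_int n\<bar> \<le> (1/2 :: real)"
      using of_int_round_abs_le by blast
    hence "\<bar>of_int (round (of_int x / of_int n :: real)) - of_int x / of_int n\<bar> * \<bar>of_int n\<bar> \<le> (1/2) * \<bar>of_int n :: real\<bar>"
      by (rule mult_right_mono) simp
    also have "\<bar>of_int (round (of_int x / of_int n :: real)) - of_int x / of_int n\<bar> * \<bar>of_int n :: real\<bar>
        = \<bar>of_int x - of_int (round (of_int x / of_int n :: real)) * of_int n\<bar>"
      using n by (simp add: abs_mult[symmetric] left_diff_distrib abs_minus_commute)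
    finally have "\<bar>of_int x - of_int (round (of_int x / of_int n :: real)) * of_int n\<bar> \<le> \<bar>of_int n / 2 :: real\<bar>"
      by simp
    thus ?thesis unfolding abs_le_square_iff by (simp add: power_divide)
  qed
  let ?q = "ZS u v"
  define d where "d = c - ?q * of_int n"
  have d: "d = (a - ?q * b) * cjg b"
    by (simp add: d_def c_def n_def mult_cjg[symmetric] algebra_simps)
  have r: "rpart d = rpart c - u * n" "spart d = spart c - v * n"
    by (simp_all add: d_def zs2_sel_mult)
  have "(of_int (rpart d) :: real)\<^sup>2 \<le> (of_int n)\<^sup>2 / 4" "(of_int (spart d) :: real)\<^sup>2 \<le> (of_int n)\<^sup>2 / 4"
    using rnd[of "rpart c"] rnd[of "spart c"] by (simp_all add: r u_def v_def)
  hence "4 * (real_of_int (rpart d))\<^sup>2 \<le> (of_int n)\<^sup>2" "4 * (real_of_int (spart d))\<^sup>2 \<le> (of_int n)\<^sup>2"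
    by simp_all
  hence "real_of_int (4 * (rpart d)\<^sup>2) \<le> real_of_int (n\<^sup>2)" "real_of_int (4 * (spart d)\<^sup>2) \<le> real_of_int (n\<^sup>2)"
    by simp_all
  hence "4 * (rpart d)\<^sup>2 \<le> n\<^sup>2" "4 * (spart d)\<^sup>2 \<le> n\<^sup>2"
    by (simp_all only: of_int_le_iff)
  moreover have "0 \<le> (rpart d)\<^sup>2" "0 \<le> (spart d)\<^sup>2" "0 < n\<^sup>2" using n by auto
  \<comment> \<open>Both coordinates of \<open>d\<close> are at most n/2 in absolute value, so x^2 -
    2 y^2 lies between -n^2/2 and n^2/4.\<close>
  ultimately have "\<bar>fnorm d\<bar> < n\<^sup>2"
    unfolding fnorm_def abs_less_iff by linarith
  also have "\<bar>fnorm d\<bar> = \<bar>fnorm (a - ?q * b)\<bar> * \<bar>n\<bar>"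
    by (simp add: d abs_mult n_def)
  also have "n\<^sup>2 = \<bar>n\<bar> * \<bar>n\<bar>" by (simp add: power2_eq_square)
  finally have "\<bar>fnorm (a - ?q * b)\<bar> < \<bar>n\<bar>" using mult_right_less_imp_less abs_ge_zero by blast
  thus ?thesis unfolding n_def by blast
qed

lemma zs2_bezout:
  assumes "p \<noteq> 0"
  shows "\<exists>d x y. d = x * p + y * a \<and> d dvd p \<and> d dvd (a :: zs2)"
proof -
  define I where "I = {x * p + y * a | x y. True}"
  have "1 * p + 0 * a \<in> I" unfolding I_def by blast
  hence "\<exists>d. d \<in> I \<and> d \<noteq> 0" using assms by auto
  then obtain d where d: "d \<in> I" "d \<noteq> 0" and min: "\<And>y. y \<in> I \<and> y \<noteq> 0 \<Longrightarrow> nat \<bar>fnorm d\<bar> \<le> nat \<bar>fnorm y\<bar>"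
    using ex_has_least_nat[of "\<lambda>x. x \<in> I \<and> x \<noteq> 0" _ "\<lambda>x. nat \<bar>fnorm x\<bar>"] by auto
  obtain x y where dxy: "d = x * p + y * a" using d unfolding I_def by auto
  have dvd: "d dvd c" if cI: "c \<in> I" for c
  proof -
    obtain q where q: "\<bar>fnorm (c - q * d)\<bar> < \<bar>fnorm d\<bar>" using zs2_division[OF d(2)] by blast
    obtain x' y' where c: "c = x' * p + y' * a" using cI unfolding I_def by auto
    have "c - q * d = (x' - q * x) * p + (y' - q * y) * a" by (simp add: c dxy algebra_simps)
    hence "c - q * d \<in> I" unfolding I_def by blast
    with min[of "c - q * d"] q have "c - q * d = 0" by fastforce
    thus ?thesis by simp
  qed
  have "0 * p + 1 * a \<in> I" unfolding I_def by blast
  hence "d dvd a" using dvd by simp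
  moreover have "d dvd p" using dvd[OF \<open>1 * p + 0 * a \<in> I\<close>] by simp
  ultimately show ?thesis using dxy by blast
qed

lemma irreducible_bezout:
  assumes "irreducible p" "\<not> p dvd (a :: zs2)"
  shows "\<exists>x y. x * p + y * a = 1"
proof -
  have "p \<noteq> 0" using assms by auto
  from zs2_bezout[OF this] obtain d x y where d: "d = x * p + y * a" "d dvd p" "d dvd a" by blast
  from d(2) obtain f where f: "p = d * f" by (elim dvdE)
  have "\<not> f dvd 1"
  proof
    assume "f dvd 1"
    then obtain g where "1 = f * g" by (elim dvdE)
    hence "d = p * g" by (simp add: f mult.assoc)
    hence "p dvd d" by (rule dvdI)
    thus False using d(3) assms(2) dvd_trans by blast
  qed
  hence "d dvd 1" using irreducibleD[OF assms(1) f] by blast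
  then obtain e where "1 = d * e" by (elim dvdE)
  hence "(e * x) * p + (e * y) * a = 1" by (simp add: d(1) algebra_simps)
  thus ?thesis by blast
qed

lemma irreducible_imp_prime_zs2:
  assumes "irreducible (p :: zs2)"
  shows "prime_elem p"
  unfolding prime_elem_def
proof (intro conjI allI impI)
  fix a b assume ab: "p dvd a * b"
  show "p dvd a \<or> p dvd b"
  proof (rule disjCI)
    assume "\<not> p dvd b"
    then obtain x y where "x * p + y * b = 1" using irreducible_bezout[OF assms] by blast
    hence "a = a * (x * p + y * b)" by simp
    also have "\<dots> = (a * x) * p + y * (a * b)" by (simp add: algebra_simps)
    finally have "a = (a * x) * p + y * (a * b)" .
    moreover have "p dvd (a * x) * p + y * (a * b)" using ab by (simp add: dvd_mult)
    ultimately show "p dvd a" by simp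
  qed
qed (use assms in \<open>auto simp: irreducible_def\<close>)

lemma prime_elem_imp_irreducible_zs2:
  assumes "prime_elem (p :: zs2)"
  shows "irreducible p"
proof (rule irreducibleI)
  fix a b assume ab: "p = a * b"
  have p0: "p \<noteq> 0" using assms by auto
  have "p dvd a \<or> p dvd b" using prime_elem_dvd_multD[OF assms, of a b] ab by simp
  thus "a dvd 1 \<or> b dvd 1"
  proof
    assume "p dvd a"
    then obtain c where "a = p * c" by (elim dvdE)
    hence "p * (b * c) = p * 1" using ab by (metis mult.assoc mult.commute mult.right_neutral)
    hence "1 = b * c" using p0 by (metis mult_cancel_left)
    thus ?thesis by (metis dvdI)
  next
    assume "p dvd b"
    then obtain c where "b = p * c" by (elim dvdE)
    hence "p * (a * c) = p * 1" using ab by (metis mult.left_commute mult.right_neutral)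
    hence "1 = a * c" using p0 by (metis mult_cancel_left)
    thus ?thesis by (metis dvdI)
  qed
qed (use assms in \<open>auto simp: prime_elem_def\<close>)

lemma prime_elem_inverse:
  assumes "prime_elem p" "\<not> p dvd (a :: zs2)"
  obtains y where "p dvd y * a - 1"
proof -
  obtain x y where "x * p + y * a = 1"
    using irreducible_bezout[OF prime_elem_imp_irreducible_zs2[OF assms(1)] assms(2)] by blast
  hence "y * a - 1 = p * (- x)" by (simp add: algebra_simps eq_diff_eq)
  hence "p dvd y * a - 1" by (rule dvdI)
  thus ?thesis by (rule that)
qed

lemma exists_prime_divisor:
  assumes "x \<noteq> 0" "\<not> x dvd 1"
  obtains p where "prime_elem (p :: zs2)" "p dvd x"
proof -
  have "\<exists>p. irreducible p \<and> p dvd x" using assms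
  proof (induction "nat \<bar>fnorm x\<bar>" arbitrary: x rule: less_induct)
    case (less x)
    show ?case
    proof (cases "irreducible x")
      case True
      thus ?thesis by (intro exI[of _ x]) simp
    next
      case False
      then obtain a b where ab: "x = a * b" "\<not> a dvd 1" "\<not> b dvd 1"
        using less.prems unfolding irreducible_def by blast
      have "a \<noteq> 0" "b \<noteq> 0" using ab less.prems by auto
      hence "\<bar>fnorm a\<bar> \<noteq> 0" "\<bar>fnorm b\<bar> \<noteq> 0" "\<bar>fnorm b\<bar> \<noteq> 1" using ab unit_iff_fnorm by auto
      hence "\<bar>fnorm a\<bar> * 1 < \<bar>fnorm a\<bar> * \<bar>fnorm b\<bar>"
        by (intro mult_strict_left_mono) (use \<open>a \<noteq> 0\<close> \<open>\<bar>fnorm b\<bar> \<noteq> 0\<close> \<open>\<bar>fnorm b\<bar> \<noteq> 1\<close> in linarith)+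
      hence "nat \<bar>fnorm a\<bar> < nat \<bar>fnorm x\<bar>" by (simp add: ab(1) abs_mult)
      from less.hyps[OF this \<open>a \<noteq> 0\<close> ab(2)] show ?thesis using ab(1) by auto
    qed
  qed
  thus ?thesis using that irreducible_imp_prime_zs2 by blast
qed

subsection \<open>Total positivity and units\<close>

text \<open>Both conjugates are positive exactly when their sum and their product are; this turns
  total positivity into a condition on integers.\<close>

definition totpos :: "zs2 \<Rightarrow> bool" where "totpos x \<longleftrightarrow> 0 < rpart x \<and> 0 < fnorm x"

lemma emb_cjg_mult: "emb x * emb (cjg x) = of_int (fnorm x)"
  using mult_cjg[of x] by (metis emb_simps(6,7))

lemma totpos_iff_emb: "totpos x \<longleftrightarrow> 0 < emb x \<and> 0 < emb (cjg x)"
proof -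
  have s: "emb x + emb (cjg x) = 2 * of_int (rpart x)" by (simp add: emb_def)
  have *: "0 < emb x * emb (cjg x) \<longleftrightarrow> 0 < fnorm x" by (simp add: emb_cjg_mult)
  show ?thesis
  proof
    assume "totpos x"
    hence a: "0 < emb x * emb (cjg x)" "0 < emb x + emb (cjg x)" using * s by (auto simp: totpos_def)
    thus "0 < emb x \<and> 0 < emb (cjg x)" by (auto simp: zero_less_mult_iff)
  next
    assume a: "0 < emb x \<and> 0 < emb (cjg x)"
    hence "0 < emb x * emb (cjg x)" "0 < emb x + emb (cjg x)" by auto
    thus "totpos x" using * s by (auto simp: totpos_def)
  qed
qed

lemma totpos_mult_cancel: "totpos x \<Longrightarrow> totpos (x * y) \<Longrightarrow> totpos y"
  by (auto simp: totpos_iff_emb zero_less_mult_iff)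

lemma totpos_nonzero: "totpos x \<Longrightarrow> x \<noteq> 0"
  by (auto simp: totpos_def)

text \<open>The unit 1 + sqrt 2 has norm -1, so it repairs the sign of the norm, and -1 then repairs
  the sign of the trace.\<close>

lemma totpos_associate:
  assumes "x \<noteq> 0"
  obtains u where "u dvd 1" "totpos (u * x)"
proof -
  have "\<exists>u. u dvd 1 \<and> fnorm (u * x) > 0"
  proof (cases "fnorm x > 0")
    case False
    moreover have "fnorm x \<noteq> 0" using assms by simp
    ultimately have "fnorm x < 0" by linarith
    hence "fnorm (ZS 1 1 * x) > 0" by (simp add: fnorm_def[of "ZS 1 1"])
    thus ?thesis by (intro exI[of _ "ZS 1 1"]) (simp add: unit_iff_fnorm fnorm_def)
  qed (auto intro: exI[of _ 1])
  then obtain u where u: "u dvd 1" "fnorm (u * x) > 0" by blast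
  have "rpart (u * x) \<noteq> 0"
  proof
    assume "rpart (u * x) = 0"
    hence "fnorm (u * x) \<le> 0" unfolding fnorm_def by simp
    with u(2) show False by simp
  qed
  hence "totpos (u * x) \<or> totpos ((- u) * x)" using u(2) by (auto simp: totpos_def)
  thus ?thesis using that u(1) by (metis minus_dvd_iff)
qed

text \<open>Descent on the irrational coordinate by the square of the fundamental unit. This is what
  lets a generator of norm prime times unit be rescaled to norm exactly the prime.\<close>

lemma totpos_unit_square:
  assumes "totpos u" "u dvd 1"
  obtains v where "u = v * v" "v dvd 1"
proof -
  have "\<exists>v. u = v * v" using assms
  proof (induction "nat \<bar>spart u\<bar>" arbitrary: u rule: less_induct)
    case (less u)
    define a b where "a = rpart u" and "b = spart u"
    have a: "a > 0" and n: "a\<^sup>2 - 2 * b\<^sup>2 = 1"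
      using less.prems by (auto simp: totpos_def unit_iff_fnorm fnorm_def a_def b_def)
    show ?case
    proof (cases "b = 0")
      case True
      with n a have "a = 1" by (simp add: power2_eq_1_iff)
      hence "u = 1 * 1" using True by (simp add: zs2_eq_iff a_def b_def)
      thus ?thesis by blast
    next
      case False
      define e :: int where "e = sgn b"
      have e: "e * e = 1" "e * b = \<bar>b\<bar>" using False by (auto simp: e_def sgn_if)
      \<comment> \<open>\<open>ZS 3 (-2 * e)\<close> is (1 + e sqrt 2)^(-2). From a^2 = 2 b^2 + 1
        and b \<noteq> 0 follows |b| < a < 2|b|, so the new irrational coordinate, 3|b| - 2a up to
        sign, is smaller than |b| in absolute value.\<close>
      define w where "w = ZS 3 (-2 * e) * u"
      have w: "rpart w = 3 * a - 4 * \<bar>b\<bar>" "spart w = 3 * b - 2 * e * a"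
        using e by (simp_all add: w_def zs2_sel_mult a_def b_def)
      have eb: "b = e * \<bar>b\<bar>" using e by (simp add: mult.assoc[symmetric] flip: e(2))
      have bb: "\<bar>b\<bar>\<^sup>2 = b\<^sup>2" "\<bar>b\<bar> \<ge> 1" using False by auto
      have "1 \<le> b\<^sup>2" using False by (simp add: int_one_le_iff_zero_less)
      hence "\<bar>b\<bar>\<^sup>2 < a\<^sup>2" unfolding bb using n by linarith
      hence lt: "\<bar>b\<bar> < a" by (rule power2_less_imp_less) (use a in simp)
      have "a\<^sup>2 < (2 * \<bar>b\<bar>)\<^sup>2" using n \<open>1 \<le> b\<^sup>2\<close> by (simp add: power_mult_distrib)
      hence lt2: "a < 2 * \<bar>b\<bar>" by (rule power2_less_imp_less) simp
      have "spart w = e * (3 * \<bar>b\<bar> - 2 * a)" unfolding w using eb by (simp add: algebra_simps)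
      moreover have "\<bar>e\<bar> = 1" using False by (simp add: e_def abs_sgn_eq)
      ultimately have sw: "\<bar>spart w\<bar> = \<bar>3 * \<bar>b\<bar> - 2 * a\<bar>" by (simp add: abs_mult)
      also have "\<dots> < \<bar>b\<bar>" using lt lt2 by linarith
      finally have less1: "nat \<bar>spart w\<bar> < nat \<bar>spart u\<bar>" by (simp add: b_def)
      have "(4 * \<bar>b\<bar>)\<^sup>2 < (3 * a)\<^sup>2" using n \<open>1 \<le> b\<^sup>2\<close> by (simp add: power_mult_distrib)
      hence "4 * \<bar>b\<bar> < 3 * a" by (rule power2_less_imp_less) (use a in simp)
      hence "rpart w > 0" by (simp add: w)
      moreover have ew: "e\<^sup>2 = 1" using e by (simp add: power2_eq_square)
      have nw: "fnorm w = 1" unfolding w_def fnorm_mult using n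
        by (simp add: fnorm_def a_def b_def power_mult_distrib ew)
      ultimately have "totpos w" "w dvd 1" by (auto simp: totpos_def unit_iff_fnorm)
      from less.hyps[OF less1 this] obtain v where v: "w = v * v" by blast
      have "(ZS 1 e * ZS 1 e) * ZS 3 (-2 * e) = 1"
        using e by (simp add: zs2_eq_iff zs2_sel_mult algebra_simps)
      hence "u = (ZS 1 e * ZS 1 e) * w" unfolding w_def by (simp add: mult.assoc[symmetric])
      also have "\<dots> = (ZS 1 e * v) * (ZS 1 e * v)" unfolding v by (simp add: ac_simps)
      finally have "u = (ZS 1 e * v) * (ZS 1 e * v)" .
      thus ?thesis by blast
    qed
  qed
  then obtain v where "u = v * v" by blast
  moreover from this have "v dvd 1" using assms(2) dvd_mult_left by blast
  ultimately show ?thesis using that by blast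
qed


section \<open>The maximal order\<close>

datatype oct = Oct (c0: zs2) (c1: zs2) (c2: zs2) (c3: zs2)

lemma oct_eq_iff: "x = y \<longleftrightarrow> c0 x = c0 y \<and> c1 x = c1 y \<and> c2 x = c2 y \<and> c3 x = c3 y"
  by (cases x; cases y) auto

text \<open>
  Coordinates with respect to the basis $1$, $(1+\mathbf i)/\sqrt 2$, $(1+\mathbf j)/\sqrt 2$,
  $(1+\mathbf i+\mathbf j+\mathbf k)/2$ of a maximal order containing $\mathcal G$.
\<close>

definition to_quat :: "oct \<Rightarrow> quat" where
  "to_quat x = Quat
    (emb (c0 x) + (emb (c1 x) + emb (c2 x)) * (sqrt 2 / 2) + emb (c3 x) / 2)
    (emb (c1 x) * (sqrt 2 / 2) + emb (c3 x) / 2)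
    (emb (c2 x) * (sqrt 2 / 2) + emb (c3 x) / 2)
    (emb (c3 x) / 2)"

lemma to_quat_inj: "to_quat x = to_quat y \<longleftrightarrow> x = y"
  by (auto simp: to_quat_def oct_eq_iff emb_inj)

text \<open>The product is written in basis coordinates so that divisibility can be read off;
  associativity and distributivity are pulled back along the injective map
  \<open>to_quat\<close>.\<close>

instantiation oct :: ring_1
begin

definition "0 = Oct 0 0 0 0"
definition "1 = Oct 1 0 0 0"
definition "x + y = Oct (c0 x + c0 y) (c1 x + c1 y) (c2 x + c2 y) (c3 x + c3 y)"
definition "- x = Oct (- c0 x) (- c1 x) (- c2 x) (- c3 x)"
definition "x - y = Oct (c0 x - c0 y) (c1 x - c1 y) (c2 x - c2 y) (c3 x - c3 y)"
definition "x * y = Oct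
  (c0 x * c0 y - c1 x * c1 y - c2 x * c1 y - c2 x * c2 y - r2 * c2 x * c3 y - r2 * c3 x * c1 y - c3 x * c3 y)
  (c0 x * c1 y + c1 x * c0 y + r2 * c1 x * c1 y + r2 * c2 x * c1 y + c2 x * c3 y + c3 x * c1 y - c3 x * c2 y)
  (c0 x * c2 y + c2 x * c0 y - c1 x * c3 y + r2 * c2 x * c1 y + r2 * c2 x * c2 y + c2 x * c3 y + c3 x * c1 y)
  (c0 x * c3 y + c3 x * c0 y + c1 x * c2 y + r2 * c1 x * c3 y - c2 x * c1 y + r2 * c3 x * c2 y + c3 x * c3 y)"

lemmas oct_defs = zero_oct_def one_oct_def plus_oct_def uminus_oct_def minus_oct_def times_oct_def

lemma to_quat_add: "to_quat (x + y) = to_quat x + to_quat y"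
  by (simp add: to_quat_def oct_defs quat_arith_defs algebra_simps add_divide_distrib)

lemma to_quat_mult: "to_quat (x * y) = to_quat x * to_quat y"
  by (simp add: to_quat_def oct_defs quat_arith_defs field_simps)

lemma to_quat_one: "to_quat 1 = 1"
  by (simp add: to_quat_def oct_defs quat_arith_defs)

instance
proof
  fix a b c :: oct
  show "a * b * c = a * (b * c)"
    by (simp add: to_quat_mult mult.assoc flip: to_quat_inj)
  show "(a + b) * c = a * c + b * c" "a * (b + c) = a * b + a * c" "1 * a = a" "a * 1 = a"
    by (simp_all add: to_quat_mult to_quat_add to_quat_one distrib_left distrib_right flip: to_quat_inj)
qed (auto simp: oct_defs oct_eq_iff)

end

lemma oct_sel [simp]:
  "c0 0 = 0" "c1 0 = 0" "c2 0 = 0" "c3 0 = 0"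
  "c0 1 = 1" "c1 1 = 0" "c2 1 = 0" "c3 1 = 0"
  "c0 (x + y) = c0 x + c0 y" "c1 (x + y) = c1 x + c1 y" "c2 (x + y) = c2 x + c2 y" "c3 (x + y) = c3 x + c3 y"
  "c0 (- x) = - c0 x" "c1 (- x) = - c1 x" "c2 (- x) = - c2 x" "c3 (- x) = - c3 x"
  "c0 (x - y) = c0 x - c0 y" "c1 (x - y) = c1 x - c1 y" "c2 (x - y) = c2 x - c2 y" "c3 (x - y) = c3 x - c3 y"
  by (simp_all add: oct_defs)

section \<open>Scalars, conjugation and the reduced norm\<close>

definition scal :: "zs2 \<Rightarrow> oct" where "scal s = Oct s 0 0 0"

lemma scal_sel [simp]: "c0 (scal s) = s" "c1 (scal s) = 0" "c2 (scal s) = 0" "c3 (scal s) = 0"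
  by (simp_all add: scal_def)

lemma scal_mult_sel [simp]:
  "c0 (scal s * x) = s * c0 x" "c1 (scal s * x) = s * c1 x" "c2 (scal s * x) = s * c2 x" "c3 (scal s * x) = s * c3 x"
  by (simp_all add: oct_defs scal_def)

lemma scal_simps: "scal 0 = 0" "scal 1 = 1" "scal (s + t) = scal s + scal t" "scal (s * t) = scal s * scal t"
  "scal (- s) = - scal s" "scal (s - t) = scal s - scal t"
  by (simp_all add: oct_eq_iff)

lemma scal_commute: "x * scal s = scal s * x"
  by (simp add: oct_eq_iff) (simp add: oct_defs scal_def algebra_simps)

lemma scal_left_commute: "x * (scal s * y) = scal s * (x * y)"
  by (metis mult.assoc scal_commute)

lemma scal_cancel: "s \<noteq> 0 \<Longrightarrow> scal s * x = scal s * y \<longleftrightarrow> x = y"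
  by (simp add: oct_eq_iff)

text \<open>Quaternion conjugation as trace minus identity: the basis elements have traces 2, sqrt
  2, sqrt 2 and 1.\<close>

definition qcnj :: "oct \<Rightarrow> oct" where
  "qcnj x = Oct (c0 x + r2 * c1 x + r2 * c2 x + c3 x) (- c1 x) (- c2 x) (- c3 x)"

definition nn :: "oct \<Rightarrow> zs2" where
  "nn x = c0 x * c0 x + c1 x * c1 x + c2 x * c2 x + c3 x * c3 x + c0 x * c3 x + c1 x * c2 x
    + r2 * (c0 x * c1 x + c0 x * c2 x + c1 x * c3 x + c2 x * c3 x)"

lemma nrd_to_quat: "nrd (to_quat x) = emb (nn x)"
  by (simp add: to_quat_def nrd_def nn_def power2_eq_square field_simps)

lemma nrd_quat_mult: "nrd (p * q) = nrd p * nrd q"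
  by (simp add: nrd_def times_quat_def power2_eq_square algebra_simps)

lemma nn_mult [simp]: "nn (x * y) = nn x * nn y"
  by (simp add: nrd_quat_mult to_quat_mult flip: emb_inj nrd_to_quat)

lemma nn_simps [simp]: "nn 0 = 0" "nn 1 = 1" "nn (scal s) = s * s" "nn (- x) = nn x"
  by (simp_all add: nn_def)

lemma mult_qcnj: "x * qcnj x = scal (nn x)"
  by (simp add: oct_eq_iff) (simp add: qcnj_def nn_def oct_defs algebra_simps r2_mult_r2)

lemma qcnj_mult: "qcnj x * x = scal (nn x)"
  by (simp add: oct_eq_iff) (simp add: qcnj_def nn_def oct_defs algebra_simps r2_mult_r2)

lemma nn_qcnj [simp]: "nn (qcnj x) = nn x"
  by (simp add: qcnj_def nn_def algebra_simps r2_mult_r2)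

text \<open>Twice the coordinates with respect to $1, \mathbf i, \mathbf j, \mathbf k$.\<close>

definition w0 :: "oct \<Rightarrow> zs2" where "w0 x = 2 * c0 x + r2 * (c1 x + c2 x) + c3 x"
definition w1 :: "oct \<Rightarrow> zs2" where "w1 x = r2 * c1 x + c3 x"
definition w2 :: "oct \<Rightarrow> zs2" where "w2 x = r2 * c2 x + c3 x"
definition w3 :: "oct \<Rightarrow> zs2" where "w3 x = c3 x"

lemmas w_defs = w0_def w1_def w2_def w3_def

lemma four_nn: "4 * nn x = w0 x * w0 x + w1 x * w1 x + w2 x * w2 x + w3 x * w3 x"
  by (simp add: nn_def w_defs algebra_simps r2_mult_r2)

lemma w_zero: "w0 x = 0 \<Longrightarrow> w1 x = 0 \<Longrightarrow> w2 x = 0 \<Longrightarrow> w3 x = 0 \<Longrightarrow> x = 0"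
  by (auto simp: w_defs oct_eq_iff)

lemma sum4_squares_pos:
  fixes a b c d :: real
  assumes "\<not> (a = 0 \<and> b = 0 \<and> c = 0 \<and> d = 0)"
  shows "0 < a * a + b * b + c * c + d * d"
  using assms by (metis add_pos_nonneg add_nonneg_pos add_nonneg_nonneg not_real_square_gt_zero zero_le_square)

text \<open>Four times the norm is a sum of four squares, and the identity survives replacing sqrt 2
  by -sqrt 2: the algebra is definite at both real places.\<close>

lemma totpos_nn:
  assumes "x \<noteq> 0"
  shows "totpos (nn x)"
proof -
  have nz: "\<not> (w0 x = 0 \<and> w1 x = 0 \<and> w2 x = 0 \<and> w3 x = 0)" using w_zero assms by blast
  have "4 * emb (nn x) = emb (w0 x) * emb (w0 x) + emb (w1 x) * emb (w1 x) + emb (w2 x) * emb (w2 x) + emb (w3 x) * emb (w3 x)"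
    using arg_cong[OF four_nn[of x], of emb] by simp
  also have "\<dots> > 0" using nz by (intro sum4_squares_pos) (simp add: emb_eq_0)
  finally have 1: "0 < emb (nn x)" by simp
  have "4 * emb (cjg (nn x)) = emb (cjg (w0 x)) * emb (cjg (w0 x)) + emb (cjg (w1 x)) * emb (cjg (w1 x))
    + emb (cjg (w2 x)) * emb (cjg (w2 x)) + emb (cjg (w3 x)) * emb (cjg (w3 x))"
    using arg_cong[OF four_nn[of x], of "\<lambda>z. emb (cjg z)"] by simp
  also have "\<dots> > 0" using nz by (intro sum4_squares_pos) (simp add: emb_eq_0)
  finally have 2: "0 < emb (cjg (nn x))" by simp
  from 1 2 show ?thesis by (simp add: totpos_iff_emb)
qed

lemma nn_eq_0_iff [simp]: "nn x = 0 \<longleftrightarrow> x = 0"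
  using totpos_nn[of x] totpos_nonzero by auto

lemma oct_no_zero_divisors: "(x :: oct) * y = 0 \<longleftrightarrow> x = 0 \<or> y = 0"
  by (metis nn_eq_0_iff nn_mult mult_eq_0_iff)

lemma oct_mult_right_cancel: "z \<noteq> 0 \<Longrightarrow> x * z = y * z \<longleftrightarrow> x = (y :: oct)"
  by (metis eq_iff_diff_eq_0 left_diff_distrib oct_no_zero_divisors)

text \<open>
  The rational and irrational parts of a quaternion in the maximal order range independently over
  the Hurwitz lattice and over a scaled copy of the root lattice $D_4$.
\<close>

lemma exists_oct_of_parts:
  assumes "even (a0 + a1)" "even (a0 + a2)" "even (a0 + a3)" "even (b0 + b1 + b2 + b3)"
  shows "\<exists>x. w0 x = ZS a0 b0 \<and> w1 x = ZS a1 b1 \<and> w2 x = ZS a2 b2 \<and> w3 x = ZS a3 b3"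
proof -
  have "even (a1 - a3)" "even (a2 - a3)" "even (a0 - a1 - a2 + a3)" "even (b0 - b1 - b2 + b3)"
    using assms by presburger+
  then obtain k l m n where k: "a1 - a3 = 2 * k" "a2 - a3 = 2 * l" "a0 - a1 - a2 + a3 = 2 * m" "b0 - b1 - b2 + b3 = 2 * n"
    by (metis evenE)
  show ?thesis
    by (rule exI[of _ "Oct (ZS m n) (ZS (b1 - b3) k) (ZS (b2 - b3) l) (ZS a3 b3)"])
      (use k in \<open>simp add: w_defs zs2_eq_iff zs2_sel_mult\<close>)
qed

lemma parts_parity:
  "even (rpart (w0 x) + rpart (w1 x))" "even (rpart (w0 x) + rpart (w2 x))" "even (rpart (w0 x) + rpart (w3 x))"
  "even (spart (w0 x) + spart (w1 x) + spart (w2 x) + spart (w3 x))"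
  by (simp_all add: w_defs zs2_sel_mult)


section \<open>Left ideals are principal\<close>

lemma sum_lessThan_4: "(\<Sum>i<4::nat. f i) = f 0 + f 1 + f 2 + (f 3 :: 'a :: comm_monoid_add)"
  by (simp add: eval_nat_numeral)

lemma all_less_4: "(\<forall>i<4::nat. P i) \<longleftrightarrow> P 0 \<and> P 1 \<and> P 2 \<and> P 3"
  by (simp add: eval_nat_numeral less_Suc_eq) blast

text \<open>The better of the two cosets of Z^4 is chosen. With rounding errors f, moving every
  coordinate by 1/2 changes the squared error from sum f^2 to sum f^2 - sum |f| + 1; since f^2 \<le>
  |f|/2, the first is at most 1/2 if sum |f| \<le> 1, and the second otherwise. The lattice point is
  h/2, so all h have the same parity.\<close>

lemma hurwitz_rounding:
  fixes p :: "nat \<Rightarrow> real"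
  obtains h :: "nat \<Rightarrow> int" where "\<And>i j. i < 4 \<Longrightarrow> j < 4 \<Longrightarrow> even (h i + h j)"
    "(\<Sum>i<4. (p i - of_int (h i) / 2)\<^sup>2) \<le> 1 / 2"
proof -
  define f where "f i = p i - of_int (round (p i))" for i
  have f: "\<bar>f i\<bar> \<le> 1/2" for i
    using of_int_round_abs_le[of "p i"] by (simp add: f_def abs_minus_commute)
  have f2: "(f i)\<^sup>2 \<le> \<bar>f i\<bar> / 2" for i
  proof -
    have "\<bar>f i\<bar> * \<bar>f i\<bar> \<le> \<bar>f i\<bar> * (1/2)" using f by (intro mult_left_mono) auto
    thus ?thesis by (simp add: power2_eq_square)
  qed
  have s2: "(\<Sum>i<4. (f i)\<^sup>2) \<le> (\<Sum>i<4. \<bar>f i\<bar>) / 2"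
    unfolding sum_divide_distrib by (intro sum_mono f2)
  show ?thesis
  proof (cases "(\<Sum>i<4. \<bar>f i\<bar>) \<le> 1")
    case True
    show ?thesis
      by (rule that[of "\<lambda>i. 2 * round (p i)"]) (use s2 True in \<open>simp_all add: f_def\<close>)
  next
    case False
    define h where "h i = 2 * round (p i) + (if f i \<ge> 0 then 1 else - 1)" for i
    have "(p i - of_int (h i) / 2)\<^sup>2 = (f i)\<^sup>2 - \<bar>f i\<bar> + 1 / 4" for i
    proof -
      have "p i - of_int (h i) / 2 = f i - (if f i \<ge> 0 then 1/2 else - 1/2)"
        by (simp add: h_def f_def field_simps)
      hence "(p i - of_int (h i) / 2)\<^sup>2 = (f i - (if f i \<ge> 0 then 1/2 else - 1/2))\<^sup>2" by (simp only:)
      also have "\<dots> = (f i)\<^sup>2 - \<bar>f i\<bar> + 1 / 4" by (simp add: power2_eq_square algebra_simps)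
      finally show ?thesis .
    qed
    hence "(\<Sum>i<4. (p i - of_int (h i) / 2)\<^sup>2) = (\<Sum>i<4. (f i)\<^sup>2) - (\<Sum>i<4. \<bar>f i\<bar>) + 1"
      by (simp add: sum.distrib sum_subtractf)
    also have "\<dots> \<le> 1 / 2" using s2 False by linarith
    finally show ?thesis by (intro that[of h]) (simp_all add: h_def)
  qed
qed

text \<open>
  The covering radius of $D_4$ is $1$. In the boundary case the nearest lattice point is not
  unique, and the choice is used to avoid orthogonality to a given vector.
\<close>

lemma D4_rounding:
  fixes p t :: "nat \<Rightarrow> real"
  assumes p: "\<exists>i<4. p i \<noteq> 0"
  obtains d :: "nat \<Rightarrow> int" where "even (\<Sum>i<4. d i)" "(\<Sum>i<4. (t i - of_int (d i))\<^sup>2) \<le> 1"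
    "(\<Sum>i<4. (t i - of_int (d i))\<^sup>2) < 1 \<or> (\<Sum>i<4. p i * (t i - of_int (d i))) \<noteq> 0"
proof -
  note found = that
  \<comment> \<open>Deep hole with all errors 1/2 in absolute value. Reversing the signs of two
    errors gives further nearest lattice points. If all these error vectors were orthogonal to
    \<open>p\<close>, then the numbers p_i s_i would have vanishing pairwise sums, hence vanish, and
    \<open>p\<close> would be zero.\<close>
  have half: thesis
    if d: "even (\<Sum>i<4. d i)" "\<And>i. i < 4 \<Longrightarrow> \<bar>t i - of_int (d i)\<bar> = 1/2" for d :: "nat \<Rightarrow> int"
  proof -
    define s where "s i = (if t i - of_int (d i) \<ge> 0 then 1 else - 1 :: int)" for i
    have ts: "t i - of_int (d i) = of_int (s i) / 2" if "i < 4" for i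
      using d(2)[OF that] by (auto simp: s_def)
    have sq: "(of_int (s i) / 2 :: real)\<^sup>2 = 1/4" for i by (simp add: s_def power2_eq_square)
    have sod: "odd (s i)" for i by (simp add: s_def)
    define d' where "d' i j k = d k + (if k = i \<or> k = j then s k else 0)" for i j k
    have td': "t k - of_int (d' i j k) = (if k = i \<or> k = j then - (of_int (s k) / 2) else of_int (s k) / 2)" if "k < 4" for i j k
      using ts[OF that] by (simp add: d'_def field_simps)
    have norm: "(\<Sum>k<4. (t k - of_int (d' i j k))\<^sup>2) = 1" for i j
    proof -
      have "(\<Sum>k<4. (t k - of_int (d' i j k))\<^sup>2) = (\<Sum>k<4::nat. 1/4)"
        by (intro sum.cong) (auto simp: td' sq)
      thus ?thesis by simp
    qed
    have ev: "even (\<Sum>k<4. d' i j k)" if "i < 4" "j < 4" "i \<noteq> j" for i j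
    proof -
      have "(\<Sum>k<4. d' i j k) = (\<Sum>k<4. d k) + (\<Sum>k<4. if k = i \<or> k = j then s k else 0)"
        by (simp add: d'_def sum.distrib)
      also have "(\<Sum>k<4. if k = i \<or> k = j then s k else 0) = (\<Sum>k\<in>{i,j}. s k)"
        using that by (intro sum.mono_neutral_cong_right) auto
      finally show ?thesis using d(1) sod that by simp
    qed
    define P where "P = (\<Sum>k<4. p k * (of_int (s k) / 2))"
    have ip: "(\<Sum>k<4. p k * (t k - of_int (d' i j k))) = P - p i * of_int (s i) - p j * of_int (s j)" if "i < 4" "j < 4" "i \<noteq> j" for i j
    proof -
      have "(\<Sum>k<4. p k * (t k - of_int (d' i j k))) = (\<Sum>k<4. p k * (of_int (s k) / 2) - (if k = i \<or> k = j then p k * of_int (s k) else 0))"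
        by (intro sum.cong) (auto simp: td')
      also have "\<dots> = P - (\<Sum>k<4. if k = i \<or> k = j then p k * of_int (s k) else 0)"
        by (simp add: sum_subtractf P_def)
      also have "(\<Sum>k<4. if k = i \<or> k = j then p k * of_int (s k) else 0) = (\<Sum>k\<in>{i,j}. p k * of_int (s k))"
        using that by (intro sum.mono_neutral_cong_right) auto
      finally show ?thesis using that by simp
    qed
    have norm0: "(\<Sum>k<4. (t k - of_int (d k))\<^sup>2) = 1"
    proof -
      have "(\<Sum>k<4. (t k - of_int (d k))\<^sup>2) = (\<Sum>k<4::nat. 1/4)"
        by (intro sum.cong) (auto simp: ts sq)
      thus ?thesis by simp
    qed
    have ip0: "(\<Sum>k<4. p k * (t k - of_int (d k))) = P"
      unfolding P_def by (intro sum.cong) (auto simp: ts)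
    show thesis
    proof (cases "P = 0 \<and> (\<forall>i<4. \<forall>j<4. i \<noteq> j \<longrightarrow> P - p i * of_int (s i) - p j * of_int (s j) = 0)")
      case True
      define e where "e i = p i * of_int (s i)" for i
      have pair: "e i + e j = 0" if "i < 4" "j < 4" "i \<noteq> j" for i j
      proof -
        have "P - e i - e j = 0" using True that unfolding e_def by blast
        moreover have "P = 0" using True by blast
        ultimately show ?thesis by linarith
      qed
      have "e 0 + e 1 = 0" "e 0 + e 2 = 0" "e 1 + e 2 = 0" "e 0 + e 3 = 0"
        by (rule pair; simp)+
      hence "e 0 = 0" "e 1 = 0" "e 2 = 0" "e 3 = 0" by linarith+
      hence "\<forall>i<4. e i = 0" unfolding all_less_4 by simp
      moreover have "s i \<noteq> 0" for i by (simp add: s_def)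
      ultimately have "\<forall>i<4. p i = 0" by (simp add: e_def)
      with p show thesis by blast
    next
      case False
      then consider "P \<noteq> 0" | i j where "i < 4" "j < 4" "i \<noteq> j" "P - p i * of_int (s i) - p j * of_int (s j) \<noteq> 0" by blast
      thus thesis
      proof cases
        case 1
        show thesis by (rule found[of d]) (use d 1 norm0 ip0 in auto)
      next
        case (2 i j)
        show thesis by (rule found[of "d' i j"]) (use 2 ev norm ip in auto)
      qed
    qed
  qed
  define m where "m i = round (t i)" for i
  define f where "f i = t i - of_int (m i)" for i
  have f: "\<bar>f i\<bar> \<le> 1/2" for i
    using of_int_round_abs_le[of "t i"] by (simp add: f_def m_def abs_minus_commute)
  have f4: "(f i)\<^sup>2 \<le> 1/4" for i
    using power_mono[of "\<bar>f i\<bar>" "1/2" 2] f[of i] by (simp add: power2_eq_square)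
  show thesis
  proof (cases "even (\<Sum>i<4. m i)")
    case True
    show thesis
    proof (cases "\<forall>i<4. \<bar>f i\<bar> = 1/2")
      case True
      show thesis by (rule half[of m]) (use True \<open>even (\<Sum>i<4. m i)\<close> in \<open>auto simp: f_def\<close>)
    next
      case False
      then obtain i where i: "i < 4" "\<bar>f i\<bar> \<noteq> 1/2" by blast
      hence "\<bar>f i\<bar> < 1/2" using f[of i] by simp
      hence "\<bar>f i\<bar>\<^sup>2 < (1/2)\<^sup>2" by (intro power_strict_mono) auto
      hence "(f i)\<^sup>2 < 1/4" by (simp add: power2_eq_square)
      hence "(\<Sum>i<4. (f i)\<^sup>2) < (\<Sum>i<4::nat. 1/4)"
        using i f4 by (intro sum_strict_mono_ex1) auto
      hence "(\<Sum>i<4. (t i - of_int (m i))\<^sup>2) < 1" by (simp add: f_def)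
      thus thesis using that[of m] True by simp
    qed
  next
    case False
    \<comment> \<open>The rounded point has odd coordinate sum, so one coordinate must be rounded
      the other way. Taking the one with the largest error \<open>M\<close> changes the squared
      error by 1 - 2M, while f^2 \<le> M/2 bounds the old squared error by 2M.\<close>
    define M where "M = Max ((\<lambda>i. \<bar>f i\<bar>) ` {..<4})"
    have "0 \<in> {..<4::nat}" by simp
    hence "M \<in> (\<lambda>i. \<bar>f i\<bar>) ` {..<4}" unfolding M_def by (intro Max_in) blast+
    then obtain i0 where i0: "i0 < 4" "M = \<bar>f i0\<bar>" by auto
    have M: "\<bar>f i\<bar> \<le> M" if "i < 4" for i unfolding M_def using that by (intro Max_ge) auto
    have shift: "even (\<Sum>k<4. (m(i := m i + s)) k)" "(\<Sum>k<4. (t k - of_int ((m(i := m i + s)) k))\<^sup>2) = (\<Sum>k<4. (f k)\<^sup>2) - 2 * of_int s * f i + 1"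
      if "i < 4" "s = 1 \<or> s = - 1" for i s
    proof -
      have *: "(\<Sum>k<4. F k ((m(i := m i + s)) k)) = (\<Sum>k<4. F k (m k)) - F i (m i) + F i (m i + s)"
        for F :: "nat \<Rightarrow> int \<Rightarrow> 'b :: ab_group_add"
      proof -
        have "(\<Sum>k<4. F k ((m(i := m i + s)) k)) = F i (m i + s) + (\<Sum>k\<in>{..<4} - {i}. F k ((m(i := m i + s)) k))"
          using that by (subst sum.remove[of _ i]) auto
        also have "(\<Sum>k\<in>{..<4} - {i}. F k ((m(i := m i + s)) k)) = (\<Sum>k\<in>{..<4} - {i}. F k (m k))"
          by (intro sum.cong) auto
        also have "\<dots> = (\<Sum>k<4. F k (m k)) - F i (m i)" using that by (subst (2) sum.remove[of _ i]) auto
        finally show ?thesis by (simp add: algebra_simps)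
      qed
      show "even (\<Sum>k<4. (m(i := m i + s)) k)"
        using *[of "\<lambda>_ x. x"] False that by auto
      have ss: "of_int s * of_int s = (1 :: real)" using that by auto
      have "(\<Sum>k<4. (t k - of_int ((m(i := m i + s)) k))\<^sup>2) = (\<Sum>k<4. (f k)\<^sup>2) - (f i)\<^sup>2 + (f i - of_int s)\<^sup>2"
        unfolding *[of "\<lambda>k x. (t k - of_int x)\<^sup>2"] by (simp add: f_def algebra_simps)
      thus "(\<Sum>k<4. (t k - of_int ((m(i := m i + s)) k))\<^sup>2) = (\<Sum>k<4. (f k)\<^sup>2) - 2 * of_int s * f i + 1"
        using ss by (simp add: power2_eq_square algebra_simps)
    qed
    show thesis
    proof (cases "M = 0")
      \<comment> \<open>The second kind of deep hole: \<open>t\<close> is an integral vector of odd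
        sum. The error is then minus a unit vector, placed at a coordinate where \<open>p\<close>
        does not vanish.\<close>
      case True
      hence f0: "f i = 0" if "i < 4" for i using M[OF that] by simp
      obtain i where i: "i < 4" "p i \<noteq> 0" using p by blast
      let ?d = "m(i := m i + 1)"
      have 1: "(\<Sum>k<4. (t k - of_int (?d k))\<^sup>2) = 1"
        using shift(2)[OF i(1), of 1] f0 i(1) by simp
      have "(\<Sum>k<4. p k * (t k - of_int (?d k))) = (\<Sum>k\<in>{i}. - p k)"
        using i f0 by (intro sum.mono_neutral_cong_right) (auto simp: f_def)
      hence "(\<Sum>k<4. p k * (t k - of_int (?d k))) \<noteq> 0" using i by simp
      thus thesis using that[of ?d] shift(1)[OF i(1), of 1] 1 by simp
    next
      case False
      hence Mpos: "M > 0" using i0 by auto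
      define s where "s = (if f i0 \<ge> 0 then 1 else - 1 :: int)"
      have s: "s = 1 \<or> s = - 1" and sf: "of_int s * f i0 = M" by (auto simp: s_def i0)
      let ?d = "m(i0 := m i0 + s)"
      have nrm: "(\<Sum>k<4. (t k - of_int (?d k))\<^sup>2) = (\<Sum>k<4. (f k)\<^sup>2) - 2 * M + 1"
        using shift(2)[OF i0(1) s] sf by simp
      show thesis
      proof (cases "\<forall>i<4. \<bar>f i\<bar> = 1/2")
        case True
        have "\<bar>t i - of_int (?d i)\<bar> = 1/2" if "i < 4" for i
          using True that i0(1) by (auto simp: f_def s_def abs_if split: if_splits)
        with shift(1)[OF i0(1) s] show thesis by (rule half)
      next
        case False
        then obtain i where i: "i < 4" "\<bar>f i\<bar> \<noteq> 1/2" by blast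
        hence fi: "\<bar>f i\<bar> < 1/2" using f[of i] by simp
        have "(\<Sum>k<4. (f k)\<^sup>2) < (\<Sum>k<4::nat. M * (1/2))"
        proof (rule sum_strict_mono_ex1)
          show "\<forall>x\<in>{..<4}. (f x)\<^sup>2 \<le> M * (1/2)"
          proof
            fix x assume "x \<in> {..<4::nat}"
            hence "\<bar>f x\<bar> * \<bar>f x\<bar> \<le> M * (1/2)" using M f Mpos by (intro mult_mono) auto
            thus "(f x)\<^sup>2 \<le> M * (1/2)" by (simp add: power2_eq_square)
          qed
          have "\<bar>f i\<bar> * \<bar>f i\<bar> \<le> M * \<bar>f i\<bar>" using M i by (intro mult_right_mono) auto
          also have "\<dots> < M * (1/2)" using fi Mpos by (intro mult_strict_left_mono) auto
          finally have "(f i)\<^sup>2 < M * (1/2)" by (simp add: power2_eq_square)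
          thus "\<exists>a\<in>{..<4}. (f a)\<^sup>2 < M * (1/2)" using i by blast
        qed auto
        hence "(\<Sum>k<4. (t k - of_int (?d k))\<^sup>2) < 1" unfolding nrm by simp
        thus thesis using that[of ?d] shift(1)[OF i0(1) s] by simp
      qed
    qed
  qed
qed

text \<open>With P and Q the error vectors, the remainder has quaternion coordinates P + Q/sqrt 2,
  and its reduced norm is |P|^2 + |Q|^2/2 + sqrt 2 (P.Q). The left-hand side is the field norm of
  that. As |P|^2 \<le> 1/2 and |Q|^2 \<le> 1, the first square is below 1 unless |Q| = 1, and then
  the tie-breaking gives P.Q \<noteq> 0. If P = 0, the bound is far from sharp.\<close>

lemma joint_rounding:
  fixes p t :: "nat \<Rightarrow> real"
  obtains h d :: "nat \<Rightarrow> int" where "\<And>i j. i < 4 \<Longrightarrow> j < 4 \<Longrightarrow> even (h i + h j)" "even (\<Sum>i<4. d i)"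
    "((\<Sum>i<4. (p i - of_int (h i) / 2)\<^sup>2) + (\<Sum>i<4. (t i - of_int (d i))\<^sup>2) / 2)\<^sup>2
       - 2 * (\<Sum>i<4. (p i - of_int (h i) / 2) * (t i - of_int (d i)))\<^sup>2 < 1"
proof -
  obtain h where h: "\<And>i j. i < 4 \<Longrightarrow> j < 4 \<Longrightarrow> even (h i + h j)" "(\<Sum>i<4. (p i - of_int (h i) / 2)\<^sup>2) \<le> 1 / 2"
    by (rule hurwitz_rounding[of p]) blast
  define p' where "p' i = p i - of_int (h i) / 2" for i
  have p'2: "0 \<le> (\<Sum>i<4. (p' i)\<^sup>2)" "(\<Sum>i<4. (p' i)\<^sup>2) \<le> 1/2" using h(2) by (auto intro: sum_nonneg simp: p'_def)
  have lt1: "(a + b / 2)\<^sup>2 < 1" if "0 \<le> a" "0 \<le> b" "a \<le> 1/2" "b \<le> 1" "a < 1/2 \<or> b < 1" for a b :: real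
  proof -
    have "\<bar>a + b / 2\<bar> < 1" using that by auto
    thus ?thesis by (simp add: abs_square_less_1)
  qed
  show thesis
  proof (cases "\<exists>i<4. p' i \<noteq> 0")
    case True
    obtain d where d: "even (\<Sum>i<4. d i)" "(\<Sum>i<4. (t i - of_int (d i))\<^sup>2) \<le> 1"
      "(\<Sum>i<4. (t i - of_int (d i))\<^sup>2) < 1 \<or> (\<Sum>i<4. p' i * (t i - of_int (d i))) \<noteq> 0"
      by (rule D4_rounding[OF True, of t]) blast
    have nn: "0 \<le> (\<Sum>i<4. (t i - of_int (d i))\<^sup>2)" by (intro sum_nonneg) auto
    from d(3) have "((\<Sum>i<4. (p' i)\<^sup>2) + (\<Sum>i<4. (t i - of_int (d i))\<^sup>2) / 2)\<^sup>2
       - 2 * (\<Sum>i<4. p' i * (t i - of_int (d i)))\<^sup>2 < 1"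
    proof
      assume "(\<Sum>i<4. (t i - of_int (d i))\<^sup>2) < 1"
      with lt1[OF p'2(1) nn p'2(2) d(2)]
      have "((\<Sum>i<4. (p' i)\<^sup>2) + (\<Sum>i<4. (t i - of_int (d i))\<^sup>2) / 2)\<^sup>2 < 1" by blast
      thus ?thesis by (smt (verit) zero_le_power2)
    next
      assume ne: "(\<Sum>i<4. p' i * (t i - of_int (d i))) \<noteq> 0"
      have "\<bar>(\<Sum>i<4. (p' i)\<^sup>2) + (\<Sum>i<4. (t i - of_int (d i))\<^sup>2) / 2\<bar> \<le> 1" using p'2 d(2) nn by simp
      hence "((\<Sum>i<4. (p' i)\<^sup>2) + (\<Sum>i<4. (t i - of_int (d i))\<^sup>2) / 2)\<^sup>2 \<le> 1" by (simp add: abs_square_le_1)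
      moreover have "0 < (\<Sum>i<4. p' i * (t i - of_int (d i)))\<^sup>2" using ne by simp
      ultimately show ?thesis by linarith
    qed
    with h(1) d(1) show thesis unfolding p'_def by (rule that)
  next
    case False
    \<comment> \<open>Any nonzero vector will do here, since the errors \<open>p'\<close> vanish and
      only the bound 1 is used; the constant 1 is a placeholder.\<close>
    obtain d where d: "even (\<Sum>i<4. d i)" "(\<Sum>i<4. (t i - of_int (d i))\<^sup>2) \<le> 1"
      by (rule D4_rounding[of "\<lambda>_. 1" t]) (auto intro: exI[of _ 0])
    have nn: "0 \<le> (\<Sum>i<4. (t i - of_int (d i))\<^sup>2)" by (intro sum_nonneg) auto
    have z: "(\<Sum>i<4. (p' i)\<^sup>2) = 0" using False by (intro sum.neutral) auto
    have "((\<Sum>i<4. (p' i)\<^sup>2) + (\<Sum>i<4. (t i - of_int (d i))\<^sup>2) / 2)\<^sup>2 < 1"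
      using lt1[OF p'2(1) nn p'2(2) d(2)] z by simp
    moreover have "0 \<le> (\<Sum>i<4. p' i * (t i - of_int (d i)))\<^sup>2" by simp
    ultimately have "((\<Sum>i<4. (p' i)\<^sup>2) + (\<Sum>i<4. (t i - of_int (d i))\<^sup>2) / 2)\<^sup>2
       - 2 * (\<Sum>i<4. p' i * (t i - of_int (d i)))\<^sup>2 < 1" by linarith
    with h(1) d(1) show thesis unfolding p'_def by (rule that)
  qed
qed

section \<open>Euclidean division in the maximal order\<close>

lemma oct_division:
  assumes "\<rho> \<noteq> 0"
  shows "\<exists>x. fnorm (nn (q - x * \<rho>)) < fnorm (nn \<rho>)"
proof -
  define n where "n = fnorm (nn \<rho>)"
  have n: "n > 0" using totpos_nn[OF assms] by (simp add: totpos_def n_def)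
  \<comment> \<open>\<open>c\<close> is q \<rho>^(-1) scaled by \<open>n\<close>: the quaternion
    conjugate inverts \<rho> up to \<open>nn \<rho>\<close>, and the factor
    \<open>cjg (nn \<rho>)\<close> turns that denominator into the rational integer
    \<open>n\<close>.\<close>
  define c where "c = q * qcnj \<rho> * scal (cjg (nn \<rho>))"
  define A B where "A i = rpart ([w0 c, w1 c, w2 c, w3 c] ! i)" and "B i = spart ([w0 c, w1 c, w2 c, w3 c] ! i)" for i
  obtain h d where h: "\<And>i j. i < 4 \<Longrightarrow> j < 4 \<Longrightarrow> even (h i + h j)" and d: "even (\<Sum>i<4. d i)"
    and lt: "((\<Sum>i<4. (of_int (A i) / of_int (2 * n) - of_int (h i) / 2)\<^sup>2) + (\<Sum>i<4. (of_int (B i) / of_int n - of_int (d i))\<^sup>2) / 2)\<^sup>2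
       - 2 * (\<Sum>i<4. (of_int (A i) / of_int (2 * n) - of_int (h i) / 2) * (of_int (B i) / of_int n - of_int (d i)))\<^sup>2 < (1 :: real)"
    by (rule joint_rounding[of "\<lambda>i. of_int (A i) / of_int (2 * n)" "\<lambda>i. of_int (B i) / of_int n"]) blast
  have "even (d 0 + d 1 + d 2 + d 3)" using d by (simp add: sum_lessThan_4)
  then obtain x where x: "w0 x = ZS (h 0) (d 0)" "w1 x = ZS (h 1) (d 1)" "w2 x = ZS (h 2) (d 2)" "w3 x = ZS (h 3) (d 3)"
    using exists_oct_of_parts[of "h 0" "h 1" "h 2" "h 3" "d 0" "d 1" "d 2" "d 3"] h by auto
  define y where "y = c - scal (of_int n) * x"
  have w: "w0 y = w0 c - of_int n * w0 x" "w1 y = w1 c - of_int n * w1 x"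
    "w2 y = w2 c - of_int n * w2 x" "w3 y = w3 c - of_int n * w3 x"
    by (simp_all add: y_def w_defs algebra_simps)
  define a b where "a i = A i - n * h i" and "b i = B i - n * d i" for i
  have wy: "w0 y = ZS (a 0) (b 0)" "w1 y = ZS (a 1) (b 1)" "w2 y = ZS (a 2) (b 2)" "w3 y = ZS (a 3) (b 3)"
    unfolding w x by (simp_all add: zs2_eq_iff zs2_sel_mult a_def b_def A_def B_def)
  define S T where "S = (\<Sum>i<4. a i * a i) + 2 * (\<Sum>i<4. b i * b i)" and "T = 2 * (\<Sum>i<4. a i * b i)"
  have nny: "4 * nn y = ZS S T"
    unfolding four_nn wy by (simp add: zs2_eq_iff zs2_sel_mult S_def T_def sum_lessThan_4 algebra_simps)
  have "16 * fnorm (nn y) = fnorm (4 * nn y)" by (simp only: fnorm_mult) (simp add: fnorm_def)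
  also have "\<dots> = S\<^sup>2 - 2 * T\<^sup>2" unfolding nny by (simp add: fnorm_def)
  finally have N: "16 * fnorm (nn y) = S\<^sup>2 - 2 * T\<^sup>2" .
  let ?P = "\<lambda>i. of_int (A i) / of_int (2 * n) - of_int (h i) / 2 :: real"
  let ?Q = "\<lambda>i. of_int (B i) / of_int n - of_int (d i) :: real"
  have pq: "of_int (a i) = 2 * of_int n * ?P i" "of_int (b i) = of_int n * ?Q i" for i
    using n by (simp_all add: a_def b_def field_simps)
  have "of_int S = (\<Sum>i<4. (2 * of_int n * ?P i)\<^sup>2) + 2 * (\<Sum>i<4. (of_int n * ?Q i)\<^sup>2)"
    unfolding pq[symmetric] by (simp add: S_def power2_eq_square)
  also have "\<dots> = 4 * (of_int n)\<^sup>2 * ((\<Sum>i<4. (?P i)\<^sup>2) + (\<Sum>i<4. (?Q i)\<^sup>2) / 2)"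
    by (simp only: power_mult_distrib sum_distrib_left[symmetric]) (simp add: algebra_simps)
  finally have S: "of_int S = 4 * (of_int n)\<^sup>2 * ((\<Sum>i<4. (?P i)\<^sup>2) + (\<Sum>i<4. (?Q i)\<^sup>2) / 2)" .
  have "of_int T = 2 * (\<Sum>i<4. (2 * of_int n * ?P i) * (of_int n * ?Q i))"
    unfolding pq[symmetric] by (simp add: T_def)
  also have "(\<Sum>i<4. (2 * of_int n * ?P i) * (of_int n * ?Q i)) = (\<Sum>i<4. 2 * (of_int n)\<^sup>2 * (?P i * ?Q i))"
    by (intro sum.cong) (simp_all only: power2_eq_square ac_simps)
  finally have T: "of_int T = 4 * (of_int n)\<^sup>2 * (\<Sum>i<4. ?P i * ?Q i)"
    by (simp only: sum_distrib_left[symmetric])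
  have "real_of_int (16 * fnorm (nn y)) = (of_int S)\<^sup>2 - 2 * (of_int T)\<^sup>2" unfolding N by simp
  also have "\<dots> = 16 * (of_int n) ^ 4 * (((\<Sum>i<4. (?P i)\<^sup>2) + (\<Sum>i<4. (?Q i)\<^sup>2) / 2)\<^sup>2 - 2 * (\<Sum>i<4. ?P i * ?Q i)\<^sup>2)"
    unfolding S T by (simp only: power_mult_distrib right_diff_distrib power_mult[symmetric]) simp
  also have "\<dots> < 16 * (of_int n) ^ 4 * 1" using n lt by (intro mult_strict_left_mono) auto
  also have "\<dots> = real_of_int (16 * n ^ 4)" by simp
  finally have "16 * fnorm (nn y) < 16 * n ^ 4" by (simp only: of_int_less_iff)
  hence small: "fnorm (nn y) < n ^ 4" by simp
  have "c * \<rho> = q * qcnj \<rho> * (\<rho> * scal (cjg (nn \<rho>)))"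
    by (simp only: c_def mult.assoc scal_commute[of \<rho>])
  also have "\<dots> = q * (qcnj \<rho> * \<rho>) * scal (cjg (nn \<rho>))"
    by (simp only: mult.assoc)
  also have "\<dots> = q * scal (nn \<rho> * cjg (nn \<rho>))"
    by (simp only: qcnj_mult mult.assoc scal_simps)
  also have "\<dots> = scal (nn \<rho> * cjg (nn \<rho>)) * q" by (rule scal_commute)
  also have "\<dots> = scal (of_int n) * q" by (simp only: mult_cjg n_def)
  finally have "y * \<rho> = scal (of_int n) * (q - x * \<rho>)"
    by (simp add: y_def left_diff_distrib right_diff_distrib mult.assoc)
  hence "nn y * nn \<rho> = of_int n * of_int n * nn (q - x * \<rho>)"
    by (metis nn_mult nn_simps(3))
  hence "fnorm (nn y) * n = n ^ 4 * fnorm (nn (q - x * \<rho>))"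
    by (metis (no_types, lifting) fnorm_mult fnorm_simps(3) n_def power_add_numeral numeral_Bit0 power2_eq_square power4_eq_xxxx mult.assoc)
  moreover have "fnorm (nn y) * n < n ^ 4 * n" using small n by simp
  ultimately have "n ^ 4 * fnorm (nn (q - x * \<rho>)) < n ^ 4 * n" by simp
  hence "fnorm (nn (q - x * \<rho>)) < n" using n by (simp add: mult_less_cancel_left)
  thus ?thesis unfolding n_def by blast
qed

definition left_ideal :: "oct set \<Rightarrow> bool" where
  "left_ideal L \<longleftrightarrow> 0 \<in> L \<and> (\<forall>x\<in>L. \<forall>y\<in>L. x - y \<in> L) \<and> (\<forall>a. \<forall>x\<in>L. a * x \<in> L)"

lemma left_ideal_principal:
  assumes L: "left_ideal L" and nz: "x0 \<in> L" "x0 \<noteq> 0"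
  obtains \<rho> where "L = range (\<lambda>x. x * \<rho>)" "\<rho> \<noteq> 0"
proof -
  obtain \<rho> where \<rho>: "\<rho> \<in> L" "\<rho> \<noteq> 0" and min: "\<And>y. y \<in> L \<and> y \<noteq> 0 \<Longrightarrow> nat (fnorm (nn \<rho>)) \<le> nat (fnorm (nn y))"
    using ex_has_least_nat[of "\<lambda>x. x \<in> L \<and> x \<noteq> 0" x0 "\<lambda>x. nat (fnorm (nn x))"] nz by auto
  have "L = range (\<lambda>x. x * \<rho>)"
  proof
    show "range (\<lambda>x. x * \<rho>) \<subseteq> L" using L \<rho> by (auto simp: left_ideal_def)
    show "L \<subseteq> range (\<lambda>x. x * \<rho>)"
    proof
      fix q assume q: "q \<in> L"
      obtain x where x: "fnorm (nn (q - x * \<rho>)) < fnorm (nn \<rho>)" using oct_division[OF \<rho>(2)] by blast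
      have mem: "q - x * \<rho> \<in> L" using L q \<rho> by (auto simp: left_ideal_def)
      have "q - x * \<rho> = 0"
      proof (rule ccontr)
        assume ne: "q - x * \<rho> \<noteq> 0"
        have "0 < fnorm (nn (q - x * \<rho>))" using totpos_nn[OF ne] by (simp add: totpos_def)
        with min[of "q - x * \<rho>"] mem ne x show False by simp
      qed
      thus "q \<in> range (\<lambda>x. x * \<rho>)" by auto
    qed
  qed
  thus ?thesis using that \<rho> by blast
qed


section \<open>The Hecke recursion\<close>

definition reps :: "zs2 \<Rightarrow> oct set" where "reps \<alpha> = {x. nn x = \<alpha>}"

definition rO :: "zs2 \<Rightarrow> nat" where "rO \<alpha> = card (reps \<alpha>)"

text \<open>The rational part of \<open>four_nn\<close> writes 4 times the rational part of \<alpha>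
  as a positive definite form in the eight integer coordinates, which bounds all of them.\<close>

lemma finite_reps [simp]: "finite (reps \<alpha>)"
proof (rule finite_imageD)
  define N where "N = 4 * \<bar>rpart \<alpha>\<bar>"
  define B where "B = (\<lambda>(a, b). ZS a b) ` ({-N..N} \<times> {-N..N})"
  let ?w = "\<lambda>x. (w0 x, w1 x, w2 x, w3 x)"
  have bound: "\<bar>z\<bar> \<le> M" if "z * z \<le> M" for z M :: int
  proof -
    have "\<bar>z\<bar> \<le> z * z"
    proof (cases "z = 0")
      case False
      hence "\<bar>z\<bar> * 1 \<le> \<bar>z\<bar> * \<bar>z\<bar>" by (intro mult_left_mono) linarith+
      thus ?thesis by (simp add: abs_mult_self_eq)
    qed simp
    with that show ?thesis by simp
  qed
  show "finite (?w ` reps \<alpha>)"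
  proof (rule finite_subset)
    show "?w ` reps \<alpha> \<subseteq> B \<times> B \<times> B \<times> B"
    proof (rule image_subsetI)
      fix x assume "x \<in> reps \<alpha>"
      hence "rpart (w0 x * w0 x + w1 x * w1 x + w2 x * w2 x + w3 x * w3 x) = 4 * rpart \<alpha>"
        unfolding four_nn[symmetric] reps_def by (simp add: zs2_sel_mult)
      hence s: "(rpart (w0 x) * rpart (w0 x) + rpart (w1 x) * rpart (w1 x) + rpart (w2 x) * rpart (w2 x) + rpart (w3 x) * rpart (w3 x))
        + 2 * (spart (w0 x) * spart (w0 x) + spart (w1 x) * spart (w1 x) + spart (w2 x) * spart (w2 x) + spart (w3 x) * spart (w3 x)) = 4 * rpart \<alpha>"
        by (simp add: zs2_sel_mult)
      have sq: "0 \<le> z * z" for z :: int by simp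
      have mem: "z \<in> B" if "rpart z * rpart z \<le> N" "spart z * spart z \<le> N" for z
        using bound[OF that(1)] bound[OF that(2)] unfolding B_def
        by (intro image_eqI[of _ _ "(rpart z, spart z)"]) auto
      have bnd: "a1 \<le> N \<and> a2 \<le> N \<and> a3 \<le> N \<and> a4 \<le> N \<and> b1 \<le> N \<and> b2 \<le> N \<and> b3 \<le> N \<and> b4 \<le> N"
        if "(a1 + a2 + a3 + a4) + 2 * (b1 + b2 + b3 + b4) = 4 * rpart \<alpha>" "0 \<le> a1" "0 \<le> a2" "0 \<le> a3" "0 \<le> a4"
          "0 \<le> b1" "0 \<le> b2" "0 \<le> b3" "0 \<le> b4" for a1 a2 a3 a4 b1 b2 b3 b4
        using that by (simp add: N_def)
      have "w0 x \<in> B \<and> w1 x \<in> B \<and> w2 x \<in> B \<and> w3 x \<in> B"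
        using bnd[OF s sq sq sq sq sq sq sq sq] mem by blast
      thus "?w x \<in> B \<times> B \<times> B \<times> B" by simp
    qed
    show "finite (B \<times> B \<times> B \<times> B)" by (simp add: B_def)
  qed
  show "inj_on ?w (reps \<alpha>)"
    by (intro inj_onI) (auto simp: w_defs oct_eq_iff)
qed

lemma rO_unit_mult:
  assumes "u dvd 1"
  shows "rO (u * u * \<alpha>) = rO \<alpha>"
proof -
  from assms obtain v where v: "u * v = 1" by (metis dvdE)
  have "bij_betw (\<lambda>x. scal u * x) (reps \<alpha>) (reps (u * u * \<alpha>))"
  proof (rule bij_betwI[where g = "\<lambda>x. scal v * x"])
    have "v * v * (u * u * \<alpha>) = (u * v) * (u * v) * \<alpha>" by (simp only: ac_simps)
    thus "(\<lambda>x. scal v * x) \<in> reps (u * u * \<alpha>) \<rightarrow> reps \<alpha>" using v by (simp add: reps_def)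
  qed (use v in \<open>auto simp: reps_def mult.assoc[symmetric] mult.commute[of v u] simp flip: scal_simps\<close>,
       simp_all add: scal_simps)
  thus ?thesis by (simp add: rO_def bij_betw_same_card)
qed

definition residue_system :: "zs2 \<Rightarrow> zs2 set \<Rightarrow> bool" where
  "residue_system \<pi> R \<longleftrightarrow> finite R \<and> (\<forall>x. \<exists>!r. r \<in> R \<and> \<pi> dvd x - r)"

text \<open>
  The four forms are the entries of a surjective ring homomorphism to the $2 \times 2$ matrices
  modulo m; of the surjectivity only the hits on two matrix units are needed.
\<close>

locale splitting =
  fixes m :: zs2 and f11 f12 f21 f22 :: "oct \<Rightarrow> zs2"
  assumes diff: "f11 (x - y) = f11 x - f11 y" "f12 (x - y) = f12 x - f12 y"
      "f21 (x - y) = f21 x - f21 y" "f22 (x - y) = f22 x - f22 y"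
    and smult: "f11 (scal s * x) = s * f11 x" "f12 (scal s * x) = s * f12 x"
      "f21 (scal s * x) = s * f21 x" "f22 (scal s * x) = s * f22 x"
    and mult: "m dvd f11 (x * y) - (f11 x * f11 y + f12 x * f21 y)"
      "m dvd f12 (x * y) - (f11 x * f12 y + f12 x * f22 y)"
      "m dvd f21 (x * y) - (f21 x * f11 y + f22 x * f21 y)"
      "m dvd f22 (x * y) - (f21 x * f12 y + f22 x * f22 y)"
    and det: "m dvd f11 x * f22 x - f12 x * f21 x - nn x"
    and kernel: "m dvd f11 x \<Longrightarrow> m dvd f12 x \<Longrightarrow> m dvd f21 x \<Longrightarrow> m dvd f22 x \<Longrightarrow> \<exists>y. x = scal m * y"
    and e11: "\<exists>x. m dvd f11 x - 1 \<and> m dvd f12 x \<and> m dvd f21 x \<and> m dvd f22 x"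
    and e12: "\<exists>x. m dvd f11 x \<and> m dvd f12 x - 1 \<and> m dvd f21 x \<and> m dvd f22 x"
begin

text \<open>The elements whose matrix kills the column vector \<open>v\<close> modulo
  \<open>m\<close>.\<close>

definition ann :: "zs2 \<times> zs2 \<Rightarrow> oct set" where
  "ann v = {x. m dvd f11 x * fst v + f12 x * snd v \<and> m dvd f21 x * fst v + f22 x * snd v}"

lemma f_zero [simp]: "f11 0 = 0" "f12 0 = 0" "f21 0 = 0" "f22 0 = 0"
  using diff[of 0 0] by simp_all

lemma mult_vec:
  "m dvd (f11 (a * x) * s + f12 (a * x) * t) - (f11 a * (f11 x * s + f12 x * t) + f12 a * (f21 x * s + f22 x * t))"
  "m dvd (f21 (a * x) * s + f22 (a * x) * t) - (f21 a * (f11 x * s + f12 x * t) + f22 a * (f21 x * s + f22 x * t))"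
proof -
  have "(f11 (a * x) * s + f12 (a * x) * t) - (f11 a * (f11 x * s + f12 x * t) + f12 a * (f21 x * s + f22 x * t))
    = (f11 (a * x) - (f11 a * f11 x + f12 a * f21 x)) * s + (f12 (a * x) - (f11 a * f12 x + f12 a * f22 x)) * t"
    by (simp add: algebra_simps)
  thus "m dvd (f11 (a * x) * s + f12 (a * x) * t) - (f11 a * (f11 x * s + f12 x * t) + f12 a * (f21 x * s + f22 x * t))"
    using mult by (simp only: dvd_add dvd_mult2)
  have "(f21 (a * x) * s + f22 (a * x) * t) - (f21 a * (f11 x * s + f12 x * t) + f22 a * (f21 x * s + f22 x * t))
    = (f21 (a * x) - (f21 a * f11 x + f22 a * f21 x)) * s + (f22 (a * x) - (f21 a * f12 x + f22 a * f22 x)) * t"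
    by (simp add: algebra_simps)
  thus "m dvd (f21 (a * x) * s + f22 (a * x) * t) - (f21 a * (f11 x * s + f12 x * t) + f22 a * (f21 x * s + f22 x * t))"
    using mult by (simp only: dvd_add dvd_mult2)
qed

lemma dvd_of_diff: "m dvd a - b \<Longrightarrow> m dvd b \<Longrightarrow> m dvd a"
  by (metis diff_add_cancel dvd_add)

lemma left_ideal_ann: "left_ideal (ann v)"
  unfolding left_ideal_def
proof (intro conjI ballI allI)
  show "0 \<in> ann v" by (simp add: ann_def)
next
  fix x y assume "x \<in> ann v" "y \<in> ann v"
  moreover have "f11 (x - y) * fst v + f12 (x - y) * snd v = (f11 x * fst v + f12 x * snd v) - (f11 y * fst v + f12 y * snd v)"
    "f21 (x - y) * fst v + f22 (x - y) * snd v = (f21 x * fst v + f22 x * snd v) - (f21 y * fst v + f22 y * snd v)"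
    by (simp_all add: diff algebra_simps)
  ultimately show "x - y \<in> ann v" by (simp add: ann_def dvd_diff)
next
  fix a x assume x: "x \<in> ann v"
  show "a * x \<in> ann v"
    unfolding ann_def
    by (intro CollectI conjI; rule dvd_of_diff[OF mult_vec(1)] dvd_of_diff[OF mult_vec(2)]; use x in \<open>simp add: ann_def\<close>)
qed

lemma scal_m_mem_ann: "scal m * x \<in> ann v"
  by (simp add: ann_def smult mult.assoc)

text \<open>For prime \<open>m\<close> and a residue system \<open>R\<close>, one representative of
  each point of the projective line over the residue field; the first is the point at
  infinity.\<close>

definition lines :: "zs2 set \<Rightarrow> (zs2 \<times> zs2) set" where
  "lines R = insert (0, 1) ((\<lambda>s. (1, s)) ` R)"

lemma card_lines: "finite R \<Longrightarrow> card (lines R) = card R + 1"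
  by (subst lines_def, subst card_insert_disjoint) (auto simp: card_image inj_on_def)

lemma finite_lines: "finite R \<Longrightarrow> finite (lines R)"
  by (simp add: lines_def)

text \<open>Needed to know that the annihilator is strictly larger than the multiples of
  \<open>m\<close>, so that its generator is not \<open>m\<close> up to a unit. The matrix unit at
  position 1,1 kills (0, 1).\<close>

lemma ann_nontrivial:
  assumes "fst v = 1 \<or> v = (0, 1)" "\<not> m dvd 1"
  shows "\<exists>x \<in> ann v. \<not> (m dvd f11 x \<and> m dvd f12 x \<and> m dvd f21 x \<and> m dvd f22 x)"
proof -
  obtain x1 where x1: "m dvd f11 x1 - 1" "m dvd f12 x1" "m dvd f21 x1" "m dvd f22 x1" using e11 by blast
  obtain x2 where x2: "m dvd f11 x2" "m dvd f12 x2 - 1" "m dvd f21 x2" "m dvd f22 x2" using e12 by blast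
  have not: "\<not> m dvd a" if "m dvd a - 1" for a
  proof
    assume "m dvd a"
    hence "m dvd a - (a - 1)" using that by (rule dvd_diff)
    thus False using assms(2) by simp
  qed
  from assms(1) show ?thesis
  proof
    assume "v = (0, 1)"
    hence "x1 \<in> ann v" using x1 by (simp add: ann_def)
    thus ?thesis using not[OF x1(1)] by blast
  next
    assume v: "fst v = 1"
    define s where "s = snd v"
    \<comment> \<open>The matrix with first row (s, -1) and zero second row kills (1, s).\<close>
    let ?x = "scal s * x1 - x2"
    have "f11 ?x + f12 ?x * s = (f11 x1 - 1) * s + f12 x1 * (s * s) - f11 x2 - (f12 x2 - 1) * s"
      by (simp add: diff smult algebra_simps)
    hence "m dvd f11 ?x + f12 ?x * s" using x1 x2 by simp
    moreover have "f21 ?x + f22 ?x * s = f21 x1 * s + f22 x1 * (s * s) - f21 x2 - f22 x2 * s"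
      by (simp add: diff smult algebra_simps)
    hence "m dvd f21 ?x + f22 ?x * s" using x1 x2 by simp
    ultimately have "?x \<in> ann v" by (simp add: ann_def v s_def)
    moreover have "\<not> m dvd f12 ?x"
    proof
      assume "m dvd f12 ?x"
      hence "m dvd s * f12 x1 - f12 ?x" using x1 by simp
      thus False using not[OF x2(2)] by (simp add: diff smult)
    qed
    ultimately show ?thesis by blast
  qed
qed

text \<open>One coordinate of \<open>v\<close> is 1, so a matrix killing \<open>v\<close> has
  determinant zero modulo \<open>m\<close>, and the determinant is congruent to the norm.\<close>

lemma nn_dvd_of_mem_ann:
  assumes "x \<in> ann v" "fst v = 1 \<or> v = (0, 1)"
  shows "m dvd nn x"
proof -
  have "m dvd f11 x * f22 x - f12 x * f21 x"
    using assms(2)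
  proof
    assume v: "fst v = 1"
    have "f11 x * f22 x - f12 x * f21 x = (f11 x + f12 x * snd v) * f22 x - f12 x * (f21 x + f22 x * snd v)"
      by (simp add: algebra_simps)
    thus ?thesis using assms(1) v by (simp add: ann_def)
  qed (use assms(1) in \<open>simp add: ann_def\<close>)
  hence "m dvd (f11 x * f22 x - f12 x * f21 x) - (f11 x * f22 x - f12 x * f21 x - nn x)"
    using det by (rule dvd_diff)
  thus ?thesis by simp
qed

end

locale prime_splitting = splitting +
  assumes prime: "prime_elem m" and pos: "totpos m"
begin

lemma not_dvd_one: "\<not> m dvd 1"
  using prime by (auto simp: prime_elem_def)

lemma m_nonzero: "m \<noteq> 0"
  using pos totpos_nonzero by blast

text \<open>Writing \<open>m\<close> as \<sigma>\<rho> gives m^2 = nn \<sigma> nn \<rho>, and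
  \<open>m\<close> divides nn \<rho>. If nn \<sigma> were a unit, the ideal would consist of
  multiples of \<open>m\<close>, against \<open>ann_nontrivial\<close>. As \<open>m\<close> is
  irreducible, nn \<rho> is \<open>m\<close> times a totally positive unit, whose square root is
  scaled away.\<close>

lemma ann_generator:
  assumes v: "fst v = 1 \<or> v = (0, 1)"
  obtains \<rho> where "ann v = range (\<lambda>x. x * \<rho>)" "nn \<rho> = m"
proof -
  have "scal m \<in> ann v" using scal_m_mem_ann[of 1] by simp
  moreover have "scal m \<noteq> 0" using m_nonzero by (simp add: oct_eq_iff)
  ultimately obtain \<rho> where \<rho>: "ann v = range (\<lambda>x. x * \<rho>)" "\<rho> \<noteq> 0"
    using left_ideal_principal[OF left_ideal_ann] by blast
  obtain \<sigma> where \<sigma>: "scal m = \<sigma> * \<rho>" using \<open>scal m \<in> ann v\<close> \<rho>(1) by auto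
  have "1 * \<rho> \<in> ann v" unfolding \<rho>(1) by blast
  hence "m dvd nn \<rho>" using nn_dvd_of_mem_ann v by simp
  then obtain \<kappa> where \<kappa>: "nn \<rho> = m * \<kappa>" by (elim dvdE)
  have "m * m = nn \<sigma> * nn \<rho>" using arg_cong[OF \<sigma>, of nn] by simp
  hence "m * m = m * (nn \<sigma> * \<kappa>)" by (simp add: \<kappa> ac_simps)
  hence m: "m = nn \<sigma> * \<kappa>" using m_nonzero by simp
  have "\<not> nn \<sigma> dvd 1"
  proof
    assume "nn \<sigma> dvd 1"
    then obtain u where u: "1 = nn \<sigma> * u" by (elim dvdE)
    have "scal u * qcnj \<sigma> * scal m = scal u * (qcnj \<sigma> * \<sigma>) * \<rho>" by (simp add: \<sigma> mult.assoc)
    also have "\<dots> = scal (nn \<sigma> * u) * \<rho>"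
      by (simp only: qcnj_mult mult.commute[of "nn \<sigma>" u] scal_simps)
    also have "\<dots> = \<rho>" by (simp only: u[symmetric] scal_simps) simp
    finally have \<rho>m: "\<rho> = scal m * (scal u * qcnj \<sigma>)" by (metis scal_commute)
    obtain x where x: "x \<in> ann v" "\<not> (m dvd f11 x \<and> m dvd f12 x \<and> m dvd f21 x \<and> m dvd f22 x)"
      using ann_nontrivial[OF v not_dvd_one] by blast
    obtain y where "x = y * \<rho>" using x(1) \<rho>(1) by auto
    hence "x = y * (scal m * (scal u * qcnj \<sigma>))" by (subst (asm) \<rho>m)
    also have "\<dots> = scal m * (y * (scal u * qcnj \<sigma>))" by (rule scal_left_commute)
    finally have "x = scal m * (y * (scal u * qcnj \<sigma>))" .
    thus False using x(2) by (simp add: smult)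
  qed
  hence \<kappa>1: "\<kappa> dvd 1" using irreducibleD[OF prime_elem_imp_irreducible_zs2[OF prime] m] by blast
  moreover have "totpos \<kappa>" using totpos_nn[OF \<rho>(2)] pos unfolding \<kappa> by (rule totpos_mult_cancel[rotated])
  ultimately obtain w where w: "\<kappa> = w * w" "w dvd 1" using totpos_unit_square by blast
  then obtain w' where w': "w * w' = 1" by (metis dvdE)
  let ?\<rho> = "scal w' * \<rho>"
  have "nn ?\<rho> = m * ((w * w') * (w * w'))" by (simp add: \<kappa> w(1) ac_simps)
  hence "nn ?\<rho> = m" by (simp add: w')
  moreover have "range (\<lambda>x. x * ?\<rho>) = range (\<lambda>x. x * \<rho>)"
  proof (intro subset_antisym subsetI)
    fix y assume "y \<in> range (\<lambda>x. x * ?\<rho>)"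
    then obtain x where "y = x * scal w' * \<rho>" by (auto simp: mult.assoc)
    thus "y \<in> range (\<lambda>x. x * \<rho>)" by blast
  next
    fix y assume "y \<in> range (\<lambda>x. x * \<rho>)"
    then obtain x where "y = x * \<rho>" by auto
    also have "\<dots> = x * (scal (w * w') * \<rho>)" by (simp add: w' scal_simps)
    also have "\<dots> = (x * scal w) * ?\<rho>" by (simp add: scal_simps mult.assoc)
    finally show "y \<in> range (\<lambda>x. x * ?\<rho>)" by blast
  qed
  ultimately show ?thesis using that \<rho>(1) by metis
qed

text \<open>Right multiplication by the generator of norm \<open>m\<close> is a bijection from the
  elements of norm \<alpha>.\<close>

lemma card_reps_ann:
  assumes v: "fst v = 1 \<or> v = (0, 1)"
  shows "card (reps (m * \<alpha>) \<inter> ann v) = rO \<alpha>"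
proof -
  obtain \<rho> where \<rho>: "ann v = range (\<lambda>x. x * \<rho>)" "nn \<rho> = m" using ann_generator[OF v] by blast
  have \<rho>0: "\<rho> \<noteq> 0" using \<rho>(2) m_nonzero by auto
  have "(\<lambda>x. x * \<rho>) ` reps \<alpha> = reps (m * \<alpha>) \<inter> ann v"
    unfolding \<rho>(1) using m_nonzero by (auto simp: reps_def \<rho>(2) mult.commute)
  moreover have "inj_on (\<lambda>x. x * \<rho>) (reps \<alpha>)"
    by (intro inj_onI) (simp add: oct_mult_right_cancel[OF \<rho>0])
  ultimately show ?thesis unfolding rO_def by (metis card_image)
qed

text \<open>Over the residue field a nonzero singular 2 x 2 matrix has rank one, so its kernel is a
  single line. The line is (0, 1) if the second column vanishes; otherwise its slope comes from
  inverting a nonzero entry of that column.\<close>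

lemma lines_containing:
  assumes R: "residue_system m R" and x: "m dvd nn x"
    and nz: "\<not> (m dvd f11 x \<and> m dvd f12 x \<and> m dvd f21 x \<and> m dvd f22 x)"
  shows "\<exists>!v. v \<in> lines R \<and> x \<in> ann v"
proof -
  have pd: "m dvd a \<or> m dvd b" if "m dvd a * b" for a b
    using prime_elem_dvd_multD[OF prime that] .
  have "m dvd (f11 x * f22 x - f12 x * f21 x - nn x) + nn x" using det x by (rule dvd_add)
  hence d: "m dvd f11 x * f22 x - f12 x * f21 x" by simp
  have row: "\<exists>s. s \<in> R \<and> m dvd f11 x + f12 x * s \<and> m dvd f21 x + f22 x * s"
    if "\<not> (m dvd f12 x \<and> m dvd f22 x)"
  proof -
    have "\<exists>s. m dvd f11 x + f12 x * s \<and> m dvd f21 x + f22 x * s"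
    proof (cases "m dvd f12 x")
      case False
      then obtain y where y: "m dvd y * f12 x - 1" using prime_elem_inverse[OF prime] by blast
      have "f11 x + f12 x * (- y * f11 x) = - f11 x * (y * f12 x - 1)" by (simp add: algebra_simps)
      hence 1: "m dvd f11 x + f12 x * (- y * f11 x)" using y by simp
      have "f12 x * (f21 x + f22 x * (- y * f11 x)) = (f11 x + f12 x * (- y * f11 x)) * f22 x - (f11 x * f22 x - f12 x * f21 x)"
        by (simp add: algebra_simps)
      also have "m dvd \<dots>" using 1 d by simp
      finally have "m dvd f21 x + f22 x * (- y * f11 x)" using pd False by blast
      with 1 show ?thesis by blast
    next
      case True
      hence F: "\<not> m dvd f22 x" using that by simp
      then obtain y where y: "m dvd y * f22 x - 1" using prime_elem_inverse[OF prime] by blast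
      have "m dvd (f11 x * f22 x - f12 x * f21 x) + f12 x * f21 x" using d True by (intro dvd_add) simp_all
      hence "m dvd f11 x" using pd F by fastforce
      hence 1: "m dvd f11 x + f12 x * (- y * f21 x)" using True by simp
      have "f21 x + f22 x * (- y * f21 x) = - f21 x * (y * f22 x - 1)" by (simp add: algebra_simps)
      hence "m dvd f21 x + f22 x * (- y * f21 x)" using y by simp
      with 1 show ?thesis by blast
    qed
    then obtain s where s: "m dvd f11 x + f12 x * s" "m dvd f21 x + f22 x * s" by blast
    obtain r where r: "r \<in> R" "m dvd s - r" using R unfolding residue_system_def by blast
    have "f11 x + f12 x * r = (f11 x + f12 x * s) - f12 x * (s - r)" "f21 x + f22 x * r = (f21 x + f22 x * s) - f22 x * (s - r)"
      by (simp_all add: algebra_simps)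
    moreover have "m dvd (f11 x + f12 x * s) - f12 x * (s - r)" "m dvd (f21 x + f22 x * s) - f22 x * (s - r)"
      using s r by (auto intro!: dvd_diff)
    ultimately have "m dvd f11 x + f12 x * r" "m dvd f21 x + f22 x * r" by (simp_all only:)
    with r(1) show ?thesis by blast
  qed
  have inf: False if "x \<in> ann (0, 1)" "x \<in> ann (1, s)" for s
  proof -
    have a: "m dvd f12 x" "m dvd f22 x" using that(1) by (simp_all add: ann_def)
    have "m dvd (f11 x + f12 x * s) - f12 x * s" "m dvd (f21 x + f22 x * s) - f22 x * s"
      using that(2) a by (simp_all only: ann_def mem_Collect_eq fst_conv snd_conv mult_1_right dvd_diff dvd_mult2)
    thus False using nz a by simp
  qed
  have fin: "s = t" if "x \<in> ann (1, s)" "x \<in> ann (1, t)" "s \<in> R" "t \<in> R" for s t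
  proof (rule ccontr)
    assume "s \<noteq> t"
    hence ns: "\<not> m dvd s - t" using R that(3,4) unfolding residue_system_def by (metis diff_self dvd_0_right)
    have "f12 x * (s - t) = (f11 x + f12 x * s) - (f11 x + f12 x * t)" "f22 x * (s - t) = (f21 x + f22 x * s) - (f21 x + f22 x * t)"
      by (simp_all add: algebra_simps)
    hence "m dvd f12 x * (s - t)" "m dvd f22 x * (s - t)" using that(1,2) by (simp_all only: ann_def mem_Collect_eq fst_conv snd_conv mult_1_right dvd_diff)
    hence "x \<in> ann (0, 1)" using pd ns by (auto simp: ann_def)
    with inf that(1) show False by blast
  qed
  show ?thesis
  proof (cases "m dvd f12 x \<and> m dvd f22 x")
    case True
    hence "x \<in> ann (0, 1)" by (simp add: ann_def)
    thus ?thesis using inf by (intro ex1I[of _ "(0, 1)"]) (auto simp: lines_def)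
  next
    case False
    then obtain s where s: "s \<in> R" "x \<in> ann (1, s)" using row by (auto simp: ann_def)
    thus ?thesis using inf fin by (intro ex1I[of _ "(1, s)"]) (auto simp: lines_def)
  qed
qed

text \<open>
  Double counting of the pairs of a line modulo m and an element annihilating it: the elements
  annihilating a fixed line form a principal left ideal, and an element of norm divisible by m
  annihilates exactly one line unless it is a multiple of m.
\<close>

lemma hecke_count:
  assumes R: "residue_system m R"
  shows "rO (m * \<alpha>) + card R * card {x \<in> reps (m * \<alpha>). \<exists>y. x = scal m * y} = (card R + 1) * rO \<alpha>"
proof -
  have finR: "finite R" using R by (simp add: residue_system_def)
  let ?X = "reps (m * \<alpha>)"
  define N where "N = {x \<in> ?X. \<exists>y. x = scal m * y}"
  have line: "fst v = 1 \<or> v = (0, 1)" if "v \<in> lines R" for v using that by (auto simp: lines_def)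
  have cnt: "card {v \<in> lines R. x \<in> ann v} = (if x \<in> N then card R + 1 else 1)" if "x \<in> ?X" for x
  proof (cases "x \<in> N")
    case True
    then obtain y where "x = scal m * y" by (auto simp: N_def)
    hence "{v \<in> lines R. x \<in> ann v} = lines R" using scal_m_mem_ann by auto
    thus ?thesis using True card_lines[OF finR] by simp
  next
    case False
    hence nz: "\<not> (m dvd f11 x \<and> m dvd f12 x \<and> m dvd f21 x \<and> m dvd f22 x)"
      using kernel[of x] that by (auto simp: N_def)
    have "m dvd nn x" using that by (simp add: reps_def)
    from lines_containing[OF R this nz] obtain v where "{v \<in> lines R. x \<in> ann v} = {v}" by blast
    thus ?thesis using False by simp
  qed
  have "(card R + 1) * rO \<alpha> = (\<Sum>v\<in>lines R. card {x \<in> ?X. x \<in> ann v})"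
    using card_reps_ann[OF line] by (simp add: card_lines[OF finR] Int_def)
  also have "\<dots> = (\<Sum>v\<in>lines R. \<Sum>x\<in>?X. if x \<in> ann v then 1 else 0)"
    by (simp add: sum.If_cases Int_def)
  also have "\<dots> = (\<Sum>x\<in>?X. \<Sum>v\<in>lines R. if x \<in> ann v then 1 else 0)" by (rule sum.swap)
  also have "\<dots> = (\<Sum>x\<in>?X. card {v \<in> lines R. x \<in> ann v})"
    using finite_lines[OF finR] by (simp add: sum.If_cases Int_def)
  also have "\<dots> = (\<Sum>x\<in>?X. 1 + (if x \<in> N then card R else 0))" by (intro sum.cong) (auto simp: cnt)
  also have "\<dots> = rO (m * \<alpha>) + card R * card N"
    by (subst sum.distrib) (simp add: rO_def sum.If_cases N_def Int_def conj_commute cong: conj_cong)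
  finally show ?thesis unfolding N_def by simp
qed

lemma hecke_recursion:
  assumes R: "residue_system m R"
  shows "rO (m * (m * \<alpha>)) + card R * rO \<alpha> = (card R + 1) * rO (m * \<alpha>)"
    and "\<not> m dvd \<alpha> \<Longrightarrow> rO (m * \<alpha>) = (card R + 1) * rO \<alpha>"
proof -
  have "{x \<in> reps (m * (m * \<alpha>)). \<exists>y. x = scal m * y} = (\<lambda>y. scal m * y) ` reps \<alpha>"
    using m_nonzero by (auto simp: reps_def mult.assoc)
  moreover have "inj_on (\<lambda>y. scal m * y) (reps \<alpha>)"
    using m_nonzero by (intro inj_onI) (simp add: scal_cancel)
  ultimately have "card {x \<in> reps (m * (m * \<alpha>)). \<exists>y. x = scal m * y} = rO \<alpha>"
    by (simp add: card_image rO_def)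
  thus "rO (m * (m * \<alpha>)) + card R * rO \<alpha> = (card R + 1) * rO (m * \<alpha>)"
    using hecke_count[OF R, of "m * \<alpha>"] by simp
  assume nd: "\<not> m dvd \<alpha>"
  have "{x \<in> reps (m * \<alpha>). \<exists>y. x = scal m * y} = {}"
    using m_nonzero nd by (auto simp: reps_def mult.assoc)
  thus "rO (m * \<alpha>) = (card R + 1) * rO \<alpha>" using hecke_count[OF R, of \<alpha>] by (metis add.right_neutral card.empty mult_0_right)
qed

end


section \<open>Splitting the maximal order at primes\<close>

text \<open>
  An isomorphism of the maximal order modulo $2\sqrt 2$ with a matrix ring, chosen such that
  the lattice $\mathcal G$ is cut out by the vanishing of the lower left entry.
\<close>

definition h11 :: "oct \<Rightarrow> zs2" where "h11 x = c0 x - c2 x + c3 x"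
definition h12 :: "oct \<Rightarrow> zs2" where "h12 x = - c1 x + (2 + r2) * c2 x + (r2 - 1) * c3 x"
definition h21 :: "oct \<Rightarrow> zs2" where "h21 x = c1 x - c2 x + (r2 - 1) * c3 x"
definition h22 :: "oct \<Rightarrow> zs2" where "h22 x = c0 x + r2 * c1 x + (1 + r2) * c2 x"

lemmas h_defs = h11_def h12_def h21_def h22_def

lemma h_mult:
  "2 * r2 dvd h11 (x * y) - (h11 x * h11 y + h12 x * h21 y)"
  "2 * r2 dvd h12 (x * y) - (h11 x * h12 y + h12 x * h22 y)"
  "2 * r2 dvd h21 (x * y) - (h21 x * h11 y + h22 x * h21 y)"
  "2 * r2 dvd h22 (x * y) - (h21 x * h12 y + h22 x * h22 y)"
proof -
  have "h11 (x * y) - (h11 x * h11 y + h12 x * h21 y) = 2 * r2 * (c1 x * c3 y - (1 + r2) * c2 x * c1 y - c2 x * c3 y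
      - c3 x * c1 y + c3 x * c2 y + (1 - r2) * c3 x * c3 y)"
    by (simp add: h_defs times_oct_def algebra_simps r2_mult_r2)
  thus "2 * r2 dvd h11 (x * y) - (h11 x * h11 y + h12 x * h21 y)" by (rule dvdI)
  have "h12 (x * y) - (h11 x * h12 y + h12 x * h22 y) = 2 * r2 * (c1 x * c2 y - c1 x * c3 y - c2 x * c1 y + c2 x * c3 y
      + c3 x * c1 y - c3 x * c2 y)"
    by (simp add: h_defs times_oct_def algebra_simps r2_mult_r2)
  thus "2 * r2 dvd h12 (x * y) - (h11 x * h12 y + h12 x * h22 y)" by (rule dvdI)
  have "h21 (x * y) - (h21 x * h11 y + h22 x * h21 y) = 2 * r2 * (c1 x * c2 y - c2 x * c1 y)"
    by (simp add: h_defs times_oct_def algebra_simps r2_mult_r2)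
  thus "2 * r2 dvd h21 (x * y) - (h21 x * h11 y + h22 x * h21 y)" by (rule dvdI)
  have "h22 (x * y) - (h21 x * h12 y + h22 x * h22 y) = 2 * r2 * (- (1 + r2) * c1 x * c2 y - c1 x * c3 y + c2 x * c3 y
      + c3 x * c1 y - c3 x * c2 y + (1 - r2) * c3 x * c3 y)"
    by (simp add: h_defs times_oct_def algebra_simps r2_mult_r2)
  thus "2 * r2 dvd h22 (x * y) - (h21 x * h12 y + h22 x * h22 y)" by (rule dvdI)
qed

lemma h_det: "2 * r2 dvd h11 x * h22 x - h12 x * h21 x - nn x"
proof -
  have "h11 x * h22 x - h12 x * h21 x - nn x = 2 * r2 * (- (1 + r2) * c1 x * c2 x + (1 - r2) * c3 x * c3 x)"
    by (simp add: h_defs nn_def algebra_simps r2_mult_r2)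
  thus ?thesis by (rule dvdI)
qed

lemma exists_scal_mult:
  assumes "m dvd c0 x" "m dvd c1 x" "m dvd c2 x" "m dvd c3 x"
  shows "\<exists>y. x = scal m * y"
proof -
  from assms obtain a b c d where "c0 x = m * a" "c1 x = m * b" "c2 x = m * c" "c3 x = m * d" by (auto elim!: dvdE)
  hence "x = scal m * Oct a b c d" by (simp add: oct_eq_iff)
  thus ?thesis by blast
qed

lemma prime_elem_r2: "prime_elem r2"
proof (rule irreducible_imp_prime_zs2, rule irreducibleI)
  fix a b assume "r2 = a * b"
  hence "fnorm a * fnorm b = - 2" by (metis fnorm_mult fnorm_simps(6))
  hence "\<bar>fnorm a\<bar> * \<bar>fnorm b\<bar> = 2" by (simp add: abs_mult[symmetric])
  hence "nat \<bar>fnorm a\<bar> * nat \<bar>fnorm b\<bar> = 2" by (simp add: nat_mult_distrib[symmetric])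
  hence "nat \<bar>fnorm a\<bar> = 1 \<or> nat \<bar>fnorm b\<bar> = 1" using two_is_prime_nat
    by (metis prime_product)
  thus "a dvd 1 \<or> b dvd 1" by (auto simp: unit_iff_fnorm)
qed (simp_all add: unit_iff_fnorm)

lemma prime_dvd_r2_iff:
  assumes "prime_elem \<pi>"
  shows "\<pi> dvd r2 \<longleftrightarrow> r2 dvd \<pi>"
proof -
  have *: "q dvd p" if p: "prime_elem p" and q: "prime_elem q" and pq: "p dvd q" for p q :: zs2
  proof -
    obtain u where u: "q = p * u" using pq by (elim dvdE)
    have "\<not> p dvd 1" using p by (auto simp: prime_elem_def)
    hence "u dvd 1" using irreducibleD[OF prime_elem_imp_irreducible_zs2[OF q] u] by blast
    then obtain v where "1 = u * v" by (elim dvdE)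
    hence "p = q * v" by (simp add: u mult.assoc)
    thus ?thesis by (rule dvdI)
  qed
  show ?thesis using *[of \<pi> r2] *[of r2 \<pi>] assms prime_elem_r2 by blast
qed

text \<open>Here \<open>m\<close> is associated to sqrt 2, so the congruences modulo 2 sqrt 2 may be
  weakened to \<open>m\<close>. The kernel condition holds because the four forms are linearly
  independent modulo sqrt 2, where divisibility is parity of the rational part.\<close>

lemma splitting_ramified:
  assumes m: "prime_elem m" "m dvd r2"
  shows "splitting m h11 h12 h21 h22"
proof -
  have "r2 dvd m" using m prime_dvd_r2_iff by blast
  hence iff: "m dvd x \<longleftrightarrow> r2 dvd x" for x using m(2) dvd_trans by blast
  have conv: "m dvd x" if "2 * r2 dvd x" for x
    using that m(2) by (meson dvd_mult dvd_trans)
  show ?thesis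
  proof
    fix x
    assume "m dvd h11 x" "m dvd h12 x" "m dvd h21 x" "m dvd h22 x"
    hence "even (rpart (h11 x))" "even (rpart (h12 x))" "even (rpart (h21 x))" "even (rpart (h22 x))"
      by (simp_all only: iff r2_dvd_iff)
    hence "even (rpart (c0 x) - rpart (c2 x) + rpart (c3 x))"
      "even (- rpart (c1 x) + 2 * rpart (c2 x) + 2 * spart (c2 x) + 2 * spart (c3 x) - rpart (c3 x))"
      "even (rpart (c1 x) - rpart (c2 x) + 2 * spart (c3 x) - rpart (c3 x))"
      "even (rpart (c0 x) + 2 * spart (c1 x) + rpart (c2 x) + 2 * spart (c2 x))"
      by (simp_all add: h_defs zs2_sel_mult algebra_simps)
    hence "even (rpart (c0 x)) \<and> even (rpart (c1 x)) \<and> even (rpart (c2 x)) \<and> even (rpart (c3 x))"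
      by presburger
    thus "\<exists>y. x = scal m * y" by (intro exists_scal_mult) (simp_all add: iff r2_dvd_iff)
  next
    show "\<exists>x. m dvd h11 x - 1 \<and> m dvd h12 x \<and> m dvd h21 x \<and> m dvd h22 x"
      \<comment> \<open>This element and the next one reduce modulo sqrt 2 to the matrix units at
        positions 1,1 and 1,2.\<close>
      by (rule exI[of _ "Oct 0 1 0 1"]) (simp add: h_defs iff r2_dvd_iff zs2_sel_mult)
    show "\<exists>x. m dvd h11 x \<and> m dvd h12 x - 1 \<and> m dvd h21 x \<and> m dvd h22 x"
      by (rule exI[of _ "Oct 1 1 1 0"]) (simp add: h_defs iff r2_dvd_iff zs2_sel_mult)
  qed (rule conv[OF h_mult(1)] conv[OF h_mult(2)] conv[OF h_mult(3)] conv[OF h_mult(4)] conv[OF h_det]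
      | simp add: h_defs algebra_simps)+
qed

section \<open>Matrices modulo the odd primes\<close>

lemma exists_two_squares_plus_one:
  assumes p: "prime p" "odd (p :: int)"
  shows "\<exists>a b. p dvd a\<^sup>2 + b\<^sup>2 + 1"
proof -
  obtain k where k: "p = 2 * k + 1" using p(2) by (elim oddE)
  have k0: "k > 0" using prime_gt_1_int[OF p(1)] k by simp
  define D where "D = {0..k}"
  have eq: "x = y" if "x \<in> D" "y \<in> D" "p dvd x\<^sup>2 - y\<^sup>2" for x y
  proof -
    have "p dvd (x + y) * (x - y)" using that(3) by (simp add: power2_eq_square algebra_simps)
    hence "p dvd x + y \<or> p dvd x - y" using p(1) prime_dvd_mult_iff by blast
    moreover have "\<bar>x + y\<bar> < p" "\<bar>x - y\<bar> < p" using that(1,2) by (auto simp: D_def k)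
    moreover have "z = 0" if "p dvd z" "\<bar>z\<bar> < p" for z
    proof (rule ccontr)
      assume "z \<noteq> 0"
      from dvd_imp_le_int[OF this that(1)] that(2) show False by linarith
    qed
    ultimately have "x + y = 0 \<or> x - y = 0" by blast
    thus ?thesis using that(1,2) by (auto simp: D_def)
  qed
  \<comment> \<open>Pigeonhole: x^2 and -1 - y^2 each take k + 1 residues for arguments from 0 to k,
    and there are only 2k + 1 residues.\<close>
  define A B where "A = (\<lambda>x. x\<^sup>2 mod p) ` D" and "B = (\<lambda>y. (- 1 - y\<^sup>2) mod p) ` D"
  have "inj_on (\<lambda>x. x\<^sup>2 mod p) D"
    by (intro inj_onI eq) (simp_all add: mod_eq_dvd_iff)
  hence cA: "card A = nat (k + 1)" by (simp add: A_def card_image D_def)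
  have "inj_on (\<lambda>y. (- 1 - y\<^sup>2) mod p) D"
  proof (intro inj_onI)
    fix x y assume xy: "x \<in> D" "y \<in> D" "(- 1 - x\<^sup>2) mod p = (- 1 - y\<^sup>2) mod p"
    hence "p dvd (- 1 - x\<^sup>2) - (- 1 - y\<^sup>2)" by (simp only: mod_eq_dvd_iff)
    hence "p dvd y\<^sup>2 - x\<^sup>2" by simp
    thus "x = y" using eq[OF xy(2,1)] by simp
  qed
  hence cB: "card B = nat (k + 1)" by (simp add: B_def card_image D_def)
  have "A \<union> B \<subseteq> {0..<p}" using prime_gt_0_int[OF p(1)] by (auto simp: A_def B_def)
  hence "card (A \<union> B) \<le> card {0..<p}" by (intro card_mono) auto
  hence "card (A \<union> B) < card A + card B" using k k0 cA cB by simp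
  moreover have "finite A" "finite B" by (simp_all add: A_def B_def D_def)
  ultimately have "A \<inter> B \<noteq> {}" by (metis card_Un_disjoint less_irrefl)
  then obtain x y where "x\<^sup>2 mod p = (- 1 - y\<^sup>2) mod p" by (auto simp: A_def B_def)
  hence "p dvd x\<^sup>2 - (- 1 - y\<^sup>2)" by (simp only: mod_eq_dvd_iff)
  hence "p dvd x\<^sup>2 + y\<^sup>2 + 1" by (simp add: algebra_simps)
  thus ?thesis by blast
qed

lemma prime_above:
  assumes m: "prime_elem (m :: zs2)" and "n > 0" "m dvd of_int (int n)"
  shows "\<exists>p. prime (p :: nat) \<and> m dvd of_int (int p)"
  using assms(2,3)
proof (induction n rule: less_induct)
  case (less n)
  show ?case
  proof (cases "n = 1")
    case True
    thus ?thesis using less.prems m by (auto simp: prime_elem_def)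
  next
    case False
    then obtain p where p: "prime p" "p dvd n" using prime_factor_nat by blast
    then obtain k where k: "n = p * k" by (elim dvdE)
    have "k < n" "k > 0" using k less.prems(1) prime_gt_1_nat[OF p(1)] by auto
    have "m dvd of_int (int p) * of_int (int k)" using less.prems(2) k by simp
    hence "m dvd of_int (int p) \<or> m dvd of_int (int k)" using prime_elem_dvd_multD[OF m] by blast
    thus ?thesis using less.IH[OF \<open>k < n\<close> \<open>k > 0\<close>] p(1) by blast
  qed
qed

text \<open>The congruences are solved in the rational integers modulo the odd prime below
  \<open>m\<close>, where the pigeonhole argument is available.\<close>

lemma prime_elem_odd_parameters:
  assumes m: "prime_elem (m :: zs2)" "\<not> m dvd r2"
  obtains a b h :: zs2 where "m dvd a * a + b * b + 1" "m dvd 2 * h - 1"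
proof -
  have "m \<noteq> 0" using m(1) by (auto simp: prime_elem_def)
  hence "nat \<bar>fnorm m\<bar> > 0" by simp
  moreover have "m dvd of_int (int (nat \<bar>fnorm m\<bar>))"
    using dvd_fnorm[of m] by (auto simp: abs_if)
  ultimately obtain p where p: "prime (p :: nat)" "m dvd of_int (int p)"
    using prime_above[OF m(1)] by blast
  have "p \<noteq> 2"
  proof
    assume "p = 2"
    hence "m dvd r2 * r2" using p(2) by (simp add: r2_mult_r2)
    thus False using prime_elem_dvd_multD[OF m(1)] m(2) by blast
  qed
  hence odd: "odd (int p)" using p(1) primes_dvd_imp_eq two_is_prime_nat by (metis even_of_nat)
  have "prime (int p)" using p(1) by simp
  from exists_two_squares_plus_one[OF this odd] obtain a b where ab: "int p dvd a\<^sup>2 + b\<^sup>2 + 1" by blast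
  obtain k where k: "int p = 2 * k + 1" using odd by (elim oddE)
  have "of_int (int p) dvd (of_int (a\<^sup>2 + b\<^sup>2 + 1) :: zs2)" using ab by (simp only: of_int_dvd_zs2 zs2_sel_num dvd_0_right simp_thms)
  hence "m dvd of_int (a\<^sup>2 + b\<^sup>2 + 1)" using p(2) dvd_trans by blast
  moreover have "of_int (a\<^sup>2 + b\<^sup>2 + 1) = (of_int a * of_int a + of_int b * of_int b + 1 :: zs2)"
    by (simp add: power2_eq_square)
  \<comment> \<open>With p = 2k + 1, the integer k + 1 inverts 2 modulo p.\<close>
  moreover have "of_int (int p) = (2 * of_int (k + 1) - 1 :: zs2)" unfolding k by simp
  ultimately show ?thesis using p(2) that by metis
qed

lemma two_w_mult:
  "2 * w0 (x * y) = w0 x * w0 y - w1 x * w1 y - w2 x * w2 y - w3 x * w3 y"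
  "2 * w1 (x * y) = w0 x * w1 y + w1 x * w0 y + w2 x * w3 y - w3 x * w2 y"
  "2 * w2 (x * y) = w0 x * w2 y - w1 x * w3 y + w2 x * w0 y + w3 x * w1 y"
  "2 * w3 (x * y) = w0 x * w3 y + w1 x * w2 y - w2 x * w1 y + w3 x * w0 y"
  by (simp_all add: w_defs times_oct_def algebra_simps r2_mult_r2)

text \<open>The quaternion t + x i + y j + z k in basis coordinates.\<close>

definition lipschitz :: "zs2 \<Rightarrow> zs2 \<Rightarrow> zs2 \<Rightarrow> zs2 \<Rightarrow> oct" where
  "lipschitz t x y z = Oct (t - x - y + z) (r2 * (x - z)) (r2 * (y - z)) (2 * z)"

lemma w_lipschitz [simp]:
  "w0 (lipschitz t x y z) = 2 * t" "w1 (lipschitz t x y z) = 2 * x"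
  "w2 (lipschitz t x y z) = 2 * y" "w3 (lipschitz t x y z) = 2 * z"
  by (simp_all add: lipschitz_def w_defs algebra_simps r2_mult_r2)

text \<open>
  The matrices are induced by $\mathbf i \mapsto (a, b; b, -a)$ and
  $\mathbf j \mapsto (0, 1; -1, 0)$, where $a^2 + b^2 = -1$; h is an inverse of $2$.
\<close>

lemma splitting_odd:
  assumes m: "prime_elem m" "\<not> m dvd r2" and N: "m dvd a * a + b * b + 1" and h: "m dvd 2 * h - 1"
  shows "splitting m (\<lambda>x. h * (w0 x + a * w1 x - b * w3 x)) (\<lambda>x. h * (b * w1 x + w2 x + a * w3 x))
    (\<lambda>x. h * (b * w1 x - w2 x + a * w3 x)) (\<lambda>x. h * (w0 x - a * w1 x + b * w3 x))"
proof -
  have m1: "\<not> m dvd 1" using m(1) by (auto simp: prime_elem_def)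
  have pd: "m dvd x" if "m dvd s * x" "\<not> m dvd s" for s x
    using prime_elem_dvd_multD[OF m(1) that(1)] that(2) by blast
  have n2: "\<not> m dvd 2" using pd[of r2 r2] m(2) by (auto simp: r2_mult_r2)
  have n2h: "\<not> m dvd 2 * h"
  proof
    assume "m dvd 2 * h"
    hence "m dvd 2 * h - (2 * h - 1)" using h by (rule dvd_diff)
    thus False using m1 by simp
  qed
  \<comment> \<open>Reduces the four product congruences to polynomial identities. \<open>E\<close>
    comes from the quaternion product and \<open>F\<close> from the matrix product; they differ by a
    multiple of a^2 + b^2 + 1, and the remaining discrepancy between h/2 and h^2 is a multiple of 2h
    - 1, after doubling to clear the denominator.\<close>
  have half: "m dvd f - g"
    if "2 * f = h * E" "g = h * h * F" "F - E = (a * a + b * b + 1) * K" for f g E F K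
  proof (rule pd[OF _ n2])
    have "F = E + (a * a + b * b + 1) * K" using that(3) by (simp add: algebra_simps)
    hence "2 * (f - g) = (2 * h - 1) * (- (h * E)) - (a * a + b * b + 1) * (2 * h * h * K)"
      using that(1,2) by (simp add: algebra_simps)
    moreover have "m dvd \<dots>" by (rule dvd_diff[OF dvd_mult2[OF h] dvd_mult2[OF N]])
    ultimately show "m dvd 2 * (f - g)" by (simp only:)
  qed
  show ?thesis
  proof
    fix x y
    show "m dvd h * (w0 (x * y) + a * w1 (x * y) - b * w3 (x * y)) - (h * (w0 x + a * w1 x - b * w3 x) * (h * (w0 y + a * w1 y - b * w3 y)) +
        h * (b * w1 x + w2 x + a * w3 x) * (h * (b * w1 y - w2 y + a * w3 y)))"
      by (rule half[where E = "2 * w0 (x * y) + a * (2 * w1 (x * y)) - b * (2 * w3 (x * y))"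
          and F = "(w0 x + a * w1 x - b * w3 x) * (w0 y + a * w1 y - b * w3 y) + (b * w1 x + w2 x + a * w3 x) * (b * w1 y - w2 y + a * w3 y)"
          and K = "w1 x * w1 y + w3 x * w3 y"], simp add: algebra_simps, simp add: algebra_simps, unfold two_w_mult, simp add: algebra_simps)
    show "m dvd h * (b * w1 (x * y) + w2 (x * y) + a * w3 (x * y)) - (h * (w0 x + a * w1 x - b * w3 x) * (h * (b * w1 y + w2 y + a * w3 y)) +
        h * (b * w1 x + w2 x + a * w3 x) * (h * (w0 y - a * w1 y + b * w3 y)))"
      by (rule half[where E = "b * (2 * w1 (x * y)) + 2 * w2 (x * y) + a * (2 * w3 (x * y))"
          and F = "(w0 x + a * w1 x - b * w3 x) * (b * w1 y + w2 y + a * w3 y) + (b * w1 x + w2 x + a * w3 x) * (w0 y - a * w1 y + b * w3 y)"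
          and K = "w1 x * w3 y - w3 x * w1 y"], simp add: algebra_simps, simp add: algebra_simps, unfold two_w_mult, simp add: algebra_simps)
    show "m dvd h * (b * w1 (x * y) - w2 (x * y) + a * w3 (x * y)) - (h * (b * w1 x - w2 x + a * w3 x) * (h * (w0 y + a * w1 y - b * w3 y)) +
        h * (w0 x - a * w1 x + b * w3 x) * (h * (b * w1 y - w2 y + a * w3 y)))"
      by (rule half[where E = "b * (2 * w1 (x * y)) - 2 * w2 (x * y) + a * (2 * w3 (x * y))"
          and F = "(b * w1 x - w2 x + a * w3 x) * (w0 y + a * w1 y - b * w3 y) + (w0 x - a * w1 x + b * w3 x) * (b * w1 y - w2 y + a * w3 y)"
          and K = "w3 x * w1 y - w1 x * w3 y"], simp add: algebra_simps, simp add: algebra_simps, unfold two_w_mult, simp add: algebra_simps)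
    show "m dvd h * (w0 (x * y) - a * w1 (x * y) + b * w3 (x * y)) - (h * (b * w1 x - w2 x + a * w3 x) * (h * (b * w1 y + w2 y + a * w3 y)) +
        h * (w0 x - a * w1 x + b * w3 x) * (h * (w0 y - a * w1 y + b * w3 y)))"
      by (rule half[where E = "2 * w0 (x * y) - a * (2 * w1 (x * y)) + b * (2 * w3 (x * y))"
          and F = "(b * w1 x - w2 x + a * w3 x) * (b * w1 y + w2 y + a * w3 y) + (w0 x - a * w1 x + b * w3 x) * (w0 y - a * w1 y + b * w3 y)"
          and K = "w1 x * w1 y + w3 x * w3 y"], simp add: algebra_simps, simp add: algebra_simps, unfold two_w_mult, simp add: algebra_simps)
  next
    fix x
    have "h * (w0 x + a * w1 x - b * w3 x) * (h * (w0 x - a * w1 x + b * w3 x)) -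
        h * (b * w1 x + w2 x + a * w3 x) * (h * (b * w1 x - w2 x + a * w3 x)) - nn x
      = h * h * (w0 x * w0 x + w1 x * w1 x + w2 x * w2 x + w3 x * w3 x) - nn x - (a * a + b * b + 1) * (h * h * (w1 x * w1 x + w3 x * w3 x))"
      by (simp add: algebra_simps)
    also have "\<dots> = (2 * h - 1) * ((2 * h + 1) * nn x) - (a * a + b * b + 1) * (h * h * (w1 x * w1 x + w3 x * w3 x))"
      unfolding four_nn[symmetric] by (simp add: algebra_simps)
    also have "m dvd \<dots>" by (rule dvd_diff[OF dvd_mult2[OF h] dvd_mult2[OF N]])
    finally show "m dvd h * (w0 x + a * w1 x - b * w3 x) * (h * (w0 x - a * w1 x + b * w3 x)) -
        h * (b * w1 x + w2 x + a * w3 x) * (h * (b * w1 x - w2 x + a * w3 x)) - nn x" .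
  next
    fix x
    assume f: "m dvd h * (w0 x + a * w1 x - b * w3 x)" "m dvd h * (b * w1 x + w2 x + a * w3 x)"
      "m dvd h * (b * w1 x - w2 x + a * w3 x)" "m dvd h * (w0 x - a * w1 x + b * w3 x)"
    have "h * (w0 x + a * w1 x - b * w3 x) + h * (w0 x - a * w1 x + b * w3 x) = 2 * h * w0 x"
      "h * (w0 x + a * w1 x - b * w3 x) - h * (w0 x - a * w1 x + b * w3 x) = 2 * h * (a * w1 x - b * w3 x)"
      "h * (b * w1 x + w2 x + a * w3 x) - h * (b * w1 x - w2 x + a * w3 x) = 2 * h * w2 x"
      "h * (b * w1 x + w2 x + a * w3 x) + h * (b * w1 x - w2 x + a * w3 x) = 2 * h * (b * w1 x + a * w3 x)"
      by (simp_all add: algebra_simps)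
    hence "m dvd 2 * h * w0 x" "m dvd 2 * h * (a * w1 x - b * w3 x)" "m dvd 2 * h * w2 x" "m dvd 2 * h * (b * w1 x + a * w3 x)"
      using f by (metis dvd_add dvd_diff)+
    hence w: "m dvd w0 x" "m dvd a * w1 x - b * w3 x" "m dvd w2 x" "m dvd b * w1 x + a * w3 x"
      using pd n2h by blast+
    \<comment> \<open>The pair (w1, w3) enters through the matrix (a, -b; b, a), whose determinant
      a^2 + b^2 is -1 modulo \<open>m\<close>; this and the next identity invert it.\<close>
    have "w1 x = (a * a + b * b + 1) * w1 x - a * (a * w1 x - b * w3 x) - b * (b * w1 x + a * w3 x)"
      by (simp add: algebra_simps)
    also have "m dvd \<dots>" by (rule dvd_diff[OF dvd_diff[OF dvd_mult2[OF N] dvd_mult[OF w(2)]] dvd_mult[OF w(4)]])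
    finally have w1: "m dvd w1 x" .
    have "w3 x = (a * a + b * b + 1) * w3 x + b * (a * w1 x - b * w3 x) - a * (b * w1 x + a * w3 x)"
      by (simp add: algebra_simps)
    also have "m dvd \<dots>" by (rule dvd_diff[OF dvd_add[OF dvd_mult2[OF N] dvd_mult[OF w(2)]] dvd_mult[OF w(4)]])
    finally have c3: "m dvd c3 x" by (simp add: w3_def)
    have "r2 * c1 x = w1 x - c3 x" "r2 * c2 x = w2 x - c3 x" by (simp_all add: w_defs)
    hence "m dvd r2 * c1 x" "m dvd r2 * c2 x" using w(3) w1 c3 by simp_all
    hence c12: "m dvd c1 x" "m dvd c2 x" using pd m(2) by blast+
    have "2 * c0 x = w0 x - r2 * c1 x - r2 * c2 x - c3 x" by (simp add: w_defs algebra_simps)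
    also have "m dvd \<dots>" using w(1) c12 c3 by simp
    finally have "m dvd c0 x" using pd n2 by blast
    thus "\<exists>y. x = scal m * y" using c12 c3 by (rule exists_scal_mult)
  next
    let ?N = "a * a + b * b + 1"
    \<comment> \<open>This is h (1 - a i + b k), which the chosen matrices for i and k send to the
      matrix unit at position 1,1.\<close>
    let ?x = "lipschitz h (- (h * a)) 0 (h * b)"
    have "h * (w0 ?x + a * w1 ?x - b * w3 ?x) - 1 = (2 * h - 1) * (2 * h + 1) - ?N * (2 * h * h)"
      "h * (b * w1 ?x + w2 ?x + a * w3 ?x) = 0" "h * (b * w1 ?x - w2 ?x + a * w3 ?x) = 0"
      "h * (w0 ?x - a * w1 ?x + b * w3 ?x) = ?N * (2 * h * h)"
      by (simp_all add: algebra_simps)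
    moreover have "m dvd (2 * h - 1) * (2 * h + 1) - ?N * (2 * h * h)" "m dvd ?N * (2 * h * h)"
      by (rule dvd_diff[OF dvd_mult2[OF h] dvd_mult2[OF N]] dvd_mult2[OF N])+
    ultimately show "\<exists>x. m dvd h * (w0 x + a * w1 x - b * w3 x) - 1 \<and> m dvd h * (b * w1 x + w2 x + a * w3 x)
        \<and> m dvd h * (b * w1 x - w2 x + a * w3 x) \<and> m dvd h * (w0 x - a * w1 x + b * w3 x)"
      by (intro exI[of _ ?x]) (simp only: dvd_0_right simp_thms)
    \<comment> \<open>This is h (j - b i - a k), sent to the matrix unit at position 1,2.\<close>
    let ?y = "lipschitz 0 (- (h * b)) h (- (h * a))"
    have "h * (w0 ?y + a * w1 ?y - b * w3 ?y) = 0"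
      "h * (b * w1 ?y + w2 ?y + a * w3 ?y) - 1 = (2 * h - 1) * (2 * h + 1) - ?N * (2 * h * h)"
      "h * (b * w1 ?y - w2 ?y + a * w3 ?y) = ?N * (- (2 * h * h))"
      "h * (w0 ?y - a * w1 ?y + b * w3 ?y) = 0"
      by (simp_all add: algebra_simps)
    moreover have "m dvd (2 * h - 1) * (2 * h + 1) - ?N * (2 * h * h)" "m dvd ?N * (- (2 * h * h))"
      by (rule dvd_diff[OF dvd_mult2[OF h] dvd_mult2[OF N]] dvd_mult2[OF N])+
    ultimately show "\<exists>x. m dvd h * (w0 x + a * w1 x - b * w3 x) \<and> m dvd h * (b * w1 x + w2 x + a * w3 x) - 1
        \<and> m dvd h * (b * w1 x - w2 x + a * w3 x) \<and> m dvd h * (w0 x - a * w1 x + b * w3 x)"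
      by (intro exI[of _ ?y]) (simp only: dvd_0_right simp_thms)
  qed (simp_all add: w_defs algebra_simps)
qed

text \<open>The maximal order becomes a matrix ring modulo every totally positive prime, including
  those over sqrt 2, so the recursion has no exceptional prime.\<close>

lemma rO_recursion:
  assumes m: "prime_elem m" "totpos m" and R: "residue_system m R"
  shows "rO (m * (m * \<alpha>)) + card R * rO \<alpha> = (card R + 1) * rO (m * \<alpha>)"
    and "\<not> m dvd \<alpha> \<Longrightarrow> rO (m * \<alpha>) = (card R + 1) * rO \<alpha>"
proof -
  obtain f11 f12 f21 f22 where "splitting m f11 f12 f21 f22"
  proof (cases "m dvd r2")
    case True
    thus ?thesis using that splitting_ramified m(1) by blast
  next
    case False
    obtain a b h where "m dvd a * a + b * b + 1" "m dvd 2 * h - 1"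
      using prime_elem_odd_parameters[OF m(1) False] by blast
    thus ?thesis using that splitting_odd[OF m(1) False] by blast
  qed
  then interpret splitting m f11 f12 f21 f22 .
  interpret prime_splitting m f11 f12 f21 f22 by unfold_locales (rule m)+
  show "rO (m * (m * \<alpha>)) + card R * rO \<alpha> = (card R + 1) * rO (m * \<alpha>)"
    and "\<not> m dvd \<alpha> \<Longrightarrow> rO (m * \<alpha>) = (card R + 1) * rO \<alpha>"
    using hecke_recursion[OF R] by blast+
qed


section \<open>Sums over odd divisors\<close>

definition multiples :: "zs2 \<Rightarrow> zs2 set" where "multiples \<delta> = {x. \<delta> dvd x}"

text \<open>The number of cosets, phrased for a bare set so that it later matches the carrier of the
  quotient ring.\<close>

definition index :: "zs2 set \<Rightarrow> nat" where "index I = card (range (\<lambda>x. {y. y - x \<in> I}))"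

lemma zs2_dvd_diff_commute: "(\<delta> :: zs2) dvd x - y \<longleftrightarrow> \<delta> dvd y - x"
  by (metis dvd_minus_iff minus_diff_eq)

lemma dvd_diff_trans: "(\<delta> :: zs2) dvd x - y \<Longrightarrow> \<delta> dvd y - z \<Longrightarrow> \<delta> dvd x - z"
  using dvd_add[of \<delta> "x - y" "y - z"] by simp

lemma multiples_eq_iff: "multiples \<delta> = multiples \<epsilon> \<longleftrightarrow> \<delta> dvd \<epsilon> \<and> \<epsilon> dvd \<delta>"
proof
  assume eq: "multiples \<delta> = multiples \<epsilon>"
  have "\<delta> \<in> multiples \<delta>" "\<epsilon> \<in> multiples \<epsilon>" by (simp_all add: multiples_def)
  hence "\<delta> \<in> multiples \<epsilon>" "\<epsilon> \<in> multiples \<delta>" by (simp_all add: eq)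
  thus "\<delta> dvd \<epsilon> \<and> \<epsilon> dvd \<delta>" by (simp add: multiples_def)
next
  assume "\<delta> dvd \<epsilon> \<and> \<epsilon> dvd \<delta>"
  hence "\<delta> dvd x \<longleftrightarrow> \<epsilon> dvd x" for x using dvd_trans[of \<delta> \<epsilon> x] dvd_trans[of \<epsilon> \<delta> x] by blast
  thus "multiples \<delta> = multiples \<epsilon>" by (simp add: multiples_def)
qed

text \<open>Finiteness holds because \<delta> divides its own norm, a nonzero rational integer
  \<open>n\<close>, so both coordinates can be reduced modulo \<open>n\<close>.\<close>

lemma exists_residue_system:
  assumes "\<delta> \<noteq> 0"
  obtains R where "residue_system \<delta> R"
proof -
  define rep where "rep x = (SOME y. \<delta> dvd y - x)" for x
  have rep: "\<delta> dvd rep x - x" for x unfolding rep_def by (rule someI[of _ x]) simp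
  have rep_eq: "rep x = rep y" if "\<delta> dvd x - y" for x y
  proof -
    have "\<delta> dvd z - x \<longleftrightarrow> \<delta> dvd z - y" for z
      using dvd_diff_trans[of \<delta> z x y] dvd_diff_trans[of \<delta> z y x] that zs2_dvd_diff_commute[of \<delta> x y] by blast
    thus ?thesis unfolding rep_def by simp
  qed
  define n where "n = \<bar>fnorm \<delta>\<bar>"
  have n: "n > 0" using assms by (simp add: n_def)
  have dn: "\<delta> dvd of_int n" using dvd_fnorm[of \<delta>] by (auto simp: n_def abs_if)
  let ?B = "(\<lambda>(a, b). ZS a b) ` ({0..<n} \<times> {0..<n})"
  have "range rep \<subseteq> rep ` ?B"
  proof (rule image_subsetI)
    fix x
    let ?y = "ZS (rpart x mod n) (spart x mod n)"
    have "of_int n dvd x - ?y" unfolding of_int_dvd_zs2 by simp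
    hence "rep x = rep ?y" by (rule rep_eq[OF dvd_trans[OF dn]])
    moreover have "?y \<in> ?B" using n by auto
    ultimately show "rep x \<in> rep ` ?B" by blast
  qed
  hence "finite (range rep)" by (rule finite_subset) simp
  moreover have "\<exists>!r. r \<in> range rep \<and> \<delta> dvd x - r" for x
  proof (rule ex1I[of _ "rep x"])
    show "rep x \<in> range rep \<and> \<delta> dvd x - rep x" using rep[of x] zs2_dvd_diff_commute[of \<delta> x "rep x"] by blast
  next
    fix r assume r: "r \<in> range rep \<and> \<delta> dvd x - r"
    then obtain z where "r = rep z" by blast
    thus "r = rep x" using r rep[of z] dvd_diff_trans[of \<delta> x r z] rep_eq[of x z] by simp
  qed
  ultimately show ?thesis using that unfolding residue_system_def by blast
qed

lemma card_residue_system: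
  assumes "residue_system \<delta> R"
  shows "card R = index (multiples \<delta>)"
proof -
  let ?c = "\<lambda>x. {y. y - x \<in> multiples \<delta>}"
  have "inj_on ?c R"
  proof (rule inj_onI)
    fix r s assume rs: "r \<in> R" "s \<in> R" "?c r = ?c s"
    have "r \<in> ?c r" by (simp add: multiples_def)
    hence "r \<in> ?c s" by (simp only: rs(3))
    hence "\<delta> dvd r - s" by (simp add: multiples_def)
    moreover have "\<delta> dvd r - r" by simp
    ultimately show "r = s" using assms rs(1,2) unfolding residue_system_def by blast
  qed
  moreover have "?c ` R = range ?c"
  proof
    show "range ?c \<subseteq> ?c ` R"
    proof (rule image_subsetI)
      fix x
      obtain r where r: "r \<in> R" "\<delta> dvd x - r" using assms unfolding residue_system_def by blast
      have "\<delta> dvd y - x \<longleftrightarrow> \<delta> dvd y - r" for y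
        using dvd_diff_trans[of \<delta> y x r] dvd_diff_trans[of \<delta> y r x] r(2) zs2_dvd_diff_commute[of \<delta> x r] by blast
      hence "?c x = ?c r" by (simp add: multiples_def)
      with r(1) show "?c x \<in> ?c ` R" by blast
    qed
  qed blast
  ultimately show ?thesis unfolding index_def by (metis card_image)
qed

text \<open>Two-digit expansion: r + \<delta> s, with r a residue modulo \<delta> and s a residue
  modulo \<epsilon>, runs once through the residues modulo the product.\<close>

lemma index_mult:
  assumes "\<delta> \<noteq> 0" "\<epsilon> \<noteq> 0"
  shows "index (multiples (\<delta> * \<epsilon>)) = index (multiples \<delta>) * index (multiples \<epsilon>)"
proof -
  obtain R S where R: "residue_system \<delta> R" and S: "residue_system \<epsilon> S"
    using exists_residue_system assms by metis
  let ?f = "\<lambda>(r, s). r + \<delta> * s"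
  have uniq: "r = r' \<and> s = s'"
    if "r \<in> R" "r' \<in> R" "s \<in> S" "s' \<in> S" "\<delta> * \<epsilon> dvd (r + \<delta> * s) - (r' + \<delta> * s')" for r r' s s'
  proof -
    have "\<delta> dvd (r + \<delta> * s) - (r' + \<delta> * s') - \<delta> * (s - s')"
      by (rule dvd_diff[OF dvd_mult_left[OF that(5)] dvd_triv_left])
    hence "\<delta> dvd r - r'" by (simp add: algebra_simps)
    moreover have "\<delta> dvd r - r" by simp
    ultimately have rr: "r = r'" using R that(1,2) unfolding residue_system_def by blast
    have "\<delta> * \<epsilon> dvd \<delta> * (s - s')" using that(5) by (simp add: rr algebra_simps)
    hence "\<epsilon> dvd s - s'" using assms(1) by simp
    moreover have "\<epsilon> dvd s - s" by simp
    ultimately show ?thesis using S that(3,4) rr unfolding residue_system_def by blast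
  qed
  have inj: "inj_on ?f (R \<times> S)"
  proof (rule inj_onI, clarify)
    fix r s r' s' assume rs: "r \<in> R" "s \<in> S" "r' \<in> R" "s' \<in> S" "r + \<delta> * s = r' + \<delta> * s'"
    hence "\<delta> * \<epsilon> dvd (r + \<delta> * s) - (r' + \<delta> * s')" by simp
    from uniq[OF rs(1,3,2,4) this] show "r = r' \<and> s = s'" .
  qed
  have "residue_system (\<delta> * \<epsilon>) (?f ` (R \<times> S))"
    unfolding residue_system_def
  proof (intro conjI allI)
    show "finite (?f ` (R \<times> S))" using R S by (auto simp: residue_system_def)
    fix x
    obtain r where r: "r \<in> R" "\<delta> dvd x - r" using R unfolding residue_system_def by blast
    then obtain k where k: "x - r = \<delta> * k" by (elim dvdE)
    obtain s where s: "s \<in> S" "\<epsilon> dvd k - s" using S unfolding residue_system_def by blast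
    have "x - (r + \<delta> * s) = \<delta> * (k - s)" using k by (simp add: algebra_simps)
    hence d: "\<delta> * \<epsilon> dvd x - (r + \<delta> * s)" using s(2) by simp
    show "\<exists>!t. t \<in> ?f ` (R \<times> S) \<and> \<delta> * \<epsilon> dvd x - t"
    proof (rule ex1I[of _ "r + \<delta> * s"])
      show "r + \<delta> * s \<in> ?f ` (R \<times> S) \<and> \<delta> * \<epsilon> dvd x - (r + \<delta> * s)" using r s d by force
    next
      fix t assume t: "t \<in> ?f ` (R \<times> S) \<and> \<delta> * \<epsilon> dvd x - t"
      then obtain r' s' where rs: "r' \<in> R" "s' \<in> S" "t = r' + \<delta> * s'" by auto
      have "\<delta> * \<epsilon> dvd t - (r + \<delta> * s)"
        using t d dvd_diff_trans[of "\<delta> * \<epsilon>" t x "r + \<delta> * s"] zs2_dvd_diff_commute[of "\<delta> * \<epsilon>" t x] by blast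
      thus "t = r + \<delta> * s" using uniq[of r' r s' s] rs r(1) s(1) by simp
    qed
  qed
  from card_residue_system[OF this] show ?thesis
    using card_image[OF inj] card_residue_system[OF R] card_residue_system[OF S] by (simp add: card_cartesian_product)
qed

lemma index_one: "index (multiples 1) = 1"
proof -
  have "residue_system 1 {0}" by (simp add: residue_system_def)
  from card_residue_system[OF this] show ?thesis by simp
qed

lemma index_r2: "index (multiples r2) = 2"
proof -
  have "residue_system r2 {0, 1}"
    unfolding residue_system_def
  proof (intro conjI allI)
    fix x show "\<exists>!r. r \<in> {0, 1} \<and> r2 dvd x - r"
      by (cases "even (rpart x)") (auto simp: r2_dvd_iff intro: ex1I[of _ 0] ex1I[of _ 1])
  qed simp
  from card_residue_system[OF this] show ?thesis by simp
qed

section \<open>The odd divisor sum and its recursion\<close>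

definition odd_divisors :: "zs2 \<Rightarrow> zs2 set set" where
  "odd_divisors \<alpha> = {multiples \<delta> | \<delta>. \<delta> dvd \<alpha> \<and> \<not> r2 dvd \<delta>}"

text \<open>Summing over sets of multiples instead of elements counts associated divisors
  once.\<close>

definition odd_sigma :: "zs2 \<Rightarrow> nat" where
  "odd_sigma \<alpha> = (\<Sum>I\<in>odd_divisors \<alpha>. index I)"

text \<open>The multiples of a divisor of \<alpha> include the rational integer \<open>n\<close>, so
  they are determined by their members in the box of residues modulo \<open>n\<close>.\<close>

lemma finite_odd_divisors:
  assumes "\<alpha> \<noteq> 0"
  shows "finite (odd_divisors \<alpha>)"
proof -
  define n where "n = \<bar>fnorm \<alpha>\<bar>"
  have n: "n > 0" using assms by (simp add: n_def)
  have an: "\<alpha> dvd of_int n" using dvd_fnorm[of \<alpha>] by (auto simp: n_def abs_if)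
  let ?B = "(\<lambda>(a, b). ZS a b) ` ({0..<n} \<times> {0..<n})"
  have sub: "I \<subseteq> J" if I: "I \<in> odd_divisors \<alpha>" and J: "J \<in> odd_divisors \<alpha>" and IJ: "I \<inter> ?B = J \<inter> ?B" for I J
  proof
    fix x assume x: "x \<in> I"
    obtain \<delta> \<epsilon> where d: "I = multiples \<delta>" "\<delta> dvd \<alpha>" "J = multiples \<epsilon>" "\<epsilon> dvd \<alpha>"
      using I J unfolding odd_divisors_def by blast
    let ?y = "ZS (rpart x mod n) (spart x mod n)"
    have "of_int n dvd x - ?y" unfolding of_int_dvd_zs2 by simp
    hence y: "\<delta> dvd x - ?y" "\<epsilon> dvd x - ?y"
      by (rule dvd_trans[OF dvd_trans[OF d(2) an]] dvd_trans[OF dvd_trans[OF d(4) an]])+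
    have "\<delta> dvd x" using x d(1) by (simp add: multiples_def)
    hence "\<delta> dvd x - (x - ?y)" using y(1) by (rule dvd_diff)
    hence "?y \<in> I" using d(1) by (simp add: multiples_def)
    moreover have "?y \<in> ?B" using n by auto
    ultimately have "?y \<in> J" using IJ by blast
    hence "\<epsilon> dvd ?y" using d(3) by (simp add: multiples_def)
    with y(2) have "\<epsilon> dvd (x - ?y) + ?y" by (rule dvd_add)
    thus "x \<in> J" using d(3) by (simp add: multiples_def)
  qed
  have "inj_on (\<lambda>I. I \<inter> ?B) (odd_divisors \<alpha>)"
  proof (rule inj_onI)
    fix I J assume IJ: "I \<in> odd_divisors \<alpha>" "J \<in> odd_divisors \<alpha>" "I \<inter> ?B = J \<inter> ?B"
    show "I = J" using sub[OF IJ] sub[OF IJ(2,1) IJ(3)[symmetric]] by (rule subset_antisym)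
  qed
  moreover have "finite ((\<lambda>I. I \<inter> ?B) ` odd_divisors \<alpha>)"
    by (rule finite_subset[of _ "Pow ?B"]) auto
  ultimately show ?thesis by (rule finite_imageD[rotated])
qed

lemma dvd_of_not_prime_dvd:
  assumes "prime_elem \<pi>" "\<not> \<pi> dvd \<delta>" "\<delta> dvd \<pi> * (\<beta> :: zs2)"
  shows "\<delta> dvd \<beta>"
proof -
  obtain x y where xy: "x * \<pi> + y * \<delta> = 1"
    using irreducible_bezout[OF prime_elem_imp_irreducible_zs2[OF assms(1)] assms(2)] by blast
  have "\<beta> = (x * \<pi> + y * \<delta>) * \<beta>" by (simp add: xy)
  also have "\<dots> = x * (\<pi> * \<beta>) + \<delta> * (y * \<beta>)" by (simp add: algebra_simps)
  also have "\<delta> dvd \<dots>" by (rule dvd_add[OF dvd_mult[OF assms(3)] dvd_triv_left])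
  finally show ?thesis .
qed

lemma odd_sigma_unit:
  assumes "u dvd 1"
  shows "odd_sigma u = 1"
proof -
  have n1: "\<not> r2 dvd 1" by (simp add: r2_dvd_iff)
  have "odd_divisors u = {multiples 1}"
  proof
    show "odd_divisors u \<subseteq> {multiples 1}"
    proof
      fix I assume "I \<in> odd_divisors u"
      then obtain \<delta> where "I = multiples \<delta>" "\<delta> dvd u" unfolding odd_divisors_def by blast
      thus "I \<in> {multiples 1}" using dvd_trans[OF _ assms] by (simp add: multiples_eq_iff)
    qed
    show "{multiples 1} \<subseteq> odd_divisors u" using n1 unfolding odd_divisors_def by auto
  qed
  thus ?thesis by (simp add: odd_sigma_def index_one)
qed

lemma odd_sigma_ramified:
  assumes "prime_elem \<pi>" "\<pi> dvd r2"
  shows "odd_sigma (\<pi> * \<beta>) = odd_sigma \<beta>"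
proof -
  have "\<not> \<pi> dvd \<delta>" if "\<not> r2 dvd \<delta>" for \<delta>
    using dvd_trans[of r2 \<pi> \<delta>] assms prime_dvd_r2_iff[OF assms(1)] that by blast
  hence "\<delta> dvd \<pi> * \<beta> \<longleftrightarrow> \<delta> dvd \<beta>" if "\<not> r2 dvd \<delta>" for \<delta>
    using dvd_of_not_prime_dvd[OF assms(1)] that dvd_mult by blast
  hence "odd_divisors (\<pi> * \<beta>) = odd_divisors \<beta>" unfolding odd_divisors_def by blast
  thus ?thesis by (simp add: odd_sigma_def)
qed

text \<open>The divisors of \<pi>\<beta> are those of \<beta> together with \<pi> times those of
  \<beta>. The two families overlap exactly in \<pi> times the divisors of \<beta>/\<pi>, and not at
  all if \<pi> does not divide \<beta>. The result has the shape of the Hecke recursion, with the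
  same coefficient.\<close>

lemma odd_sigma_recursion:
  assumes \<pi>: "prime_elem \<pi>" "\<not> \<pi> dvd r2" and nz: "\<beta> \<noteq> 0"
  shows "\<not> \<pi> dvd \<beta> \<Longrightarrow> odd_sigma (\<pi> * \<beta>) = (index (multiples \<pi>) + 1) * odd_sigma \<beta>"
    and "\<beta> = \<pi> * \<gamma> \<Longrightarrow> odd_sigma (\<pi> * \<beta>) + index (multiples \<pi>) * odd_sigma \<gamma> = (index (multiples \<pi>) + 1) * odd_sigma \<beta>"
proof -
  have \<pi>0: "\<pi> \<noteq> 0" using \<pi>(1) by (auto simp: prime_elem_def)
  define T where "T I = (\<lambda>x. \<pi> * x) ` I" for I
  have T: "T (multiples \<delta>) = multiples (\<pi> * \<delta>)" for \<delta>
  proof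
    show "multiples (\<pi> * \<delta>) \<subseteq> T (multiples \<delta>)"
      unfolding T_def multiples_def by (auto elim!: dvdE simp: mult.assoc)
  qed (auto simp: T_def multiples_def)
  have injT: "inj_on T A" for A
    by (intro inj_onI) (use \<pi>0 in \<open>simp add: T_def inj_image_eq_iff inj_def\<close>)
  have odd: "\<not> r2 dvd \<pi> * \<delta>" if "\<not> r2 dvd \<delta>" for \<delta>
    using that \<pi> prime_dvd_r2_iff prime_elem_dvd_multD[OF prime_elem_r2] by blast
  have idx: "index (T I) = index (multiples \<pi>) * index I" if "I \<in> odd_divisors \<gamma>" "\<gamma> \<noteq> 0" for I \<gamma>
  proof -
    obtain \<delta> where d: "I = multiples \<delta>" "\<delta> dvd \<gamma>" using \<open>I \<in> odd_divisors \<gamma>\<close> unfolding odd_divisors_def by blast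
    have "\<delta> \<noteq> 0" using d(2) that(2) by auto
    thus ?thesis unfolding d(1) T using index_mult[OF \<pi>0] by simp
  qed
  have sumT: "(\<Sum>I\<in>T ` odd_divisors \<gamma>. index I) = index (multiples \<pi>) * odd_sigma \<gamma>" if "\<gamma> \<noteq> 0" for \<gamma>
    by (subst sum.reindex[OF injT]) (simp add: idx[OF _ that] odd_sigma_def sum_distrib_left)
  have un: "odd_divisors (\<pi> * \<beta>) = odd_divisors \<beta> \<union> T ` odd_divisors \<beta>"
  proof (intro subset_antisym subsetI)
    fix I assume "I \<in> odd_divisors (\<pi> * \<beta>)"
    then obtain \<delta> where d: "I = multiples \<delta>" "\<delta> dvd \<pi> * \<beta>" "\<not> r2 dvd \<delta>" unfolding odd_divisors_def by blast
    show "I \<in> odd_divisors \<beta> \<union> T ` odd_divisors \<beta>"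
    proof (cases "\<pi> dvd \<delta>")
      case False
      hence "\<delta> dvd \<beta>" using d(2) by (rule dvd_of_not_prime_dvd[OF \<pi>(1)])
      thus ?thesis using d(1,3) unfolding odd_divisors_def by blast
    next
      case True
      then obtain \<epsilon> where e: "\<delta> = \<pi> * \<epsilon>" by (elim dvdE)
      hence "\<epsilon> dvd \<beta>" "\<not> r2 dvd \<epsilon>" using d(2,3) \<pi>0 by auto
      hence "multiples \<epsilon> \<in> odd_divisors \<beta>" unfolding odd_divisors_def by blast
      thus ?thesis using d(1) e T by blast
    qed
  next
    fix I assume "I \<in> odd_divisors \<beta> \<union> T ` odd_divisors \<beta>"
    thus "I \<in> odd_divisors (\<pi> * \<beta>)"
    proof
      assume "I \<in> odd_divisors \<beta>"
      then obtain \<delta> where "I = multiples \<delta>" "\<delta> dvd \<beta>" "\<not> r2 dvd \<delta>" unfolding odd_divisors_def by blast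
      moreover from this have "\<delta> dvd \<pi> * \<beta>" by simp
      ultimately show ?thesis unfolding odd_divisors_def by blast
    next
      assume "I \<in> T ` odd_divisors \<beta>"
      then obtain \<delta> where d: "I = multiples (\<pi> * \<delta>)" "\<delta> dvd \<beta>" "\<not> r2 dvd \<delta>" unfolding odd_divisors_def using T by auto
      have "\<pi> * \<delta> dvd \<pi> * \<beta>" using d(2) by (rule mult_dvd_mono[OF dvd_refl])
      thus ?thesis unfolding odd_divisors_def using d(1) odd[OF d(3)] by blast
    qed
  qed
  have int_sub: "\<exists>\<epsilon>. I = T (multiples \<epsilon>) \<and> \<pi> * \<epsilon> dvd \<beta> \<and> \<not> r2 dvd \<epsilon>"
    if I: "I \<in> odd_divisors \<beta>" "I \<in> T ` odd_divisors \<beta>" for I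
  proof -
    obtain \<delta> where d: "I = multiples \<delta>" "\<delta> dvd \<beta>" using I(1) unfolding odd_divisors_def by blast
    obtain \<epsilon> where e: "I = T (multiples \<epsilon>)" "\<not> r2 dvd \<epsilon>" using I(2) unfolding odd_divisors_def by blast
    have "\<pi> * \<epsilon> dvd \<delta>" using d(1) e(1) T multiples_eq_iff by metis
    hence "\<pi> * \<epsilon> dvd \<beta>" using d(2) by (rule dvd_trans)
    thus ?thesis using e by blast
  qed
  have fin: "finite (odd_divisors \<beta>)" "finite (T ` odd_divisors \<beta>)" using finite_odd_divisors[OF nz] by auto
  have main: "odd_sigma (\<pi> * \<beta>) + (\<Sum>I\<in>odd_divisors \<beta> \<inter> T ` odd_divisors \<beta>. index I) = (index (multiples \<pi>) + 1) * odd_sigma \<beta>"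
    using sum.union_inter[OF fin, of index] sumT[OF nz] unfolding odd_sigma_def un by simp
  show "odd_sigma (\<pi> * \<beta>) = (index (multiples \<pi>) + 1) * odd_sigma \<beta>" if "\<not> \<pi> dvd \<beta>"
  proof -
    have "odd_divisors \<beta> \<inter> T ` odd_divisors \<beta> = {}"
      using int_sub that dvd_mult_left[of \<pi> _ \<beta>] by blast
    thus ?thesis using main by simp
  qed
  show "odd_sigma (\<pi> * \<beta>) + index (multiples \<pi>) * odd_sigma \<gamma> = (index (multiples \<pi>) + 1) * odd_sigma \<beta>" if \<gamma>: "\<beta> = \<pi> * \<gamma>"
  proof -
    have \<gamma>0: "\<gamma> \<noteq> 0" using nz \<gamma> by auto
    have "odd_divisors \<beta> \<inter> T ` odd_divisors \<beta> = T ` odd_divisors \<gamma>"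
    proof (intro subset_antisym subsetI)
      fix I assume "I \<in> odd_divisors \<beta> \<inter> T ` odd_divisors \<beta>"
      then obtain \<epsilon> where e: "I = T (multiples \<epsilon>)" "\<pi> * \<epsilon> dvd \<beta>" "\<not> r2 dvd \<epsilon>" using int_sub by blast
      hence "\<epsilon> dvd \<gamma>" using \<gamma> \<pi>0 by simp
      thus "I \<in> T ` odd_divisors \<gamma>" using e(1,3) unfolding odd_divisors_def by blast
    next
      fix I assume "I \<in> T ` odd_divisors \<gamma>"
      then obtain \<delta> where d: "I = T (multiples \<delta>)" "\<delta> dvd \<gamma>" "\<not> r2 dvd \<delta>" unfolding odd_divisors_def by auto
      have "\<pi> * \<delta> dvd \<beta>" using d(2) unfolding \<gamma> by (rule mult_dvd_mono[OF dvd_refl])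
      hence "I \<in> odd_divisors \<beta>" using d(1) T odd[OF d(3)] unfolding odd_divisors_def by auto
      moreover have "\<delta> dvd \<beta>" using d(2) unfolding \<gamma> by (rule dvd_mult)
      hence "I \<in> T ` odd_divisors \<beta>" using d unfolding odd_divisors_def by auto
      ultimately show "I \<in> odd_divisors \<beta> \<inter> T ` odd_divisors \<beta>" by blast
    qed
    thus ?thesis using main sumT[OF \<gamma>0] by simp
  qed
qed

section \<open>Representation numbers of the maximal order\<close>

definition has_val :: "zs2 \<Rightarrow> nat \<Rightarrow> bool" where
  "has_val \<alpha> e \<longleftrightarrow> r2 ^ e dvd \<alpha> \<and> \<not> r2 ^ (e + 1) dvd \<alpha>"

lemma has_val_ramified:
  assumes \<pi>: "prime_elem \<pi>" "\<pi> dvd r2" and v: "has_val (\<pi> * \<beta>) e"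
  obtains f where "e = Suc f" "has_val \<beta> f"
proof -
  have r: "r2 dvd \<pi>" using \<pi> prime_dvd_r2_iff by blast
  have iff: "r2 ^ Suc k dvd \<pi> * \<beta> \<longleftrightarrow> r2 ^ k dvd \<beta>" for k
  proof
    assume "r2 ^ k dvd \<beta>"
    thus "r2 ^ Suc k dvd \<pi> * \<beta>" using mult_dvd_mono[OF r] by simp
  next
    assume "r2 ^ Suc k dvd \<pi> * \<beta>"
    also have "\<pi> * \<beta> dvd r2 * \<beta>" using \<pi>(2) by (rule mult_dvd_mono) simp
    finally show "r2 ^ k dvd \<beta>" by simp
  qed
  have "e \<noteq> 0"
  proof
    assume "e = 0"
    with v have "\<not> r2 dvd \<pi> * \<beta>" by (simp add: has_val_def)
    with r show False by simp
  qed
  then obtain f where f: "e = Suc f" by (cases e) auto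
  hence "has_val \<beta> f" using v iff[of f] iff[of "Suc f"] by (simp add: has_val_def)
  with f show ?thesis by (rule that)
qed

lemma has_val_odd:
  assumes \<pi>: "\<not> r2 dvd \<pi>"
  shows "has_val (\<pi> * \<beta>) e \<longleftrightarrow> has_val \<beta> e"
proof -
  have "r2 ^ k dvd \<pi> * \<beta> \<Longrightarrow> r2 ^ k dvd \<beta>" for k
  proof (induction k)
    case (Suc k)
    have "r2 ^ k dvd \<pi> * \<beta>" using Suc.prems by (auto intro: dvd_mult_right)
    hence "r2 ^ k dvd \<beta>" by (rule Suc.IH)
    then obtain c where c: "\<beta> = r2 ^ k * c" by (elim dvdE)
    have "r2 ^ k * r2 dvd r2 ^ k * (\<pi> * c)" using Suc.prems by (simp add: c ac_simps)
    hence "r2 dvd \<pi> * c" by simp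
    hence "r2 dvd c" using prime_elem_dvd_multD[OF prime_elem_r2] \<pi> by blast
    thus ?case by (auto simp: c mult.commute)
  qed simp
  hence "r2 ^ k dvd \<pi> * \<beta> \<longleftrightarrow> r2 ^ k dvd \<beta>" for k using dvd_mult by blast
  thus ?thesis by (simp only: has_val_def)
qed

lemma prime_elem_unit_mult:
  assumes "prime_elem p" "u dvd (1 :: zs2)"
  shows "prime_elem (u * p)"
proof -
  obtain v where v: "1 = u * v" using assms(2) by (elim dvdE)
  have "p dvd u * p" "u * p dvd p"
  proof -
    have "p = (u * p) * v" using v by (metis mult.assoc mult.commute mult.left_neutral)
    thus "u * p dvd p" by (rule dvdI)
  qed simp
  hence "u * p dvd x \<longleftrightarrow> p dvd x" for x using dvd_trans[of p "u * p" x] dvd_trans[of "u * p" p x] by blast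
  moreover have "u \<noteq> 0" using v by auto
  ultimately show ?thesis using assms(1) by (simp add: prime_elem_def)
qed

text \<open>Induction on the norm, removing one totally positive prime. At an odd prime both sides
  obey one recursion and e is unchanged. At sqrt 2 the divisor sum is unchanged, and 2^(e+1) - 1
  solves x(e+1) + 2 x(e-1) = 3 x(e) with x(0) = 1 and x(1) = 3. The statement is over the integers
  because the recursion is solved for its leading term by subtraction.\<close>

lemma rO_formula:
  assumes "totpos \<alpha>" "has_val \<alpha> e"
  shows "int (rO \<alpha>) = int (rO 1) * (2 ^ (e + 1) - 1) * int (odd_sigma \<alpha>)"
  using assms
proof (induction "nat (fnorm \<alpha>)" arbitrary: \<alpha> e rule: less_induct)
  case (less \<alpha>)
  have \<alpha>0: "\<alpha> \<noteq> 0" using less.prems(1) totpos_nonzero by blast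
  show ?case
  proof (cases "\<alpha> dvd 1")
    case True
    then obtain w where w: "\<alpha> = w * w" "w dvd 1" using totpos_unit_square less.prems(1) by blast
    have "e = 0"
    proof (rule ccontr)
      assume "e \<noteq> 0"
      hence "r2 dvd r2 ^ e" by (simp add: dvd_power)
      also have "r2 ^ e dvd \<alpha>" using less.prems(2) by (simp add: has_val_def)
      also note True
      finally show False by (simp add: r2_dvd_iff)
    qed
    thus ?thesis using rO_unit_mult[OF w(2), of 1] odd_sigma_unit[OF True] w(1) by simp
  next
    case False
    then obtain p where p: "prime_elem p" "p dvd \<alpha>" using exists_prime_divisor \<alpha>0 by blast
    have "p \<noteq> 0" using p(1) by (auto simp: prime_elem_def)
    \<comment> \<open>The prime is replaced by a totally positive associate so that the cofactors
      stay totally positive and the induction hypothesis applies.\<close>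
    then obtain u where u: "u dvd 1" "totpos (u * p)" using totpos_associate by blast
    define \<pi> where "\<pi> = u * p"
    have \<pi>: "prime_elem \<pi>" "totpos \<pi>" using prime_elem_unit_mult[OF p(1) u(1)] u(2) by (simp_all add: \<pi>_def)
    have "\<pi> dvd \<alpha>"
    proof -
      obtain v where v: "1 = u * v" using u(1) by (elim dvdE)
      have "p = \<pi> * v" using v by (metis \<pi>_def mult.assoc mult.commute mult.left_neutral)
      hence "\<pi> dvd p" by (rule dvdI)
      thus ?thesis using p(2) by (rule dvd_trans)
    qed
    then obtain \<beta> where \<beta>: "\<alpha> = \<pi> * \<beta>" by (elim dvdE)
    have smaller: "nat (fnorm x) < nat (fnorm (\<pi> * x))" if "totpos x" for x
    proof -
      have "fnorm \<pi> > 0" "fnorm x > 0" using \<pi>(2) that by (simp_all add: totpos_def)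
      moreover have "\<not> \<pi> dvd 1" using \<pi>(1) by (auto simp: prime_elem_def)
      hence "fnorm \<pi> \<noteq> 1" by (simp add: unit_iff_fnorm)
      ultimately have "1 * fnorm x < fnorm \<pi> * fnorm x" by (intro mult_strict_right_mono) auto
      thus ?thesis using \<open>fnorm x > 0\<close> by (simp del: mult_less_cancel_right1)
    qed
    have t\<beta>: "totpos \<beta>" using totpos_mult_cancel[OF \<pi>(2)] less.prems(1) \<beta> by simp
    have \<beta>0: "\<beta> \<noteq> 0" using t\<beta> totpos_nonzero by blast
    have IH\<beta>: "int (rO \<beta>) = int (rO 1) * (2 ^ (f + 1) - 1) * int (odd_sigma \<beta>)" if "has_val \<beta> f" for f
      using less.hyps[OF _ t\<beta> that] smaller[OF t\<beta>] \<beta> by simp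
    have \<pi>0: "\<pi> \<noteq> 0" using \<pi>(2) totpos_nonzero by blast
    obtain R where R: "residue_system \<pi> R" using exists_residue_system[OF \<pi>0] .
    note rec = rO_recursion[OF \<pi> R, unfolded card_residue_system[OF R]]
    show ?thesis
    proof (cases "\<pi> dvd \<beta>")
      case False
      have r: "int (rO \<alpha>) = (int (index (multiples \<pi>)) + 1) * int (rO \<beta>)" using rec(2)[OF False] \<beta> by (simp add: algebra_simps)
      show ?thesis
      proof (cases "\<pi> dvd r2")
        case True
        hence "multiples \<pi> = multiples r2" using \<pi>(1) prime_dvd_r2_iff by (auto simp: multiples_eq_iff)
        hence q: "index (multiples \<pi>) = 2" by (simp add: index_r2)
        obtain f where f: "e = Suc f" "has_val \<beta> f" using has_val_ramified[OF \<pi>(1) True] less.prems(2) \<beta> by blast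
        have "f = 0"
        proof (rule ccontr)
          assume "f \<noteq> 0"
          hence "r2 dvd r2 ^ f" by (simp add: dvd_power)
          moreover have "r2 ^ f dvd \<beta>" using f(2) by (simp add: has_val_def)
          ultimately have "r2 dvd \<beta>" by (rule dvd_trans)
          with True have "\<pi> dvd \<beta>" by (rule dvd_trans)
          with False show False ..
        qed
        thus ?thesis using r IH\<beta>[OF f(2)] f(1) odd_sigma_ramified[OF \<pi>(1) True, of \<beta>] \<beta> q by simp
      next
        case odd: False
        have "has_val \<beta> e" using has_val_odd less.prems(2) \<beta> odd prime_dvd_r2_iff[OF \<pi>(1)] by simp
        note IH = IH\<beta>[OF this]
        have s: "int (odd_sigma \<alpha>) = (int (index (multiples \<pi>)) + 1) * int (odd_sigma \<beta>)"
          using odd_sigma_recursion(1)[OF \<pi>(1) odd \<beta>0 False] \<beta> by (simp add: algebra_simps)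
        show ?thesis unfolding r s IH by (simp add: algebra_simps)
      qed
    next
      case True
      then obtain \<gamma> where \<gamma>: "\<beta> = \<pi> * \<gamma>" by (elim dvdE)
      have t\<gamma>: "totpos \<gamma>" using totpos_mult_cancel[OF \<pi>(2)] t\<beta> \<gamma> by simp
      have IH\<gamma>: "int (rO \<gamma>) = int (rO 1) * (2 ^ (f + 1) - 1) * int (odd_sigma \<gamma>)" if "has_val \<gamma> f" for f
        using less.hyps[OF _ t\<gamma> that] smaller[OF t\<gamma>] smaller[OF t\<beta>] \<beta> \<gamma> by simp
      have "rO \<alpha> + index (multiples \<pi>) * rO \<gamma> = (index (multiples \<pi>) + 1) * rO \<beta>"
        using rec(1)[of \<gamma>] \<beta> \<gamma> by simp
      hence "int (rO \<alpha> + index (multiples \<pi>) * rO \<gamma>) = int ((index (multiples \<pi>) + 1) * rO \<beta>)" by (simp only:)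
      hence r: "int (rO \<alpha>) = (int (index (multiples \<pi>)) + 1) * int (rO \<beta>) - int (index (multiples \<pi>)) * int (rO \<gamma>)"
        by (simp add: algebra_simps)
      show ?thesis
      proof (cases "\<pi> dvd r2")
        case ram: True
        hence "multiples \<pi> = multiples r2" using \<pi>(1) prime_dvd_r2_iff by (auto simp: multiples_eq_iff)
        hence q: "index (multiples \<pi>) = 2" by (simp add: index_r2)
        obtain f where f: "e = Suc f" "has_val \<beta> f" using has_val_ramified[OF \<pi>(1) ram] less.prems(2) \<beta> by blast
        obtain g where g: "f = Suc g" "has_val \<gamma> g" using has_val_ramified[OF \<pi>(1) ram] f(2) \<gamma> by blast
        have "odd_sigma \<alpha> = odd_sigma \<beta>" "odd_sigma \<beta> = odd_sigma \<gamma>"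
          using odd_sigma_ramified[OF \<pi>(1) ram] \<beta> \<gamma> by simp_all
        thus ?thesis using r IH\<beta>[OF f(2)] IH\<gamma>[OF g(2)] q f(1) g(1) by (simp add: algebra_simps)
      next
        case odd: False
        have v: "has_val \<beta> e" using has_val_odd less.prems(2) \<beta> odd prime_dvd_r2_iff[OF \<pi>(1)] by simp
        hence v': "has_val \<gamma> e" using has_val_odd \<gamma> odd prime_dvd_r2_iff[OF \<pi>(1)] by simp
        have "odd_sigma \<alpha> + index (multiples \<pi>) * odd_sigma \<gamma> = (index (multiples \<pi>) + 1) * odd_sigma \<beta>"
          using odd_sigma_recursion(2)[OF \<pi>(1) odd \<beta>0 \<gamma>] \<beta> by simp
        hence "int (odd_sigma \<alpha> + index (multiples \<pi>) * odd_sigma \<gamma>) = int ((index (multiples \<pi>) + 1) * odd_sigma \<beta>)" by (simp only:)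
        hence s: "int (odd_sigma \<alpha>) = (int (index (multiples \<pi>)) + 1) * int (odd_sigma \<beta>) - int (index (multiples \<pi>)) * int (odd_sigma \<gamma>)"
          by (simp add: algebra_simps)
        show ?thesis unfolding r s IH\<beta>[OF v] IH\<gamma>[OF v'] by (simp add: algebra_simps)
      qed
    qed
  qed
qed


section \<open>The unit group of the maximal order\<close>

text \<open>The binary octahedral group in doubled coordinates, rational parts before irrational
  parts: 16 elements with all four coordinates 1/2 up to sign, 8 signed basis quaternions, and 24
  with two coordinates 1/sqrt 2 up to sign.\<close>

definition unit_parts :: "(int \<times> int \<times> int \<times> int \<times> int \<times> int \<times> int \<times> int) list" where
  "unit_parts =
  [(1, 1, 1, 1, 0, 0, 0, 0), (1, 1, 1, -1, 0, 0, 0, 0), (1, 1, -1, 1, 0, 0, 0, 0), (1, 1, -1, -1, 0, 0, 0, 0),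
   (1, -1, 1, 1, 0, 0, 0, 0), (1, -1, 1, -1, 0, 0, 0, 0), (1, -1, -1, 1, 0, 0, 0, 0), (1, -1, -1, -1, 0, 0, 0, 0),
   (-1, 1, 1, 1, 0, 0, 0, 0), (-1, 1, 1, -1, 0, 0, 0, 0), (-1, 1, -1, 1, 0, 0, 0, 0), (-1, 1, -1, -1, 0, 0, 0, 0),
   (-1, -1, 1, 1, 0, 0, 0, 0), (-1, -1, 1, -1, 0, 0, 0, 0), (-1, -1, -1, 1, 0, 0, 0, 0), (-1, -1, -1, -1, 0, 0, 0, 0),
   (2, 0, 0, 0, 0, 0, 0, 0), (-2, 0, 0, 0, 0, 0, 0, 0), (0, 2, 0, 0, 0, 0, 0, 0), (0, -2, 0, 0, 0, 0, 0, 0),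
   (0, 0, 2, 0, 0, 0, 0, 0), (0, 0, -2, 0, 0, 0, 0, 0), (0, 0, 0, 2, 0, 0, 0, 0), (0, 0, 0, -2, 0, 0, 0, 0),
   (0, 0, 0, 0, 1, 1, 0, 0), (0, 0, 0, 0, 1, -1, 0, 0), (0, 0, 0, 0, -1, 1, 0, 0), (0, 0, 0, 0, -1, -1, 0, 0),
   (0, 0, 0, 0, 1, 0, 1, 0), (0, 0, 0, 0, 1, 0, -1, 0), (0, 0, 0, 0, -1, 0, 1, 0), (0, 0, 0, 0, -1, 0, -1, 0),
   (0, 0, 0, 0, 1, 0, 0, 1), (0, 0, 0, 0, 1, 0, 0, -1), (0, 0, 0, 0, -1, 0, 0, 1), (0, 0, 0, 0, -1, 0, 0, -1),
   (0, 0, 0, 0, 0, 1, 1, 0), (0, 0, 0, 0, 0, 1, -1, 0), (0, 0, 0, 0, 0, -1, 1, 0), (0, 0, 0, 0, 0, -1, -1, 0),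
   (0, 0, 0, 0, 0, 1, 0, 1), (0, 0, 0, 0, 0, 1, 0, -1), (0, 0, 0, 0, 0, -1, 0, 1), (0, 0, 0, 0, 0, -1, 0, -1),
   (0, 0, 0, 0, 0, 0, 1, 1), (0, 0, 0, 0, 0, 0, 1, -1), (0, 0, 0, 0, 0, 0, -1, 1), (0, 0, 0, 0, 0, 0, -1, -1)]"

definition oct_of_parts :: "int \<times> int \<times> int \<times> int \<times> int \<times> int \<times> int \<times> int \<Rightarrow> oct" where
  "oct_of_parts = (\<lambda>(a0, a1, a2, a3, b0, b1, b2, b3).
     Oct (ZS ((a0 - a1 - a2 + a3) div 2) ((b0 - b1 - b2 + b3) div 2))
       (ZS (b1 - b3) ((a1 - a3) div 2)) (ZS (b2 - b3) ((a2 - a3) div 2)) (ZS a3 b3))"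

lemma oct_of_parts:
  "x = oct_of_parts (rpart (w0 x), rpart (w1 x), rpart (w2 x), rpart (w3 x),
      spart (w0 x), spart (w1 x), spart (w2 x), spart (w3 x))"
  by (simp add: oct_of_parts_def w_defs oct_eq_iff zs2_eq_iff zs2_sel_mult)

text \<open>The equation is the rational part of 4 \<open>nn x\<close> = 4. If the \<open>a\<close>
  are odd, they exhaust the sum and the \<open>b\<close> vanish. If they are even, halving leaves
  either one entry of absolute value 1 among the halves and no \<open>b\<close>, or two such entries
  among the \<open>b\<close> and no \<open>a\<close>.\<close>

lemma parts_of_unit:
  assumes sum: "a0 * a0 + a1 * a1 + a2 * a2 + a3 * a3 + 2 * (b0 * b0 + b1 * b1 + b2 * b2 + b3 * b3) = (4 :: int)"
    and par: "even (a0 + a1)" "even (a0 + a2)" "even (a0 + a3)" "even (b0 + b1 + b2 + b3)"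
  shows "(a0, a1, a2, a3, b0, b1, b2, b3) \<in> set unit_parts"
proof -
  have sq: "0 \<le> z * z" for z :: int by simp
  have one: "1 \<le> z * z" if "z \<noteq> 0" for z :: int 
  proof -
    have "z * z \<noteq> 0" using that by simp
    with sq[of z] show ?thesis by linarith
  qed
  have small: "z = - 1 \<or> z = 0 \<or> z = 1" if "z * z \<le> 3" for z :: int
  proof -
    have "\<bar>z\<bar> < 2"
    proof (rule ccontr)
      assume "\<not> \<bar>z\<bar> < 2"
      hence "2 * 2 \<le> \<bar>z\<bar> * \<bar>z\<bar>" by (intro mult_mono) auto
      with that show False by (simp add: abs_mult_self_eq)
    qed
    thus ?thesis by linarith
  qed
  show ?thesis
  proof (cases "even a0")
    case False
    hence odd: "odd a0" "odd a1" "odd a2" "odd a3" using par by auto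
    hence nz: "a0 \<noteq> 0" "a1 \<noteq> 0" "a2 \<noteq> 0" "a3 \<noteq> 0" by auto
    note a = one[OF nz(1)] one[OF nz(2)] one[OF nz(3)] one[OF nz(4)]
    have "B0 = 0 \<and> B1 = 0 \<and> B2 = 0 \<and> B3 = 0 \<and> A0 \<le> 3 \<and> A1 \<le> 3 \<and> A2 \<le> 3 \<and> A3 \<le> 3"
      if "A0 + A1 + A2 + A3 + 2 * (B0 + B1 + B2 + B3) = 4" "1 \<le> A0" "1 \<le> A1" "1 \<le> A2" "1 \<le> A3"
        "0 \<le> B0" "0 \<le> B1" "0 \<le> B2" "0 \<le> B3" for A0 A1 A2 A3 B0 B1 B2 B3 :: int
      using that by auto
    from this[OF sum a sq sq sq sq] have b: "b0 * b0 = 0" "b1 * b1 = 0" "b2 * b2 = 0" "b3 * b3 = 0"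
      and "a0 * a0 \<le> 3" "a1 * a1 \<le> 3" "a2 * a2 \<le> 3" "a3 * a3 \<le> 3" by blast+
    hence "a0 = - 1 \<or> a0 = 1" "a1 = - 1 \<or> a1 = 1" "a2 = - 1 \<or> a2 = 1" "a3 = - 1 \<or> a3 = 1"
      using small nz by blast+
    with b show ?thesis by (elim disjE) (simp_all add: unit_parts_def)
  next
    case True
    hence "even a0" "even a1" "even a2" "even a3" using par by auto
    then obtain d0 d1 d2 d3 where d: "a0 = 2 * d0" "a1 = 2 * d1" "a2 = 2 * d2" "a3 = 2 * d3" by (metis evenE)
    have sum': "2 * (d0 * d0 + d1 * d1 + d2 * d2 + d3 * d3) + (b0 * b0 + b1 * b1 + b2 * b2 + b3 * b3) = 2"
      using sum unfolding d by simp
    have bound: "B0 \<le> M \<and> B1 \<le> M \<and> B2 \<le> M \<and> B3 \<le> M"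
      if "B0 + B1 + B2 + B3 = M" "0 \<le> B0" "0 \<le> B1" "0 \<le> B2" "0 \<le> B3" for B0 B1 B2 B3 M :: int
      using that by auto
    show ?thesis
    proof (cases "d0 = 0 \<and> d1 = 0 \<and> d2 = 0 \<and> d3 = 0")
      case True
      hence s: "b0 * b0 + b1 * b1 + b2 * b2 + b3 * b3 = 2" using sum' by simp
      have "b0 * b0 \<le> 3" "b1 * b1 \<le> 3" "b2 * b2 \<le> 3" "b3 * b3 \<le> 3" using bound[OF s sq sq sq sq] by auto
      hence "b0 = - 1 \<or> b0 = 0 \<or> b0 = 1" "b1 = - 1 \<or> b1 = 0 \<or> b1 = 1" "b2 = - 1 \<or> b2 = 0 \<or> b2 = 1" "b3 = - 1 \<or> b3 = 0 \<or> b3 = 1"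
        using small by blast+
      with s show ?thesis using True d by (elim disjE) (simp_all add: unit_parts_def)
    next
      case False
      hence "1 \<le> d0 * d0 \<or> 1 \<le> d1 * d1 \<or> 1 \<le> d2 * d2 \<or> 1 \<le> d3 * d3" using one by blast
      moreover have "A0 + A1 + A2 + A3 = 1 \<and> B0 = 0 \<and> B1 = 0 \<and> B2 = 0 \<and> B3 = 0"
        if "1 \<le> A0 \<or> 1 \<le> A1 \<or> 1 \<le> A2 \<or> 1 \<le> A3" "2 * (A0 + A1 + A2 + A3) + (B0 + B1 + B2 + B3) = 2"
          "0 \<le> A0" "0 \<le> A1" "0 \<le> A2" "0 \<le> A3" "0 \<le> B0" "0 \<le> B1" "0 \<le> B2" "0 \<le> B3" for A0 A1 A2 A3 B0 B1 B2 B3 :: int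
        using that by auto
      ultimately have s: "d0 * d0 + d1 * d1 + d2 * d2 + d3 * d3 = 1" and b': "b0 * b0 = 0" "b1 * b1 = 0" "b2 * b2 = 0" "b3 * b3 = 0"
        using sum' sq by metis+
      have "d0 * d0 \<le> 3" "d1 * d1 \<le> 3" "d2 * d2 \<le> 3" "d3 * d3 \<le> 3" using bound[OF s sq sq sq sq] by auto
      hence "d0 = - 1 \<or> d0 = 0 \<or> d0 = 1" "d1 = - 1 \<or> d1 = 0 \<or> d1 = 1" "d2 = - 1 \<or> d2 = 0 \<or> d2 = 1" "d3 = - 1 \<or> d3 = 0 \<or> d3 = 1"
        using small by blast+
      with s b' d show ?thesis by (elim disjE) (simp_all add: unit_parts_def)
    qed
  qed
qed

definition unit_list :: "oct list" where
  "unit_list =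
  [Oct (ZS 0 0) (ZS 0 0) (ZS 0 0) (ZS 1 0), Oct (ZS (-1) 0) (ZS 0 1) (ZS 0 1) (ZS (-1) 0), Oct (ZS 1 0) (ZS 0 0) (ZS 0 (-1)) (ZS 1 0),
   Oct (ZS 0 0) (ZS 0 1) (ZS 0 0) (ZS (-1) 0), Oct (ZS 1 0) (ZS 0 (-1)) (ZS 0 0) (ZS 1 0), Oct (ZS 0 0) (ZS 0 0) (ZS 0 1) (ZS (-1) 0),
   Oct (ZS 2 0) (ZS 0 (-1)) (ZS 0 (-1)) (ZS 1 0), Oct (ZS 1 0) (ZS 0 0) (ZS 0 0) (ZS (-1) 0), Oct (ZS (-1) 0) (ZS 0 0) (ZS 0 0) (ZS 1 0),
   Oct (ZS (-2) 0) (ZS 0 1) (ZS 0 1) (ZS (-1) 0), Oct (ZS 0 0) (ZS 0 0) (ZS 0 (-1)) (ZS 1 0), Oct (ZS (-1) 0) (ZS 0 1) (ZS 0 0) (ZS (-1) 0),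
   Oct (ZS 0 0) (ZS 0 (-1)) (ZS 0 0) (ZS 1 0), Oct (ZS (-1) 0) (ZS 0 0) (ZS 0 1) (ZS (-1) 0), Oct (ZS 1 0) (ZS 0 (-1)) (ZS 0 (-1)) (ZS 1 0),
   Oct (ZS 0 0) (ZS 0 0) (ZS 0 0) (ZS (-1) 0), Oct (ZS 1 0) (ZS 0 0) (ZS 0 0) (ZS 0 0), Oct (ZS (-1) 0) (ZS 0 0) (ZS 0 0) (ZS 0 0),
   Oct (ZS (-1) 0) (ZS 0 1) (ZS 0 0) (ZS 0 0), Oct (ZS 1 0) (ZS 0 (-1)) (ZS 0 0) (ZS 0 0), Oct (ZS (-1) 0) (ZS 0 0) (ZS 0 1) (ZS 0 0),
   Oct (ZS 1 0) (ZS 0 0) (ZS 0 (-1)) (ZS 0 0), Oct (ZS 1 0) (ZS 0 (-1)) (ZS 0 (-1)) (ZS 2 0), Oct (ZS (-1) 0) (ZS 0 1) (ZS 0 1) (ZS (-2) 0),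
   Oct (ZS 0 0) (ZS 1 0) (ZS 0 0) (ZS 0 0), Oct (ZS 0 1) (ZS (-1) 0) (ZS 0 0) (ZS 0 0), Oct (ZS 0 (-1)) (ZS 1 0) (ZS 0 0) (ZS 0 0),
   Oct (ZS 0 0) (ZS (-1) 0) (ZS 0 0) (ZS 0 0), Oct (ZS 0 0) (ZS 0 0) (ZS 1 0) (ZS 0 0), Oct (ZS 0 1) (ZS 0 0) (ZS (-1) 0) (ZS 0 0),
   Oct (ZS 0 (-1)) (ZS 0 0) (ZS 1 0) (ZS 0 0), Oct (ZS 0 0) (ZS 0 0) (ZS (-1) 0) (ZS 0 0), Oct (ZS 0 1) (ZS (-1) 0) (ZS (-1) 0) (ZS 0 1),
   Oct (ZS 0 0) (ZS 1 0) (ZS 1 0) (ZS 0 (-1)), Oct (ZS 0 0) (ZS (-1) 0) (ZS (-1) 0) (ZS 0 1), Oct (ZS 0 (-1)) (ZS 1 0) (ZS 1 0) (ZS 0 (-1)),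
   Oct (ZS 0 (-1)) (ZS 1 0) (ZS 1 0) (ZS 0 0), Oct (ZS 0 0) (ZS 1 0) (ZS (-1) 0) (ZS 0 0), Oct (ZS 0 0) (ZS (-1) 0) (ZS 1 0) (ZS 0 0),
   Oct (ZS 0 1) (ZS (-1) 0) (ZS (-1) 0) (ZS 0 0), Oct (ZS 0 0) (ZS 0 0) (ZS (-1) 0) (ZS 0 1), Oct (ZS 0 (-1)) (ZS 2 0) (ZS 1 0) (ZS 0 (-1)),
   Oct (ZS 0 1) (ZS (-2) 0) (ZS (-1) 0) (ZS 0 1), Oct (ZS 0 0) (ZS 0 0) (ZS 1 0) (ZS 0 (-1)), Oct (ZS 0 0) (ZS (-1) 0) (ZS 0 0) (ZS 0 1),
   Oct (ZS 0 (-1)) (ZS 1 0) (ZS 2 0) (ZS 0 (-1)), Oct (ZS 0 1) (ZS (-1) 0) (ZS (-2) 0) (ZS 0 1), Oct (ZS 0 0) (ZS 1 0) (ZS 0 0) (ZS 0 (-1))]"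

lemma map_unit_parts: "map oct_of_parts unit_parts = unit_list"
  by (simp add: unit_parts_def unit_list_def oct_of_parts_def)

lemma distinct_unit_list: "distinct unit_list"
  by (simp add: unit_list_def)

lemma reps_one: "reps 1 = set unit_list"
proof
  show "reps 1 \<subseteq> set unit_list"
  proof
    fix x assume "x \<in> reps 1"
    hence "4 = w0 x * w0 x + w1 x * w1 x + w2 x * w2 x + w3 x * w3 x"
      using four_nn[of x] by (simp add: reps_def)
    hence "rpart 4 = rpart (w0 x * w0 x + w1 x * w1 x + w2 x * w2 x + w3 x * w3 x)" by (simp only:)
    hence "rpart (w0 x) * rpart (w0 x) + rpart (w1 x) * rpart (w1 x) + rpart (w2 x) * rpart (w2 x) + rpart (w3 x) * rpart (w3 x)
      + 2 * (spart (w0 x) * spart (w0 x) + spart (w1 x) * spart (w1 x) + spart (w2 x) * spart (w2 x) + spart (w3 x) * spart (w3 x)) = 4"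
      by (simp add: zs2_sel_mult)
    from parts_of_unit[OF this parts_parity] have "x \<in> oct_of_parts ` set unit_parts"
      using oct_of_parts by blast
    thus "x \<in> set unit_list" by (simp only: set_map[symmetric] map_unit_parts)
  qed
  have "\<forall>x\<in>set unit_list. nn x = 1"
    by (simp add: unit_list_def nn_def zs2_eq_iff zs2_sel_mult)
  thus "set unit_list \<subseteq> reps 1" by (auto simp: reps_def)
qed

lemma rO_one: "rO 1 = 48"
  unfolding rO_def reps_one distinct_card[OF distinct_unit_list] by (simp add: unit_list_def)

section \<open>The action of the units on rows modulo $2 \sqrt 2$\<close>

definition unit_rows :: "(int \<times> int \<times> int \<times> int) list" where
  "unit_rows =
  [(-1, 1, 0, 0), (1, -1, 3, 1), (-1, 2, -1, -1), (1, 0, 2, 0), (-1, 0, -1, 0), (1, -2, 2, 1),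
   (-1, 1, -2, -1), (1, -1, 1, 0), (-1, 1, -1, 0), (1, -1, 2, 1), (-1, 2, -2, -1), (1, 0, 1, 0),
   (-1, 0, -2, 0), (1, -2, 1, 1), (-1, 1, -3, -1), (1, -1, 0, 0), (0, 0, 1, 0), (0, 0, -1, 0),
   (0, 1, 1, 0), (0, -1, -1, 0), (0, -1, 1, 1), (0, 1, -1, -1), (-2, 2, -3, -1), (2, -2, 3, 1),
   (1, 0, 0, 1), (-1, 0, 0, 0), (1, 0, 0, 0), (-1, 0, 0, -1), (-1, 0, 1, 1), (1, 0, -1, 0),
   (-1, 0, 1, 0), (1, 0, -1, -1), (2, -1, -1, -1), (-2, 1, 1, 2), (2, -1, -1, -2), (-2, 1, 1, 1),
   (0, 0, 1, 1), (2, 0, -1, 0), (-2, 0, 1, 0), (0, 0, -1, -1), (3, -1, -1, -1), (-1, 1, 1, 2),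
   (1, -1, -1, -2), (-3, 1, 1, 1), (1, -1, 0, -1), (-3, 1, 2, 2), (3, -1, -2, -2), (-1, 1, 0, 1)]"

lemma map_unit_rows:
  "map (\<lambda>u. (rpart (h21 u), spart (h21 u), rpart (h22 u), spart (h22 u))) unit_list = unit_rows"
  by (simp add: unit_rows_def unit_list_def h_defs zs2_sel_mult)

text \<open>Divisibility by 2 sqrt 2 of (p + q sqrt 2)(a + b sqrt 2) + (r + t sqrt 2)(c + d sqrt 2),
  spelled out by \<open>two_r2_dvd_iff\<close>.\<close>

definition row_annihilates :: "int \<Rightarrow> int \<Rightarrow> int \<Rightarrow> int \<Rightarrow> int \<times> int \<times> int \<times> int \<Rightarrow> bool" where
  "row_annihilates a b c d = (\<lambda>(p, q, r, t).
     4 dvd p * a + 2 * q * b + r * c + 2 * t * d \<and> 2 dvd p * b + q * a + r * d + t * c)"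

text \<open>The total is 4, 8, 16 or 48 according to the power of sqrt 2 common to both entries of
  the column. It is written through its increments, so that each summand tests membership in one
  left ideal.\<close>

definition row_count :: "int \<Rightarrow> int \<Rightarrow> int \<Rightarrow> int \<Rightarrow> nat" where
  "row_count a b c d = 4 + (if 2 dvd a \<and> 2 dvd c then 4 else 0)
     + (if (2 dvd a \<and> 2 dvd b) \<and> 2 dvd c \<and> 2 dvd d then 8 else 0)
     + (if (4 dvd a \<and> 2 dvd b) \<and> 4 dvd c \<and> 2 dvd d then 32 else 0)"

lemma row_annihilates_mod:
  "row_annihilates (a mod 4) (b mod 2) (c mod 4) (d mod 2) = row_annihilates a b c d"
proof (rule ext)
  fix z :: "int \<times> int \<times> int \<times> int"
  obtain p q r t where z: "z = (p, q, r, t)" by (cases z)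
  obtain a' b' c' d' where e: "a = 4 * a' + a mod 4" "b = 2 * b' + b mod 2" "c = 4 * c' + c mod 4" "d = 2 * d' + d mod 2"
    by (metis mult_div_mod_eq)
  define A B C D where "A = a mod 4" and "B = b mod 2" and "C = c mod 4" and "D = d mod 2"
  have eA: "a = 4 * a' + A" "b = 2 * b' + B" "c = 4 * c' + C" "d = 2 * d' + D"
    using e by (simp_all only: A_def B_def C_def D_def)
  have "p * a + 2 * q * b + r * c + 2 * t * d = (p * A + 2 * q * B + r * C + 2 * t * D) + 4 * (p * a' + q * b' + r * c' + t * d')"
    "p * b + q * a + r * d + t * c = (p * B + q * A + r * D + t * C) + 2 * (p * b' + 2 * q * a' + r * d' + 2 * t * c')"
    by (simp_all add: eA algebra_simps)
  hence "4 dvd p * a + 2 * q * b + r * c + 2 * t * d \<longleftrightarrow> 4 dvd p * A + 2 * q * B + r * C + 2 * t * D"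
    "2 dvd p * b + q * a + r * d + t * c \<longleftrightarrow> 2 dvd p * B + q * A + r * D + t * C"
    by (metis dvd_add_left_iff dvd_triv_left)+
  thus "row_annihilates (a mod 4) (b mod 2) (c mod 4) (d mod 2) z = row_annihilates a b c d z"
    by (simp only: row_annihilates_def z prod.case A_def B_def C_def D_def)
qed

text \<open>A column matters only modulo 2 sqrt 2, that is, by rational parts modulo 4 and
  irrational parts modulo 2; these are the 64 cases.\<close>

lemma unit_rows_grid:
  "list_all (\<lambda>(a, b, c, d). length (filter (row_annihilates a b c d) unit_rows) = row_count a b c d)
     (List.product [0, 1, 2, 3] (List.product [0, 1] (List.product [0, 1, 2, 3] [0, 1])))"
  by code_simp

lemma unit_rows_count: "length (filter (row_annihilates a b c d) unit_rows) = row_count a b c d"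
proof -
  have "a mod 4 \<in> {0,1,2,3}" "b mod 2 \<in> {0,1}" "c mod 4 \<in> {0,1,2,3}" "d mod 2 \<in> {0,1}" by auto
  hence "(a mod 4, b mod 2, c mod 4, d mod 2)
      \<in> set (List.product [0, 1, 2, 3] (List.product [0, 1] (List.product [0, 1, 2, 3] [0, 1])))"
    by (simp only: set_product list.set mem_Sigma_iff)
  with unit_rows_grid have "length (filter (row_annihilates (a mod 4) (b mod 2) (c mod 4) (d mod 2)) unit_rows) = row_count (a mod 4) (b mod 2) (c mod 4) (d mod 2)"
    unfolding list_all_iff by blast
  moreover have "row_count (a mod 4) (b mod 2) (c mod 4) (d mod 2) = row_count a b c d"
    by (simp add: row_count_def dvd_mod_iff)
  ultimately show ?thesis by (simp only: row_annihilates_mod)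
qed

lemma two_dvd_zs2: "2 dvd x \<longleftrightarrow> even (rpart x) \<and> even (spart x)"
  using of_int_dvd_zs2[of 2 x] by simp

lemma card_units_annihilating:
  "card {u \<in> reps 1. 2 * r2 dvd h21 u * x + h22 u * y} =
    4 + (if r2 dvd x \<and> r2 dvd y then 4 else 0) + (if 2 dvd x \<and> 2 dvd y then 8 else 0)
      + (if 2 * r2 dvd x \<and> 2 * r2 dvd y then 32 else 0)"
proof -
  let ?row = "\<lambda>u. (rpart (h21 u), spart (h21 u), rpart (h22 u), spart (h22 u))"
  let ?P = "row_annihilates (rpart x) (spart x) (rpart y) (spart y)"
  have iff: "2 * r2 dvd h21 u * x + h22 u * y \<longleftrightarrow> ?P (?row u)" for u
    by (simp only: row_annihilates_def two_r2_dvd_iff zs2_sel_mult zs2_sel prod.case add.assoc)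
  have "{u \<in> reps 1. 2 * r2 dvd h21 u * x + h22 u * y} = set (filter (?P \<circ> ?row) unit_list)"
    by (simp add: reps_one iff)
  hence "card {u \<in> reps 1. 2 * r2 dvd h21 u * x + h22 u * y} = length (filter (?P \<circ> ?row) unit_list)"
    by (simp only: distinct_card[OF distinct_filter[OF distinct_unit_list]])
  also have "\<dots> = length (filter ?P (map ?row unit_list))" by (simp add: filter_map)
  also have "\<dots> = row_count (rpart x) (spart x) (rpart y) (spart y)"
    by (simp only: map_unit_rows unit_rows_count)
  finally show ?thesis
    by (simp only: row_count_def r2_dvd_iff two_dvd_zs2 two_r2_dvd_iff)
qed

section \<open>Representation numbers of the suborder\<close>

definition column_ideal :: "zs2 \<Rightarrow> oct set" where
  "column_ideal s = {x. s dvd h11 x \<and> s dvd h21 x}"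

text \<open>The left-hand sides of the assumptions g span the ideal over $\mathbb{Z}[\sqrt 2]$.\<close>

lemma column_ideal_principal:
  assumes "s dvd 2 * r2" "s dvd h11 \<rho>" "s dvd h21 \<rho>"
    and g: "scal s = x1 * \<rho>" "scal s * Oct 0 1 0 0 = x2 * \<rho>" "Oct 1 1 1 0 = x3 * \<rho>" "Oct (- 1) (1 - r2) 0 1 = x4 * \<rho>"
  shows "column_ideal s = range (\<lambda>x. x * \<rho>)"
proof
  show "range (\<lambda>x. x * \<rho>) \<subseteq> column_ideal s"
  proof
    fix y assume "y \<in> range (\<lambda>x. x * \<rho>)"
    then obtain x where y: "y = x * \<rho>" by auto
    have "s dvd (h11 y - (h11 x * h11 \<rho> + h12 x * h21 \<rho>)) + (h11 x * h11 \<rho> + h12 x * h21 \<rho>)"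
      by (rule dvd_add[OF dvd_trans[OF assms(1) h_mult(1)[of x \<rho>, folded y]]]) (intro dvd_add dvd_mult assms)
    moreover have "s dvd (h21 y - (h21 x * h11 \<rho> + h22 x * h21 \<rho>)) + (h21 x * h11 \<rho> + h22 x * h21 \<rho>)"
      by (rule dvd_add[OF dvd_trans[OF assms(1) h_mult(3)[of x \<rho>, folded y]]]) (intro dvd_add dvd_mult assms)
    ultimately show "y \<in> column_ideal s" by (simp add: column_ideal_def)
  qed
  show "column_ideal s \<subseteq> range (\<lambda>x. x * \<rho>)"
  proof
    fix y assume "y \<in> column_ideal s"
    then obtain X Y where XY: "h11 y = s * X" "h21 y = s * Y" by (auto simp: column_ideal_def elim!: dvdE)
    have "c0 y = s * X + c2 y - c3 y" "c1 y = s * Y + c2 y - (r2 - 1) * c3 y"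
      using XY by (simp_all add: h_defs algebra_simps)
    hence "y = scal X * scal s + scal Y * (scal s * Oct 0 1 0 0) + scal (c2 y) * Oct 1 1 1 0 + scal (c3 y) * Oct (- 1) (1 - r2) 0 1"
      by (simp add: oct_eq_iff algebra_simps)
    also have "\<dots> = (scal X * x1 + scal Y * x2 + scal (c2 y) * x3 + scal (c3 y) * x4) * \<rho>"
      by (simp only: g(2-4)) (simp only: g(1) distrib_right mult.assoc)
    finally show "y \<in> range (\<lambda>x. x * \<rho>)" by (rule image_eqI) simp
  qed
qed

text \<open>The generators have norms (2 + sqrt 2)^s for s = 1, 2, 3. Each witness is a right
  quotient: the spanning element times the conjugate of the generator, divided by its norm.\<close>

lemma column_ideals:
  "column_ideal r2 = range (\<lambda>x. x * Oct 0 0 (- 1) (- 1))"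
  "column_ideal 2 = range (\<lambda>x. x * Oct (ZS (- 1) (- 1)) 1 0 (ZS (- 1) (- 1)))"
  "column_ideal (2 * r2) = range (\<lambda>x. x * Oct (ZS (- 1) (- 1)) (ZS (- 1) (- 1)) (ZS (- 1) (- 1)) 0)"
proof -
  show "column_ideal r2 = range (\<lambda>x. x * Oct 0 0 (- 1) (- 1))"
    by (rule column_ideal_principal[where ?x1.0 = "Oct (- 1) 0 (ZS (- 1) 1) (ZS (- 1) 1)" and ?x2.0 = "Oct 0 (- 1) (ZS 1 (- 1)) 1"
        and ?x3.0 = "Oct (- r2) (ZS 1 (- 1)) 0 1" and ?x4.0 = "Oct (ZS (- 1) 1) 0 (ZS (- 3) 2) (ZS (- 2) 1)"])
      (simp_all add: h_defs r2_dvd_iff zs2_sel_mult oct_eq_iff times_oct_def zs2_eq_iff)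
  show "column_ideal 2 = range (\<lambda>x. x * Oct (ZS (- 1) (- 1)) 1 0 (ZS (- 1) (- 1)))"
    by (rule column_ideal_principal[where ?x1.0 = "Oct (ZS (- 2) 1) (ZS (- 3) 2) 0 (ZS (- 1) 1)"
        and ?x2.0 = "Oct (ZS 3 (- 2)) (ZS 2 (- 2)) (ZS 1 (- 1)) (ZS 2 (- 1))"
        and ?x3.0 = "Oct (ZS 1 (- 1)) (ZS 1 (- 1)) (ZS 1 (- 1)) (ZS 2 (- 1))"
        and ?x4.0 = "Oct (ZS 3 (- 2)) (ZS 3 (- 2)) 0 (ZS 1 (- 1))"])
      (simp_all add: h_defs two_dvd_zs2 zs2_sel_mult oct_eq_iff times_oct_def zs2_eq_iff)
  show "column_ideal (2 * r2) = range (\<lambda>x. x * Oct (ZS (- 1) (- 1)) (ZS (- 1) (- 1)) (ZS (- 1) (- 1)) 0)"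
    by (rule column_ideal_principal[where ?x1.0 = "Oct (ZS 5 (- 4)) (ZS 3 (- 2)) (ZS 3 (- 2)) 0"
        and ?x2.0 = "Oct (ZS (- 3) 2) (ZS 1 (- 1)) 0 (ZS 3 (- 2))"
        and ?x3.0 = "Oct (ZS 1 (- 1)) 0 0 0"
        and ?x4.0 = "Oct (ZS 3 (- 2)) 0 0 (ZS (- 3) 2)"])
      (simp_all add: h_defs two_r2_dvd_iff zs2_sel_mult oct_eq_iff times_oct_def zs2_eq_iff)
qed

text \<open>The product of sqrt 2 and 1 + sqrt 2. Reduced norms are totally positive, so sqrt 2
  itself, having a negative conjugate, cannot be one.\<close>

definition pi2 :: zs2 where "pi2 = ZS 2 1"

lemma card_reps_column_ideal:
  assumes "column_ideal s = range (\<lambda>x. x * \<rho>)" "nn \<rho> = \<nu>" "\<nu> \<noteq> 0"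
  shows "card (reps (\<nu> * \<alpha>) \<inter> column_ideal s) = rO \<alpha>" "\<not> \<nu> dvd \<beta> \<Longrightarrow> card (reps \<beta> \<inter> column_ideal s) = 0"
proof -
  have \<rho>0: "\<rho> \<noteq> 0" using assms(2,3) by auto
  have "(\<lambda>x. x * \<rho>) ` reps \<alpha> = reps (\<nu> * \<alpha>) \<inter> column_ideal s"
    unfolding assms(1) using assms(2,3) by (auto simp: reps_def mult.commute)
  moreover have "inj_on (\<lambda>x. x * \<rho>) (reps \<alpha>)"
    by (intro inj_onI) (simp add: oct_mult_right_cancel[OF \<rho>0])
  ultimately show "card (reps (\<nu> * \<alpha>) \<inter> column_ideal s) = rO \<alpha>" unfolding rO_def by (metis card_image)
  assume "\<not> \<nu> dvd \<beta>"
  hence "reps \<beta> \<inter> column_ideal s = {}" unfolding assms(1) by (auto simp: reps_def assms(2))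
  thus "card (reps \<beta> \<inter> column_ideal s) = 0" by simp
qed

definition rG :: "zs2 \<Rightarrow> nat" where "rG \<alpha> = card {x \<in> reps \<alpha>. 2 * r2 dvd h21 x}"

lemma rG_rO:
  "48 * rG \<alpha> = 4 * rO \<alpha> + 4 * card (reps \<alpha> \<inter> column_ideal r2) + 8 * card (reps \<alpha> \<inter> column_ideal 2)
     + 32 * card (reps \<alpha> \<inter> column_ideal (2 * r2))"
proof -
  \<comment> \<open>Left multiplication by a unit of norm 1 permutes the elements of norm \<alpha>,
    so every unit sees the same number of elements of the lattice.\<close>
  have trans: "card {x \<in> reps \<alpha>. 2 * r2 dvd h21 (u * x)} = rG \<alpha>" if "u \<in> reps 1" for u
  proof -
    have u: "nn u = 1" using that by (simp add: reps_def)
    hence inv: "qcnj u * u = 1" "u * qcnj u = 1" by (simp_all add: qcnj_mult mult_qcnj scal_simps)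
    have "bij_betw (\<lambda>x. u * x) {x \<in> reps \<alpha>. 2 * r2 dvd h21 (u * x)} {x \<in> reps \<alpha>. 2 * r2 dvd h21 x}"
      by (rule bij_betwI[where g = "\<lambda>x. qcnj u * x"])
        (use u inv in \<open>auto simp: reps_def mult.assoc[symmetric]\<close>)
    thus ?thesis by (simp add: rG_def bij_betw_same_card)
  qed
  \<comment> \<open>The lower left entry of a product is the lower row of \<open>u\<close> applied
    to the first column of \<open>x\<close>, which is why the count over units depends on that
    column alone.\<close>
  have iff: "2 * r2 dvd h21 (u * x) \<longleftrightarrow> 2 * r2 dvd h21 u * h11 x + h22 u * h21 x" for u x
    using h_mult(3)[of u x] by (metis add_diff_cancel_left' diff_add_cancel dvd_add dvd_diff)
  have "48 * rG \<alpha> = (\<Sum>u\<in>reps 1. card {x \<in> reps \<alpha>. 2 * r2 dvd h21 (u * x)})"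
    using rO_one by (simp add: trans rO_def)
  also have "\<dots> = (\<Sum>u\<in>reps 1. \<Sum>x\<in>reps \<alpha>. if 2 * r2 dvd h21 (u * x) then 1 else 0)"
    by (simp add: sum.If_cases Int_def)
  also have "\<dots> = (\<Sum>x\<in>reps \<alpha>. \<Sum>u\<in>reps 1. if 2 * r2 dvd h21 (u * x) then 1 else 0)" by (rule sum.swap)
  also have "\<dots> = (\<Sum>x\<in>reps \<alpha>. card {u \<in> reps 1. 2 * r2 dvd h21 u * h11 x + h22 u * h21 x})"
    by (simp add: sum.If_cases Int_def iff)
  also have "\<dots> = (\<Sum>x\<in>reps \<alpha>. 4 + (if x \<in> column_ideal r2 then 4 else 0) + (if x \<in> column_ideal 2 then 8 else 0)
      + (if x \<in> column_ideal (2 * r2) then 32 else 0))"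
    by (simp add: card_units_annihilating column_ideal_def)
  also have "\<dots> = 4 * rO \<alpha> + 4 * card (reps \<alpha> \<inter> column_ideal r2) + 8 * card (reps \<alpha> \<inter> column_ideal 2)
     + 32 * card (reps \<alpha> \<inter> column_ideal (2 * r2))"
    by (simp add: sum.distrib sum.If_cases rO_def)
  finally show ?thesis .
qed

lemma prime_pi2: "prime_elem pi2" "pi2 dvd r2" "totpos pi2"
proof -
  have "r2 = pi2 * ZS (- 1) 1" "pi2 = r2 * ZS 1 1" by (simp_all add: pi2_def zs2_eq_iff zs2_sel_mult)
  thus "pi2 dvd r2" by (metis dvd_triv_left)
  have "ZS 1 1 dvd 1" by (simp add: unit_iff_fnorm fnorm_def)
  from prime_elem_unit_mult[OF prime_elem_r2 this] show "prime_elem pi2"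
    using \<open>pi2 = r2 * ZS 1 1\<close> by (simp add: mult.commute)
  show "totpos pi2" by (simp add: totpos_def pi2_def fnorm_def)
qed

lemma pi2_power_dvd_iff: "pi2 ^ k dvd x \<longleftrightarrow> r2 ^ k dvd x"
proof -
  have "r2 dvd pi2" using prime_pi2 prime_dvd_r2_iff by blast
  hence "r2 ^ k dvd pi2 ^ k" "pi2 ^ k dvd r2 ^ k" using prime_pi2(2) by (simp_all add: dvd_power_same)
  thus ?thesis using dvd_trans[of "r2 ^ k" "pi2 ^ k" x] dvd_trans[of "pi2 ^ k" "r2 ^ k" x] by blast
qed

text \<open>Removing k factors 2 + sqrt 2 lowers the valuation by k and leaves the odd divisor sum
  unchanged; when k exceeds the valuation, no element of the ideal can have norm \<alpha>.\<close>

lemma card_column_ideal_formula: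
  assumes \<alpha>: "totpos \<alpha>" "has_val \<alpha> e"
    and s: "column_ideal s = range (\<lambda>x. x * \<rho>)" "nn \<rho> = pi2 ^ k"
  shows "int (card (reps \<alpha> \<inter> column_ideal s)) = (if k \<le> e then 48 * (2 ^ (e - k + 1) - 1) * int (odd_sigma \<alpha>) else 0)"
proof (cases "k \<le> e")
  case True
  have pk0: "pi2 ^ k \<noteq> 0" using prime_pi2(3) totpos_nonzero by simp
  have strip: "\<exists>\<beta>. \<alpha> = pi2 ^ k * \<beta> \<and> totpos \<beta> \<and> has_val \<beta> (e - k) \<and> odd_sigma \<beta> = odd_sigma \<alpha>"
    if "k \<le> e" for k using that
  proof (induction k)
    case 0
    show ?case using \<alpha> by simp
  next
    case (Suc k)
    then obtain \<beta> where \<beta>: "\<alpha> = pi2 ^ k * \<beta>" "totpos \<beta>" "has_val \<beta> (e - k)" "odd_sigma \<beta> = odd_sigma \<alpha>" by auto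
    have "r2 ^ 1 dvd r2 ^ (e - k)" using Suc.prems by (intro le_imp_power_dvd) simp
    also have "r2 ^ (e - k) dvd \<beta>" using \<beta>(3) by (simp add: has_val_def)
    finally have "pi2 ^ 1 dvd \<beta>" unfolding pi2_power_dvd_iff .
    then obtain \<gamma> where \<gamma>: "\<beta> = pi2 * \<gamma>" by (auto elim!: dvdE)
    obtain f where "e - k = Suc f" "has_val \<gamma> f"
      using has_val_ramified[OF prime_pi2(1,2)] \<beta>(3) \<gamma> by blast
    hence "has_val \<gamma> (e - Suc k)" by (metis Suc_diff_Suc Suc.prems Suc_le_lessD diff_Suc_Suc diff_Suc_1 Suc_le_eq)
    moreover have "totpos \<gamma>" using totpos_mult_cancel[OF prime_pi2(3)] \<beta>(2) \<gamma> by simp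
    moreover have "odd_sigma \<gamma> = odd_sigma \<alpha>" using odd_sigma_ramified[OF prime_pi2(1,2), of \<gamma>] \<beta>(4) \<gamma> by simp
    moreover have "\<alpha> = pi2 ^ Suc k * \<gamma>" using \<beta>(1) \<gamma> by (simp add: ac_simps)
    ultimately show ?case by blast
  qed
  from strip[OF True] obtain \<beta> where \<beta>: "\<alpha> = pi2 ^ k * \<beta>" "totpos \<beta>" "has_val \<beta> (e - k)" "odd_sigma \<beta> = odd_sigma \<alpha>" by blast
  have "card (reps \<alpha> \<inter> column_ideal s) = rO \<beta>"
    unfolding \<beta>(1) by (rule card_reps_column_ideal[OF s pk0])
  thus ?thesis using rO_formula[OF \<beta>(2,3)] True by (simp add: rO_one \<beta>(4))
next
  case False
  have pk0: "pi2 ^ k \<noteq> 0" using prime_pi2(3) totpos_nonzero by simp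
  have "\<not> pi2 ^ k dvd \<alpha>"
  proof
    assume "pi2 ^ k dvd \<alpha>"
    hence "r2 ^ k dvd \<alpha>" by (simp only: pi2_power_dvd_iff)
    moreover have "r2 ^ (e + 1) dvd r2 ^ k" using False by (intro le_imp_power_dvd) simp
    ultimately have "r2 ^ (e + 1) dvd \<alpha>" using dvd_trans by blast
    thus False using \<alpha>(2) by (simp add: has_val_def)
  qed
  from card_reps_column_ideal(2)[OF s pk0 this] show ?thesis using False by simp
qed

lemma rG_formula:
  assumes \<alpha>: "totpos \<alpha>" "has_val \<alpha> e"
  shows "int (rG \<alpha>) = 4 * int (odd_sigma \<alpha>) *
    (if e = 0 then 1 else if e = 1 then 2 * 2 else if e = 2 then 3 * 2 ^ 2
     else 2 * (\<Sum>k = 2..e. 2 ^ k) + 2 * 2 ^ e - 2 ^ 2)"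
proof -
  define S where "S = int (odd_sigma \<alpha>)"
  have nn: "nn (Oct 0 0 (- 1) (- 1)) = pi2 ^ 1" "nn (Oct (ZS (- 1) (- 1)) 1 0 (ZS (- 1) (- 1))) = pi2 ^ 2"
    "nn (Oct (ZS (- 1) (- 1)) (ZS (- 1) (- 1)) (ZS (- 1) (- 1)) 0) = pi2 ^ 3"
    by (simp_all add: nn_def pi2_def zs2_eq_iff zs2_sel_mult power2_eq_square power3_eq_cube)
  note a = card_column_ideal_formula[OF \<alpha> column_ideals(1) nn(1), folded S_def]
    card_column_ideal_formula[OF \<alpha> column_ideals(2) nn(2), folded S_def]
    card_column_ideal_formula[OF \<alpha> column_ideals(3) nn(3), folded S_def]
  have r: "int (rO \<alpha>) = 48 * (2 ^ (e + 1) - 1) * S" using rO_formula[OF \<alpha>] by (simp add: rO_one S_def)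
  have "int (48 * rG \<alpha>) = int (4 * rO \<alpha> + 4 * card (reps \<alpha> \<inter> column_ideal r2) + 8 * card (reps \<alpha> \<inter> column_ideal 2)
     + 32 * card (reps \<alpha> \<inter> column_ideal (2 * r2)))"
    by (simp only: rG_rO)
  hence main: "48 * int (rG \<alpha>) = 4 * (48 * (2 ^ (e + 1) - 1) * S)
      + 4 * (if 1 \<le> e then 48 * (2 ^ (e - 1 + 1) - 1) * S else 0)
      + 8 * (if 2 \<le> e then 48 * (2 ^ (e - 2 + 1) - 1) * S else 0)
      + 32 * (if 3 \<le> e then 48 * (2 ^ (e - 3 + 1) - 1) * S else 0)"
    by (simp only: of_nat_add of_nat_mult of_nat_numeral a r)
  have geom: "(\<Sum>k = 2..e. (2 :: int) ^ k) = 2 * 2 ^ e - 4" if "e \<ge> 3" for e :: nat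
    using that by (induction e rule: dec_induct) (simp_all add: numeral_eq_Suc)
  consider "e = 0" | "e = 1" | "e = 2" | f where "e = f + 3"
    by (metis One_nat_def Suc_1 add.commute le_add_diff_inverse less_2_cases not_less_eq_eq numeral_3_eq_3 le_antisym not_less_eq less_Suc_eq not_le)
  thus ?thesis
  proof cases
    case (4 f)
    have g: "(\<Sum>k = 2..f + 3. (2 :: int) ^ k) = 16 * 2 ^ f - 4" using geom[of "f + 3"] by (simp add: power_add)
    \<comment> \<open>For e \<ge> 3 all four terms contribute, and the bracket equals 6 * 2^e - 12
      with 2^e = 8 * 2^f.\<close>
    have "48 * int (rG \<alpha>) = 48 * (4 * S * (2 * (16 * 2 ^ f - 4) + 2 * (8 * 2 ^ f) - 4))"
      using main unfolding 4 by (simp add: power_add algebra_simps)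
    thus ?thesis unfolding 4 S_def[symmetric] by (simp add: g power_add)
  qed (use main in \<open>simp_all add: S_def\<close>)
qed


section \<open>Ideals of the ring of integers\<close>

lemma OK_eq_range_emb: "OK = range emb"
proof
  show "OK \<subseteq> range emb"
  proof
    fix x assume "x \<in> OK"
    then obtain a b :: int where "x = of_int a + of_int b * sqrt 2"
      unfolding OK_eq_Zsqrt2 by (auto elim!: Ints_cases)
    hence "x = emb (ZS a b)" by (simp add: emb_def)
    thus "x \<in> range emb" by blast
  qed
  show "range emb \<subseteq> OK" unfolding OK_eq_Zsqrt2 emb_def by (blast intro: Ints_of_int)
qed

lemma inj_emb: "inj emb"
  by (intro injI) (simp add: emb_inj)

lemma emb_mem_image [simp]: "emb x \<in> emb ` A \<longleftrightarrow> x \<in> A"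
  using inj_emb by (auto simp: emb_inj)

lemma PIdl_emb: "PIdl\<^bsub>OK_ring\<^esub> (emb \<delta>) = emb ` multiples \<delta>"
proof -
  have "PIdl\<^bsub>OK_ring\<^esub> (emb \<delta>) = {emb x * emb \<delta> | x. True}"
    unfolding cgenideal_def by (auto simp: OK_eq_range_emb)
  also have "\<dots> = emb ` multiples \<delta>"
    by (auto simp: multiples_def mult.commute elim!: dvdE simp flip: emb_mult)
  finally show ?thesis .
qed

lemma ideal_multiples: "ideal (emb ` multiples \<delta>) OK_ring"
proof -
  interpret cring OK_ring by (rule cring_OK)
  have "emb \<delta> \<in> carrier OK_ring" by (simp add: OK_eq_range_emb)
  thus ?thesis using cgenideal_ideal PIdl_emb by metis
qed

lemma ideal_OK_principal:
  assumes I: "ideal I OK_ring"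
  obtains \<delta> where "I = emb ` multiples \<delta>"
proof -
  interpret ideal I OK_ring by (rule I)
  interpret cring OK_ring by (rule cring_OK)
  define J where "J = {x. emb x \<in> I}"
  have IJ: "I = emb ` J"
  proof -
    have "I \<subseteq> range emb" using a_subset by (simp add: OK_eq_range_emb)
    thus ?thesis by (auto simp: J_def)
  qed
  have add: "x + y \<in> J" if "x \<in> J" "y \<in> J" for x y
    using that additive_subgroup.a_closed[OF is_additive_subgroup, of "emb x" "emb y"] by (simp add: J_def)
  have mult: "a * x \<in> J" if "x \<in> J" for a x
    using that I_l_closed[of "emb x" "emb a"] by (simp add: J_def OK_eq_range_emb)
  have zero: "0 \<in> J"
    using additive_subgroup.zero_closed[OF is_additive_subgroup] by (simp add: J_def)
  have diff: "x - y \<in> J" if "x \<in> J" "y \<in> J" for x y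
    using add[OF that(1) mult[OF that(2), of "- 1"]] by simp
  have "\<exists>\<delta>. J = multiples \<delta>"
  proof (cases "J = {0}")
    case True
    thus ?thesis by (intro exI[of _ 0]) (simp add: multiples_def)
  next
    case False
    then obtain x0 where "x0 \<in> J" "x0 \<noteq> 0" using zero by blast
    then obtain d where d: "d \<in> J" "d \<noteq> 0" and min: "\<And>y. y \<in> J \<and> y \<noteq> 0 \<Longrightarrow> nat \<bar>fnorm d\<bar> \<le> nat \<bar>fnorm y\<bar>"
      using ex_has_least_nat[of "\<lambda>x. x \<in> J \<and> x \<noteq> 0" x0 "\<lambda>x. nat \<bar>fnorm x\<bar>"] by auto
    have "J = multiples d"
    proof
      show "multiples d \<subseteq> J" using mult[OF d(1)] by (auto simp: multiples_def mult.commute elim!: dvdE)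
      show "J \<subseteq> multiples d"
      proof
        fix c assume c: "c \<in> J"
        obtain q where q: "\<bar>fnorm (c - q * d)\<bar> < \<bar>fnorm d\<bar>" using zs2_division[OF d(2)] by blast
        have "c - q * d \<in> J" by (rule diff[OF c mult[OF d(1)]])
        with min[of "c - q * d"] q have "c - q * d = 0" by fastforce
        hence "c = d * q" by (simp add: mult.commute)
        thus "c \<in> multiples d" by (simp add: multiples_def)
      qed
    qed
    thus ?thesis by blast
  qed
  thus ?thesis using that IJ by blast
qed

lemma ideal_prod_multiples:
  "ideal_prod OK_ring (emb ` multiples \<delta>) (emb ` multiples \<epsilon>) = emb ` multiples (\<delta> * \<epsilon>)"
proof
  show "ideal_prod OK_ring (emb ` multiples \<delta>) (emb ` multiples \<epsilon>) \<subseteq> emb ` multiples (\<delta> * \<epsilon>)"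
  proof
    fix x assume "x \<in> ideal_prod OK_ring (emb ` multiples \<delta>) (emb ` multiples \<epsilon>)"
    thus "x \<in> emb ` multiples (\<delta> * \<epsilon>)"
    proof (induction rule: ideal_prod.induct)
      case (prod i j)
      then obtain a b where ab: "i = emb a" "j = emb b" "\<delta> dvd a" "\<epsilon> dvd b" by (auto simp: multiples_def)
      have "\<delta> * \<epsilon> dvd a * b" using ab(3,4) by (rule mult_dvd_mono)
      moreover have "i \<otimes>\<^bsub>OK_ring\<^esub> j = emb (a * b)" by (simp add: ab)
      ultimately show ?case by (simp only: emb_mem_image multiples_def mem_Collect_eq)
    next
      case (sum s1 s2)
      then obtain a b where ab: "s1 = emb a" "s2 = emb b" "\<delta> * \<epsilon> dvd a" "\<delta> * \<epsilon> dvd b" by (auto simp: multiples_def)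
      moreover have "s1 \<oplus>\<^bsub>OK_ring\<^esub> s2 = emb (a + b)" by (simp add: ab)
      ultimately show ?case by (simp only: emb_mem_image multiples_def mem_Collect_eq dvd_add)
    qed
  qed
  show "emb ` multiples (\<delta> * \<epsilon>) \<subseteq> ideal_prod OK_ring (emb ` multiples \<delta>) (emb ` multiples \<epsilon>)"
  proof (rule image_subsetI)
    fix x assume "x \<in> multiples (\<delta> * \<epsilon>)"
    hence "\<delta> * \<epsilon> dvd x" by (simp add: multiples_def)
    then obtain k where "x = \<delta> * \<epsilon> * k" by (elim dvdE)
    hence "x = \<delta> * (\<epsilon> * k)" by (simp only: mult.assoc)
    hence "emb x = emb \<delta> \<otimes>\<^bsub>OK_ring\<^esub> emb (\<epsilon> * k)" by simp
    moreover have "emb \<delta> \<otimes>\<^bsub>OK_ring\<^esub> emb (\<epsilon> * k) \<in> ideal_prod OK_ring (emb ` multiples \<delta>) (emb ` multiples \<epsilon>)"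
      by (rule ideal_prod.prod) (simp_all only: emb_mem_image multiples_def mem_Collect_eq dvd_refl dvd_triv_left)
    ultimately show "emb x \<in> ideal_prod OK_ring (emb ` multiples \<delta>) (emb ` multiples \<epsilon>)" by simp
  qed
qed

lemma emb_image_eq_iff: "emb ` A = emb ` B \<longleftrightarrow> A = B"
  by (rule inj_image_eq_iff[OF inj_emb])

lemma ideal_dvd_multiples:
  "ideal_dvd OK_ring (emb ` multiples \<delta>) (emb ` multiples \<alpha>) \<longleftrightarrow> \<delta> dvd \<alpha>"
proof
  assume "ideal_dvd OK_ring (emb ` multiples \<delta>) (emb ` multiples \<alpha>)"
  then obtain C where C: "ideal C OK_ring" "emb ` multiples \<alpha> = ideal_prod OK_ring (emb ` multiples \<delta>) C"
    unfolding ideal_dvd_def by blast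
  obtain \<gamma> where "C = emb ` multiples \<gamma>" using ideal_OK_principal[OF C(1)] .
  hence "multiples \<alpha> = multiples (\<delta> * \<gamma>)" using C(2) by (simp add: ideal_prod_multiples emb_image_eq_iff)
  thus "\<delta> dvd \<alpha>" unfolding multiples_eq_iff using dvd_mult_left by blast
next
  assume "\<delta> dvd \<alpha>"
  then obtain \<gamma> where "\<alpha> = \<delta> * \<gamma>" by (elim dvdE)
  thus "ideal_dvd OK_ring (emb ` multiples \<delta>) (emb ` multiples \<alpha>)"
    unfolding ideal_dvd_def using ideal_multiples ideal_prod_multiples by metis
qed

text \<open>Cosets in the quotient ring are the images under \<open>emb\<close> of the cosets
  counted by \<open>index\<close>, and \<open>emb\<close> is injective.\<close>

lemma ideal_norm_image: "ideal_norm OK_ring (emb ` J) = index J"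
proof -
  have coset: "emb ` J +>\<^bsub>OK_ring\<^esub> emb x = emb ` {y. y - x \<in> J}" for x
  proof -
    have "emb ` J +>\<^bsub>OK_ring\<^esub> emb x = (\<lambda>h. emb (h + x)) ` J"
      by (auto simp: a_r_coset_def')
    also have "\<dots> = emb ` {y. y - x \<in> J}"
    proof -
      have "(\<lambda>h. h + x) ` J = {y. y - x \<in> J}" by (auto simp: image_iff) (metis diff_add_cancel)
      hence "emb ` (\<lambda>h. h + x) ` J = emb ` {y. y - x \<in> J}" by (simp only:)
      thus ?thesis by (simp only: image_image)
    qed
    finally show ?thesis .
  qed
  have "carrier (OK_ring Quot (emb ` J)) = (\<lambda>x. emb ` J +>\<^bsub>OK_ring\<^esub> x) ` OK"
    by (auto simp: FactRing_def A_RCOSETS_def')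
  also have "\<dots> = range (\<lambda>x. emb ` J +>\<^bsub>OK_ring\<^esub> emb x)"
    by (subst (2) OK_eq_range_emb) (rule image_image)
  also have "\<dots> = (\<lambda>A. emb ` A) ` range (\<lambda>x. {y. y - x \<in> J})"
    by (simp only: coset image_image)
  finally have "carrier (OK_ring Quot (emb ` J)) = (\<lambda>A. emb ` A) ` range (\<lambda>x. {y. y - x \<in> J})" .
  moreover have "inj_on (\<lambda>A. emb ` A) B" for B by (intro inj_onI) (simp add: emb_image_eq_iff)
  ultimately show ?thesis by (simp add: ideal_norm_def index_def card_image)
qed

text \<open>All ideals are principal, so those in the sum correspond to divisors up to units, and
  divisibility of ideals is divisibility of generators.\<close>

lemma sum_ideal_norm:
  "(\<Sum>I | ideal I OK_ring \<and> ideal_dvd OK_ring I (PIdl\<^bsub>OK_ring\<^esub> (emb \<alpha>)) \<and> \<not> ideal_dvd OK_ring (PIdl\<^bsub>OK_ring\<^esub> (sqrt 2)) I.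
     int (ideal_norm OK_ring I)) = int (odd_sigma \<alpha>)"
proof -
  have "{I. ideal I OK_ring \<and> ideal_dvd OK_ring I (PIdl\<^bsub>OK_ring\<^esub> (emb \<alpha>)) \<and> \<not> ideal_dvd OK_ring (PIdl\<^bsub>OK_ring\<^esub> (sqrt 2)) I}
      = (\<lambda>J. emb ` J) ` odd_divisors \<alpha>" (is "?L = ?R")
  proof (intro subset_antisym subsetI)
    fix I assume I: "I \<in> ?L"
    then obtain \<delta> where \<delta>: "I = emb ` multiples \<delta>" using ideal_OK_principal by blast
    hence "\<delta> dvd \<alpha>" "\<not> r2 dvd \<delta>"
      using I PIdl_emb[of r2] by (simp_all add: PIdl_emb ideal_dvd_multiples)
    thus "I \<in> ?R" using \<delta> unfolding odd_divisors_def by blast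
  next
    fix I assume "I \<in> ?R"
    then obtain \<delta> where "I = emb ` multiples \<delta>" "\<delta> dvd \<alpha>" "\<not> r2 dvd \<delta>" unfolding odd_divisors_def by blast
    thus "I \<in> ?L" using PIdl_emb[of r2] by (simp add: PIdl_emb ideal_dvd_multiples ideal_multiples)
  qed
  moreover have "inj_on (\<lambda>J. emb ` J) (odd_divisors \<alpha>)" by (intro inj_onI) (simp add: emb_image_eq_iff)
  ultimately show ?thesis by (simp add: sum.reindex ideal_norm_image odd_sigma_def)
qed

section \<open>The lattice and the statement in coordinates\<close>

lemma G_eq: "G = to_quat ` {x. 2 * r2 dvd h21 x}"
proof -
  \<comment> \<open>With e1, e2, e3 the non-trivial basis elements of the maximal order, 2i = 2 sqrt
    2 e1 - 2, the third generator is e1 + e2 - sqrt 2, and the fourth is 1 + (1 - sqrt 2) e1 + e3.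
    The form \<open>h21\<close> vanishes on all generators but 2i, where it equals 2 sqrt 2.\<close>
  have comb: "emb a *\<^sub>R 1 + emb b *\<^sub>R (2 *\<^sub>R quat_i) + emb c *\<^sub>R G_basis3 + emb d *\<^sub>R G_basis4
    = to_quat (Oct (a - 2 * b - r2 * c + d) (2 * r2 * b + c + (1 - r2) * d) c d)" for a b c d
    by (simp add: to_quat_def G_basis3_def G_basis4_def quat_i_def quat_j_def quat_k_def quat_arith_defs)
      (simp add: field_simps)
  have "G = {to_quat (Oct (a - 2 * b - r2 * c + d) (2 * r2 * b + c + (1 - r2) * d) c d) | a b c d. True}"
    unfolding G_def OK_eq_range_emb comb[symmetric] by blast
  also have "\<dots> = to_quat ` {x. 2 * r2 dvd h21 x}"
  proof (intro subset_antisym subsetI)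
    fix q assume "q \<in> {to_quat (Oct (a - 2 * b - r2 * c + d) (2 * r2 * b + c + (1 - r2) * d) c d) | a b c d. True}"
    then obtain a b c d where q: "q = to_quat (Oct (a - 2 * b - r2 * c + d) (2 * r2 * b + c + (1 - r2) * d) c d)" by blast
    have "h21 (Oct (a - 2 * b - r2 * c + d) (2 * r2 * b + c + (1 - r2) * d) c d) = 2 * r2 * b"
      by (simp add: h21_def algebra_simps)
    thus "q \<in> to_quat ` {x. 2 * r2 dvd h21 x}" unfolding q by (intro imageI) simp
  next
    fix q assume "q \<in> to_quat ` {x. 2 * r2 dvd h21 x}"
    then obtain x b where x: "q = to_quat x" "h21 x = 2 * r2 * b" by (auto elim!: dvdE)
    have "x = Oct ((c0 x + 2 * b + r2 * c2 x - c3 x) - 2 * b - r2 * c2 x + c3 x) (2 * r2 * b + c2 x + (1 - r2) * c3 x) (c2 x) (c3 x)"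
      by (simp add: oct_eq_iff x(2)[symmetric]) (simp add: h21_def algebra_simps)
    with x(1) show "q \<in> {to_quat (Oct (a - 2 * b - r2 * c + d) (2 * r2 * b + c + (1 - r2) * d) c d) | a b c d. True}"
      by (intro CollectI exI[of _ "c0 x + 2 * b + r2 * c2 x - c3 x"] exI[of _ b] exI[of _ "c2 x"] exI[of _ "c3 x"]) simp
  qed
  finally show ?thesis .
qed

lemma r_G_emb: "r_G (emb \<alpha>) = rG \<alpha>"
proof -
  have "{q \<in> G. nrd q = emb \<alpha>} = to_quat ` {x \<in> reps \<alpha>. 2 * r2 dvd h21 x}"
    unfolding G_eq by (auto simp: nrd_to_quat emb_inj reps_def)
  moreover have "inj_on to_quat A" for A by (intro inj_onI) (simp add: to_quat_inj)
  ultimately show ?thesis by (simp add: r_G_def rG_def card_image)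
qed

lemma totally_positive_emb: "totally_positive Qsqrt2 (emb \<alpha>) \<longleftrightarrow> totpos \<alpha>"
  unfolding totpos_iff_emb emb_def cjg_sel
  by (subst totally_positive_Qsqrt2_iff) simp_all

lemma emb_mem_PIdl_r2_power: "emb \<alpha> \<in> PIdl\<^bsub>OK_ring\<^esub> (sqrt 2 ^ k) \<longleftrightarrow> r2 ^ k dvd \<alpha>"
  using PIdl_emb[of "r2 ^ k"] by (simp add: multiples_def)

theorem theorem3p34:
  fixes \<alpha> :: real and e :: nat
  assumes "\<alpha> \<in> OK"
    and "totally_positive Qsqrt2 \<alpha>"
    and "\<alpha> \<in> PIdl\<^bsub>OK_ring\<^esub> (sqrt 2 ^ e) - PIdl\<^bsub>OK_ring\<^esub> (sqrt 2 ^ (e + 1))"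
  shows "int (r_G \<alpha>) =
    4 * (\<Sum>I | ideal I OK_ring \<and> ideal_dvd OK_ring I (PIdl\<^bsub>OK_ring\<^esub> \<alpha>) \<and>
               \<not> ideal_dvd OK_ring (PIdl\<^bsub>OK_ring\<^esub> (sqrt 2)) I.
           int (ideal_norm OK_ring I)) *
    (if e = 0 then 1
     else if e = 1 then 2 * 2
     else if e = 2 then 3 * 2 ^ 2
     else 2 * (\<Sum>k = 2..e. 2 ^ k) + 2 * 2 ^ e - 2 ^ 2)"
proof -
  from assms(1) obtain a where a: "\<alpha> = emb a" unfolding OK_eq_range_emb by blast
  have "totpos a" using assms(2) by (simp add: a totally_positive_emb)
  moreover have "has_val a e"
    using assms(3) unfolding a by (simp add: has_val_def emb_mem_PIdl_r2_power del: power_Suc)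
  ultimately show ?thesis unfolding a r_G_emb sum_ideal_norm by (rule rG_formula)
qed

end
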